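(* Let $K/F$ be a fully computable infinite Galois extension, with associated sub-extensions $F\subseteq K_0\subseteq K_1\subseteq\cdots\subseteq K$ and groups $G_i=\mathrm{Gal}(K_i/F)$, and let $C\subseteq\omega$ be a cohesive set. Then $$\mathrm{HAut}\Big(\prod_CK/\prod_CF\Big)\cong\varprojlim_{N\in\prod_C\mathbb{N}}\mathrm{HAut}\Big(\prod_{C,N}K_i/\prod_CF\Big)\cong\varprojlim_{N\in\prod_C\mathbb{N}}\prod_{C,N}G_i.$$
   Context: For $A,B\subseteq\omega$, $A\subseteq^* B$ means $A\setminus B$ is finite. A set $C\subseteq\omega$ is cohesive if it is infinite and for every c.e. set $W$ either $C\subseteq^*W$ or $C\subseteq^*\overline{W}$. A sequence of structures is uniformly computable if their domains $\subseteq\omega$ and atomic diagrams are computable uniformly in $i$; for finite groups $G_i$ this is understood to mean that the complete finite list of elements and the multiplication table of $G_i$ are computable from $i$. The cohesive product $\prod_C\mathcal A_i$ has as domain the classes $[\varphi]$ of partial computable functions $\varphi$ with $\varphi(i)\in\mathcal A_i$ whenever $\varphi(i){\downarrow}$ and $C\subseteq^*\mathrm{dom}(\varphi)$, where $[\varphi]=[\psi]$ iff $C\subseteq^*\{i:\varphi(i){\downarrow}=\psi(i){\downarrow}\}$; operations are pointwise and a relation holds iff it holds at $i$ for almost every $i\in C$. The same definition is used for partial sequences $\{\mathcal A_i\}_{i\in W}$ with $W$ c.e. and $C\subseteq^*W$. The product of a constant sequence is the cohesive power; $\prod_C\mathbb{N}$ is linearly ordered. Brackets are omitted from elements. For $N\in\prod_C\mathbb{N}$,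 $\prod_{C,N}\mathcal A_i:=\prod_C\mathcal A_{N(i)}$. Field extensions are presented as triples $(K,F,\Psi)$ with $\Psi:F\to K$ a computable ring homomorphism between computable fields. A Galois extension $K/F$ is fully computable if: (1) $(K,F,\Psi)$ is a computable Galois extension; (2) there are uniformly computable finite Galois sub-extensions $K_i\subseteq K$ of $F$, with $(K,K_i,\Psi_i)$ and $(K_{i+1},K_i,\Phi_i)$ uniformly computable and $K=\bigcup_iK_i$; (3) the groups $G_i=\mathrm{Gal}(K_i/F)$ are uniformly computable; (4) the quotient (restriction) maps $f_{m,n}:G_m\to G_n$, $n<m$, are uniformly computable; (5) the actions $G_i\curvearrowright K_i$ are uniformly computable; (6) $K_i\subsetneq K_{i+1}$. For $N\le M$ in $\prod_C\mathbb{N}$, $\prod_CF\subseteq\prod_{C,N}K_i\subseteq\prod_{C,M}K_i\subseteq\prod_CK$. The transition maps $f_{M,N}:\prod_{C,M}G_i\to\prod_{C,N}G_i$ ($N<M$) are $f_{M,N}(g)(i)=f_{M(i),N(i)}(g(i))$; those between the $\mathrm{HAut}$ groups are restriction maps. For a structure $\mathcal A$, $\mathcal T_{\mathcal A}=(\mathcal A^{<\omega},\preceq,{}^\wedge)$ is the tree of finite tuples with extension order and concatenation. For $\vec a\in\prod_C\mathcal T_{\mathcal A_i}$, the arity $|\vec a|\in\prod_C\mathbb{N}$ is $i\mapsto|\vec a(i)|$. $\mathrm{HAut}(\prod_C\mathcal T_{\mathcal A_i})$ is the group of automorphisms $\sigma$ of $(\prod_C\mathcal T_{\mathcal A_i},\preceq,{}^\wedge)$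 with $|\sigma\vec a|=|\vec a|$ for all $\vec a$. Elements of $\prod_C\mathcal A_i$ are identified with elements of arity $1$. Elements $p\in\prod_C(\mathbb{Z}[x_1,x_2,\dots])$ are integral hyper-polynomials ($\mathbb{Z}[x_1,x_2,\dots]$ being presented so that degrees and coefficients are computable); $\mathrm{var}(p)\in\prod_C\mathbb{N}$ is $i\mapsto$ the largest index of a variable occurring in $p(i)$. For uniformly computable fields $L_i\supseteq F$ and $\vec a\in\prod_C\mathcal T_{L_i}$ with $|\vec a|=\mathrm{var}(p)$, $p(\vec a)\in\prod_CL_i$ is $i\mapsto p(i)(\vec a(i))$. $\mathrm{HAut}(\prod_CL_i)$ is the group of $\sigma\in\mathrm{HAut}(\prod_C\mathcal T_{L_i})$ with $p(\sigma(\vec a))=\sigma(p(\vec a))$ for all integral hyper-polynomials $p$ and all $\vec a\in\prod_C\mathcal T_{L_i}$ with $|\vec a|=\mathrm{var}(p)$, and $\mathrm{HAut}(\prod_CL_i/\prod_CF)$ is its subgroup of those $\sigma$ with $\sigma(\vec a)=\vec a$ for all $\vec a\in\prod_C\mathcal T_F$. (Applied to $L_i=K$ and to $L_i=K_{N(i)}$.) *)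

theory Defs
  imports
    "HOL-Algebra.Algebra"
    "HOL-Library.Nat_Bijection"
    "HOL-Library.Monad_Syntax"
    "HOL-Library.Sublist"
    "HOL-Library.Poly_Mapping"
begin

section \<open>Computability on the natural numbers\<close>

text \<open>
  Kleene's partial recursive functions. Functions of several arguments are reduced to unary ones
  by the pairing function \<^const>\<open>prod_encode\<close>; everywhere below, an argument list \<open>x\<^sub>1, \<dots>, x\<^sub>n\<close> is
  passed as \<open>list_encode [x\<^sub>1, \<dots>, x\<^sub>n]\<close>.
\<close>

inductive partial_recursive :: "(nat \<Rightarrow> nat option) \<Rightarrow> bool" where
  zero: "partial_recursive (\<lambda>n. Some 0)"
| succ: "partial_recursive (\<lambda>n. Some (Suc n))"
| left: "partial_recursive (\<lambda>n. Some (fst (prod_decode n)))"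
| right: "partial_recursive (\<lambda>n. Some (snd (prod_decode n)))"
| pair: "partial_recursive f \<Longrightarrow> partial_recursive g \<Longrightarrow>
    partial_recursive (\<lambda>n. Option.bind (f n) (\<lambda>x. Option.bind (g n) (\<lambda>y. Some (prod_encode (x, y)))))"
| comp: "partial_recursive f \<Longrightarrow> partial_recursive g \<Longrightarrow>
    partial_recursive (\<lambda>n. Option.bind (g n) f)"
| prec: "partial_recursive f \<Longrightarrow> partial_recursive g \<Longrightarrow>
    partial_recursive (\<lambda>n. case prod_decode n of (a, k) \<Rightarrow>
      rec_nat (f a) (\<lambda>j r. Option.bind r (\<lambda>y. g (prod_encode (a, prod_encode (j, y))))) k)"
| mu: "partial_recursive f \<Longrightarrow>
    partial_recursive (\<lambda>n.
      if \<exists>k. f (prod_encode (n, k)) = Some 0 \<and> (\<forall>j<k. f (prod_encode (n, j)) \<noteq> None)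
      then Some (LEAST k. f (prod_encode (n, k)) = Some 0) else None)"

definition ce_set :: "nat set \<Rightarrow> bool" where
  "ce_set W \<longleftrightarrow> (\<exists>\<phi>. partial_recursive \<phi> \<and> W = dom \<phi>)"

definition almost_subset :: "nat set \<Rightarrow> nat set \<Rightarrow> bool" (infix \<open>\<subseteq>*\<close> 50) where
  "A \<subseteq>* B \<longleftrightarrow> finite (A - B)"

definition cohesive :: "nat set \<Rightarrow> bool" where
  "cohesive C \<longleftrightarrow> infinite C \<and> (\<forall>W. ce_set W \<longrightarrow> C \<subseteq>* W \<or> C \<subseteq>* - W)"


section \<open>Uniformly computable sequences of structures\<close>

definition uniformly_computable_sets :: "(nat \<Rightarrow> nat set) \<Rightarrow> bool" where
  "uniformly_computable_sets D \<longleftrightarrow>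
    (\<exists>\<phi>. partial_recursive \<phi> \<and> (\<forall>i x. \<phi> (list_encode [i, x]) = Some (of_bool (x \<in> D i))))"

definition uniformly_computable_maps :: "(nat \<Rightarrow> nat set) \<Rightarrow> (nat \<Rightarrow> nat \<Rightarrow> nat) \<Rightarrow> bool" where
  "uniformly_computable_maps D f \<longleftrightarrow>
    (\<exists>\<phi>. partial_recursive \<phi> \<and> (\<forall>i. \<forall>x\<in>D i. \<phi> (list_encode [i, x]) = Some (f i x)))"

definition uniformly_computable_binops :: "(nat \<Rightarrow> nat set) \<Rightarrow> (nat \<Rightarrow> nat \<Rightarrow> nat \<Rightarrow> nat) \<Rightarrow> bool" where
  "uniformly_computable_binops D f \<longleftrightarrow>
    (\<exists>\<phi>. partial_recursive \<phi> \<and>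
      (\<forall>i. \<forall>x\<in>D i. \<forall>y\<in>D i. \<phi> (list_encode [i, x, y]) = Some (f i x y)))"

definition uniformly_computable_elements :: "(nat \<Rightarrow> nat) \<Rightarrow> bool" where
  "uniformly_computable_elements c \<longleftrightarrow> partial_recursive (\<lambda>i. Some (c i))"

definition uniformly_computable_fields :: "(nat \<Rightarrow> nat ring) \<Rightarrow> bool" where
  "uniformly_computable_fields R \<longleftrightarrow>
    (\<forall>i. field (R i)) \<and>
    uniformly_computable_sets (\<lambda>i. carrier (R i)) \<and>
    uniformly_computable_binops (\<lambda>i. carrier (R i)) (\<lambda>i x y. x \<oplus>\<^bsub>R i\<^esub> y) \<and>
    uniformly_computable_binops (\<lambda>i. carrier (R i)) (\<lambda>i x y. x \<otimes>\<^bsub>R i\<^esub> y) \<and>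
    uniformly_computable_elements (\<lambda>i. \<zero>\<^bsub>R i\<^esub>) \<and>
    uniformly_computable_elements (\<lambda>i. \<one>\<^bsub>R i\<^esub>)"

abbreviation computable_field :: "nat ring \<Rightarrow> bool" where
  "computable_field R \<equiv> uniformly_computable_fields (\<lambda>_. R)"

text \<open>For finite groups the complete list of elements, not only the domain, is computed from \<open>i\<close>.\<close>

definition uniformly_computable_finite_groups :: "(nat \<Rightarrow> nat monoid) \<Rightarrow> bool" where
  "uniformly_computable_finite_groups G \<longleftrightarrow>
    (\<forall>i. group (G i)) \<and>
    (\<exists>\<phi>. partial_recursive \<phi> \<and>
      (\<forall>i. \<exists>xs. \<phi> i = Some (list_encode xs) \<and> set xs = carrier (G i))) \<and>
    uniformly_computable_binops (\<lambda>i. carrier (G i)) (\<lambda>i x y. x \<otimes>\<^bsub>G i\<^esub> y)"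


section \<open>Galois extensions\<close>

text \<open>The group \<open>Gal(K/F)\<close> for a subset \<open>F\<close> of the carrier of \<open>K\<close>.\<close>

definition galois_group :: "('a, 'b) ring_scheme \<Rightarrow> 'a set \<Rightarrow> ('a \<Rightarrow> 'a) monoid" where
  "galois_group K F = (BijGroup (carrier K))
     \<lparr>carrier := {\<sigma> \<in> Bij (carrier K). \<sigma> \<in> ring_hom K K \<and> (\<forall>x\<in>F. \<sigma> x = x)}\<rparr>"

text \<open>An algebraic extension is Galois if \<open>F\<close> is the fixed field of \<open>Gal(K/F)\<close>.\<close>

definition galois_extension :: "('a, 'b) ring_scheme \<Rightarrow> 'a set \<Rightarrow> bool" where
  "galois_extension K F \<longleftrightarrow>
    field K \<and> subfield F K \<and> (\<forall>x\<in>carrier K. ring.algebraic K F x) \<and>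
    {x \<in> carrier K. \<forall>\<sigma>\<in>carrier (galois_group K F). \<sigma> x = x} = F"

text \<open>
  The embeddings \<open>\<Phi> i : K\<^sub>i \<rightarrow> K\<^sub>i\<^sub>+\<^sub>1\<close> compose to \<open>tower_map \<Phi> n m : K\<^sub>n \<rightarrow> K\<^sub>m\<close> for \<open>n \<le> m\<close>.
\<close>

definition tower_map :: "(nat \<Rightarrow> nat \<Rightarrow> nat) \<Rightarrow> nat \<Rightarrow> nat \<Rightarrow> nat \<Rightarrow> nat" where
  "tower_map \<Phi> n m = fold \<Phi> [n..<m]"

text \<open>
  A fully computable Galois extension \<open>(K, F, \<Psi>)\<close> with its associated data: the sub-extensions
  \<open>Ks i\<close> of \<open>F\<close>, presented by \<open>\<Theta> i : F \<rightarrow> Ks i\<close>, embedded by \<open>\<Psi>s i : Ks i \<rightarrow> K\<close> and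
  \<open>\<Phi> i : Ks i \<rightarrow> Ks (i + 1)\<close>; the groups \<open>G i\<close>, identified with \<open>Gal(Ks i/F)\<close> through the
  actions \<open>act i\<close>; the restriction maps \<open>res m n : G m \<rightarrow> G n\<close>.
\<close>

locale fully_computable_galois =
  fixes F K :: "nat ring" and \<Psi> :: "nat \<Rightarrow> nat"
    and Ks :: "nat \<Rightarrow> nat ring" and \<Theta> \<Psi>s \<Phi> :: "nat \<Rightarrow> nat \<Rightarrow> nat"
    and G :: "nat \<Rightarrow> nat monoid" and res :: "nat \<Rightarrow> nat \<Rightarrow> nat \<Rightarrow> nat"
    and act :: "nat \<Rightarrow> nat \<Rightarrow> nat \<Rightarrow> nat"
  assumes computable_F: "computable_field F"
    and computable_K: "computable_field K"
    and \<Psi>_hom: "\<Psi> \<in> ring_hom F K"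
    and computable_\<Psi>: "uniformly_computable_maps (\<lambda>_. carrier F) (\<lambda>_. \<Psi>)"
    and galois_K: "galois_extension K (\<Psi> ` carrier F)"
    and computable_Ks: "uniformly_computable_fields Ks"
    and \<Theta>_hom: "\<And>i. \<Theta> i \<in> ring_hom F (Ks i)"
    and computable_\<Theta>: "uniformly_computable_maps (\<lambda>_. carrier F) \<Theta>"
    and finite_Ks: "\<And>i. ring.finite_dimension (Ks i) (\<Theta> i ` carrier F) (carrier (Ks i))"
    and galois_Ks: "\<And>i. galois_extension (Ks i) (\<Theta> i ` carrier F)"
    and \<Psi>s_hom: "\<And>i. \<Psi>s i \<in> ring_hom (Ks i) K"
    and computable_\<Psi>s: "uniformly_computable_maps (\<lambda>i. carrier (Ks i)) \<Psi>s"
    and \<Psi>s_\<Theta>: "\<And>i x. x \<in> carrier F \<Longrightarrow> \<Psi>s i (\<Theta> i x) = \<Psi> x"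
    and \<Phi>_hom: "\<And>i. \<Phi> i \<in> ring_hom (Ks i) (Ks (Suc i))"
    and computable_\<Phi>: "uniformly_computable_maps (\<lambda>i. carrier (Ks i)) \<Phi>"
    and \<Psi>s_\<Phi>: "\<And>i x. x \<in> carrier (Ks i) \<Longrightarrow> \<Psi>s (Suc i) (\<Phi> i x) = \<Psi>s i x"
    and K_union: "carrier K = (\<Union>i. \<Psi>s i ` carrier (Ks i))"
    and computable_G: "uniformly_computable_finite_groups G"
    and G_galois: "\<And>i. (\<lambda>g. \<lambda>x\<in>carrier (Ks i). act i g x) \<in>
      iso (G i) (galois_group (Ks i) (\<Theta> i ` carrier F))"
    and res_hom: "\<And>m n. n < m \<Longrightarrow> res m n \<in> hom (G m) (G n)"
    and res_restrict: "\<And>m n g x. n < m \<Longrightarrow> g \<in> carrier (G m) \<Longrightarrow> x \<in> carrier (Ks n) \<Longrightarrow>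
      tower_map \<Phi> n m (act n (res m n g) x) = act m g (tower_map \<Phi> n m x)"
    and computable_res: "\<exists>\<phi>. partial_recursive \<phi> \<and>
      (\<forall>m n. \<forall>g\<in>carrier (G m). n < m \<longrightarrow> \<phi> (list_encode [m, n, g]) = Some (res m n g))"
    and computable_act: "\<exists>\<phi>. partial_recursive \<phi> \<and>
      (\<forall>i. \<forall>g\<in>carrier (G i). \<forall>x\<in>carrier (Ks i). \<phi> (list_encode [i, g, x]) = Some (act i g x))"
    and Ks_proper: "\<And>i. \<Phi> i ` carrier (Ks i) \<subset> carrier (Ks (Suc i))"


section \<open>Cohesive products\<close>

text \<open>
  Elements of cohesive products are classes \<open>[\<phi>]\<close> of partial recursive functions modulo agreement on
  almost all of \<open>C\<close>. The class is taken among all partial recursive functions, not only among those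
  with values in the \<open>i\<close>th domain. So if \<open>\<A>\<^sub>i \<subseteq> \<B>\<^sub>i\<close> then the product of the \<open>\<A>\<^sub>i\<close> is literally a
  subset of that of the \<open>\<B>\<^sub>i\<close>, and the product of the \<open>\<A>\<^bsub>N(i)\<^esub>\<close> does not depend on the representative
  of \<open>N\<close>.

  The argument of \<open>coh_class\<close> need not itself be recursive: it suffices that it agrees with a partial
  recursive function almost everywhere on \<open>C\<close>. This matters in the pointwise operations below, as a
  representative may leave the domain of the \<open>i\<close>th structure for finitely many \<open>i \<in> C\<close> and for
  \<open>i \<notin> C\<close>, where the operations are arbitrary.
\<close>

type_synonym hyper = "(nat \<Rightarrow> nat option) set"

definition coh_class :: "nat set \<Rightarrow> (nat \<Rightarrow> nat option) \<Rightarrow> hyper" where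
  "coh_class C \<phi> = {\<psi>. partial_recursive \<psi> \<and> C \<subseteq>* {i. \<exists>x. \<phi> i = Some x \<and> \<psi> i = Some x}}"

definition rep :: "hyper \<Rightarrow> nat \<Rightarrow> nat option" where
  "rep a = (SOME \<phi>. \<phi> \<in> a)"

text \<open>
  Partial sequences \<open>{\<A>\<^sub>i}\<^bsub>i\<in>W\<^esub>\<close> are functions into an option type with domain \<open>W\<close>.
\<close>

definition coh_prod :: "nat set \<Rightarrow> (nat \<Rightarrow> nat set option) \<Rightarrow> hyper set" where
  "coh_prod C A = {coh_class C \<phi> |\<phi>. partial_recursive \<phi> \<and> C \<subseteq>* dom \<phi> \<and>
     (\<forall>i x. \<phi> i = Some x \<longrightarrow> (\<exists>S. A i = Some S \<and> x \<in> S))}"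

definition hyper_nat :: "nat set \<Rightarrow> hyper set" where
  "hyper_nat C = coh_prod C (\<lambda>_. Some UNIV)"

definition hyper_less :: "nat set \<Rightarrow> hyper \<Rightarrow> hyper \<Rightarrow> bool" where
  "hyper_less C N M \<longleftrightarrow> C \<subseteq>* {i. \<exists>n m. rep N i = Some n \<and> rep M i = Some m \<and> n < m}"

text \<open>The partial sequence \<open>{\<A>\<^bsub>N(i)\<^esub>}\<^sub>i\<close> for \<open>N\<close> in the cohesive power of \<open>\<nat>\<close>.\<close>

definition reindex :: "hyper \<Rightarrow> (nat \<Rightarrow> 'a) \<Rightarrow> nat \<Rightarrow> 'a option" where
  "reindex N A = (\<lambda>i. map_option A (rep N i))"

definition coh_prod_group :: "nat set \<Rightarrow> (nat \<Rightarrow> nat monoid option) \<Rightarrow> hyper monoid" where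
  "coh_prod_group C G =
    \<lparr>carrier = coh_prod C (\<lambda>i. map_option carrier (G i)),
     monoid.mult = (\<lambda>a b. coh_class C (\<lambda>i. do { H \<leftarrow> G i; x \<leftarrow> rep a i; y \<leftarrow> rep b i; Some (x \<otimes>\<^bsub>H\<^esub> y) })),
     one = coh_class C (\<lambda>i. map_option monoid.one (G i))\<rparr>"


section \<open>Hyper-tuples and hyper-automorphisms\<close>

text \<open>
  A finite tuple over a structure with domain in the naturals is coded by \<^const>\<open>list_encode\<close>.
\<close>

definition coh_tuples :: "nat set \<Rightarrow> (nat \<Rightarrow> nat ring option) \<Rightarrow> hyper set" where
  "coh_tuples C L = coh_prod C (\<lambda>i. map_option (\<lambda>R. list_encode ` lists (carrier R)) (L i))"

definition hyper_prefix :: "nat set \<Rightarrow> hyper \<Rightarrow> hyper \<Rightarrow> bool" where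
  "hyper_prefix C a b \<longleftrightarrow>
    C \<subseteq>* {i. \<exists>x y. rep a i = Some x \<and> rep b i = Some y \<and> prefix (list_decode x) (list_decode y)}"

definition hyper_append :: "nat set \<Rightarrow> hyper \<Rightarrow> hyper \<Rightarrow> hyper" where
  "hyper_append C a b = coh_class C (\<lambda>i. do {
     x \<leftarrow> rep a i; y \<leftarrow> rep b i; Some (list_encode (list_decode x @ list_decode y)) })"

definition arity :: "nat set \<Rightarrow> hyper \<Rightarrow> hyper" where
  "arity C a = coh_class C (\<lambda>i. map_option (\<lambda>x. length (list_decode x)) (rep a i))"

definition hyper_singleton :: "nat set \<Rightarrow> hyper \<Rightarrow> hyper" where
  "hyper_singleton C a = coh_class C (\<lambda>i. map_option (\<lambda>x. list_encode [x]) (rep a i))"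

definition hyper_map :: "nat set \<Rightarrow> (nat \<Rightarrow> (nat \<Rightarrow> nat) option) \<Rightarrow> hyper \<Rightarrow> hyper" where
  "hyper_map C E a = coh_class C (\<lambda>i. do {
     e \<leftarrow> E i; x \<leftarrow> rep a i; Some (list_encode (map e (list_decode x))) })"

definition tree_hauts :: "nat set \<Rightarrow> (nat \<Rightarrow> nat ring option) \<Rightarrow> (hyper \<Rightarrow> hyper) set" where
  "tree_hauts C L = {\<sigma> \<in> Bij (coh_tuples C L).
     (\<forall>a\<in>coh_tuples C L. \<forall>b\<in>coh_tuples C L. hyper_prefix C (\<sigma> a) (\<sigma> b) \<longleftrightarrow> hyper_prefix C a b) \<and>
     (\<forall>a\<in>coh_tuples C L. \<forall>b\<in>coh_tuples C L. \<sigma> (hyper_append C a b) = hyper_append C (\<sigma> a) (\<sigma> b)) \<and>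
     (\<forall>a\<in>coh_tuples C L. arity C (\<sigma> a) = arity C a)}"

text \<open>
  \<open>\<int>[x\<^sub>1, x\<^sub>2, \<dots>]\<close>: a polynomial maps exponent vectors to coefficients, and position \<open>j\<close> of an exponent
  vector belongs to the variable \<open>x\<^bsub>j+1\<^esub>\<close>. It is presented as a list of pairs of a coefficient and an
  exponent list. The presentation is onto but not injective; hyper-polynomials are therefore taken
  as functions into the polynomials themselves, computable through this presentation.
\<close>

type_synonym int_mpoly = "(nat \<Rightarrow>\<^sub>0 nat) \<Rightarrow>\<^sub>0 int"

definition poly_decode :: "nat \<Rightarrow> int_mpoly" where
  "poly_decode c = (\<Sum>t\<leftarrow>list_decode c. case prod_decode t of (k, es) \<Rightarrow>
     Poly_Mapping.single (Poly_Mapping.nth (list_decode es)) (int_decode k))"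

definition poly_var :: "int_mpoly \<Rightarrow> nat" where
  "poly_var p = Max (insert 0 (\<Union>m\<in>Poly_Mapping.keys p. Suc ` Poly_Mapping.keys m))"

definition poly_eval :: "('a, 'b) ring_scheme \<Rightarrow> int_mpoly \<Rightarrow> 'a list \<Rightarrow> 'a" where
  "poly_eval R p xs = (\<Oplus>\<^bsub>R\<^esub>m\<in>Poly_Mapping.keys p. [Poly_Mapping.lookup p m] \<cdot>\<^bsub>R\<^esub>
     (\<Otimes>\<^bsub>R\<^esub>j\<in>Poly_Mapping.keys m. (xs ! j) [^]\<^bsub>R\<^esub> Poly_Mapping.lookup m j))"

definition hyper_poly :: "nat set \<Rightarrow> (nat \<Rightarrow> int_mpoly option) \<Rightarrow> bool" where
  "hyper_poly C p \<longleftrightarrow>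
    C \<subseteq>* dom p \<and> (\<exists>\<phi>. partial_recursive \<phi> \<and> p = (\<lambda>i. map_option poly_decode (\<phi> i)))"

definition hyper_var :: "nat set \<Rightarrow> (nat \<Rightarrow> int_mpoly option) \<Rightarrow> hyper" where
  "hyper_var C p = coh_class C (\<lambda>i. map_option poly_var (p i))"

definition hyper_eval ::
  "nat set \<Rightarrow> (nat \<Rightarrow> nat ring option) \<Rightarrow> (nat \<Rightarrow> int_mpoly option) \<Rightarrow> hyper \<Rightarrow> hyper" where
  "hyper_eval C L p a = coh_class C (\<lambda>i. do {
     R \<leftarrow> L i; q \<leftarrow> p i; x \<leftarrow> rep a i; Some (poly_eval R q (list_decode x)) })"

definition field_hauts :: "nat set \<Rightarrow> (nat \<Rightarrow> nat ring option) \<Rightarrow> (hyper \<Rightarrow> hyper) set" where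
  "field_hauts C L = {\<sigma> \<in> tree_hauts C L.
     \<forall>p. \<forall>a\<in>coh_tuples C L. hyper_poly C p \<and> arity C a = hyper_var C p \<longrightarrow>
       hyper_singleton C (hyper_eval C L p (\<sigma> a)) = \<sigma> (hyper_singleton C (hyper_eval C L p a))}"

text \<open>
  \<open>HAut(\<Prod>\<^sub>C L\<^sub>i / \<Prod>\<^sub>C F)\<close> for extensions presented by embeddings \<open>E i : F \<rightarrow> L\<^sub>i\<close>, with composition
  as multiplication.
\<close>

definition haut_group ::
  "nat set \<Rightarrow> (nat \<Rightarrow> nat ring option) \<Rightarrow> nat ring \<Rightarrow> (nat \<Rightarrow> (nat \<Rightarrow> nat) option) \<Rightarrow>
    (hyper \<Rightarrow> hyper) monoid" where
  "haut_group C L F E = (BijGroup (coh_tuples C L))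
     \<lparr>carrier := {\<sigma> \<in> field_hauts C L.
        \<forall>a\<in>coh_tuples C (\<lambda>_. Some F). \<sigma> (hyper_map C E a) = hyper_map C E a}\<rparr>"


section \<open>Inverse systems\<close>

definition inverse_limit ::
  "'i set \<Rightarrow> ('i \<Rightarrow> 'i \<Rightarrow> bool) \<Rightarrow> ('i \<Rightarrow> 'a monoid) \<Rightarrow> ('i \<Rightarrow> 'i \<Rightarrow> 'a \<Rightarrow> 'a) \<Rightarrow> ('i \<Rightarrow> 'a) monoid"
where
  "inverse_limit I lt H f = (product_group I H)
     \<lparr>carrier := {x \<in> carrier (product_group I H).
        \<forall>N\<in>I. \<forall>M\<in>I. lt N M \<longrightarrow> f M N (x M) = x N}\<rparr>"

definition coh_res ::
  "nat set \<Rightarrow> (nat \<Rightarrow> nat \<Rightarrow> nat \<Rightarrow> nat) \<Rightarrow> hyper \<Rightarrow> hyper \<Rightarrow> hyper \<Rightarrow> hyper" where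
  "coh_res C res M N a = coh_class C (\<lambda>i. do {
     m \<leftarrow> rep M i; n \<leftarrow> rep N i; g \<leftarrow> rep a i; Some (res m n g) })"

text \<open>The inclusion of tuples over the \<open>K\<^bsub>N(i)\<^esub>\<close> into tuples over the \<open>K\<^bsub>M(i)\<^esub>\<close>, for \<open>N \<le> M\<close>.\<close>

definition coh_incl ::
  "nat set \<Rightarrow> (nat \<Rightarrow> nat \<Rightarrow> nat) \<Rightarrow> hyper \<Rightarrow> hyper \<Rightarrow> hyper \<Rightarrow> hyper" where
  "coh_incl C \<Phi> N M = hyper_map C (\<lambda>i. do { n \<leftarrow> rep N i; m \<leftarrow> rep M i; Some (tower_map \<Phi> n m) })"

definition haut_restrict ::
  "nat set \<Rightarrow> (nat \<Rightarrow> nat ring) \<Rightarrow> (nat \<Rightarrow> nat \<Rightarrow> nat) \<Rightarrow>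
    hyper \<Rightarrow> hyper \<Rightarrow> (hyper \<Rightarrow> hyper) \<Rightarrow> (hyper \<Rightarrow> hyper)" where
  "haut_restrict C Ks \<Phi> M N \<sigma> =
    (\<lambda>a\<in>coh_tuples C (reindex N Ks).
      the_inv_into (coh_tuples C (reindex N Ks)) (coh_incl C \<Phi> N M) (\<sigma> (coh_incl C \<Phi> N M a)))"

end

theory Submission
  imports Defs
begin

text \<open>
  An element of a cohesive product is a sequence, recursive at almost all \<open>i \<in> C\<close>, modulo almost
  equality, and cohesiveness decides every existential statement about such sequences, with a witness
  found by search.

  At level \<open>N\<close>, a sequence of group elements acts pointwise on hyper-tuples. Conversely let \<open>\<sigma>\<close> fix \<open>F\<close>
  and map a tuple \<open>a\<close> to \<open>b\<close>. If at almost all \<open>i\<close> some polynomial over \<open>F\<close> vanished at exactly one of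
  \<open>a(i)\<close> and \<open>b(i)\<close>, a search would find a computation of its two values; \<open>\<sigma>\<close> commutes with every step of
  that computation, so it would map a zero to a nonzero element or vice versa. When \<open>a(i)\<close>
  has trivial stabiliser, Galois theory separates \<open>b(i)\<close> from \<open>a(i)\<close> by a polynomial over \<open>F\<close> unless
  \<open>b(i)\<close> lies in the orbit of \<open>a(i)\<close>; hence \<open>\<sigma>\<close> acts on \<open>a\<close>, and then on every tuple, as a sequence of group
  elements. This is compatible with the transition maps.

  For the same reason, with the product of \<open>X - g(x)\<close> over \<open>g \<in> G\<^sub>n\<close> as polynomial, a hyper-automorphism at the top
  preserves every level. As every tuple over \<open>K\<close> lies in some level and any two levels lie in a third,
  hyper-automorphisms at the top are compatible families of hyper-automorphisms of the levels.
\<close>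

section \<open>Recursive functions of almost all indices\<close>

text \<open>Instead all intermediate values together form one hyper-tuple, whose image is again a
  recursive sequence of lists. At each \<open>i\<close> one can decide which entry of the image is
  the first wrong one in the order of computation. Its position is a recursive sequence, so the step
  made there is a single constant, coordinate, sum or product of hyper-elements, and a
  hyper-automorphism respects each of these. Only the fixed polynomials x1 + x2 and x1 x2 are used
  for this; coefficients from the base field enter as steps of the computation.

  One sequence of group elements serves for all tuples because of concatenation: a tuple with
  trivial stabiliser determines the element, and a tuple appended to it has to be moved by the same
  one.

  The separating polynomials are built over the level field, where linear factors exist, and brought
  down to the base field by traces. A free multiplier inside the trace makes this work factor by
  factor, without primitive elements or symmetric functions.\<close>

definition nfst :: "nat \<Rightarrow> nat" where "nfst z = fst (prod_decode z)"
definition nsnd :: "nat \<Rightarrow> nat" where "nsnd z = snd (prod_decode z)"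

lemma nfst_pair [simp]: "nfst (prod_encode (x, y)) = x"
  by (simp add: nfst_def)

lemma nsnd_pair [simp]: "nsnd (prod_encode (x, y)) = y"
  by (simp add: nsnd_def)

lemma prod_encode_nfst_nsnd [simp]: "prod_encode (nfst z, nsnd z) = z"
  by (simp add: nfst_def nsnd_def)

section \<open>Total recursive functions of one argument\<close>

definition total_rec :: "(nat \<Rightarrow> nat) \<Rightarrow> bool" where
  "total_rec f \<longleftrightarrow> partial_recursive (\<lambda>n. Some (f n))"

lemma total_rec_pair:
  assumes "total_rec f" "total_rec g"
  shows "total_rec (\<lambda>n. prod_encode (f n, g n))"
  using partial_recursive.pair[OF assms[unfolded total_rec_def]] by (simp add: total_rec_def)

lemma partial_recursive_comp_total:
  assumes "partial_recursive f" "total_rec g"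
  shows "partial_recursive (\<lambda>n. f (g n))"
  using partial_recursive.comp[OF assms(1) assms(2)[unfolded total_rec_def]] by simp

lemma total_rec_comp:
  assumes "total_rec f" "total_rec g"
  shows "total_rec (\<lambda>n. f (g n))"
  using partial_recursive_comp_total[OF assms(1)[unfolded total_rec_def] assms(2)]
  by (simp add: total_rec_def)

lemma total_rec_nfst: "total_rec g \<Longrightarrow> total_rec (\<lambda>n. nfst (g n))"
  by (rule total_rec_comp[of nfst]) (simp_all add: total_rec_def nfst_def partial_recursive.left)

lemma total_rec_nsnd: "total_rec g \<Longrightarrow> total_rec (\<lambda>n. nsnd (g n))"
  by (rule total_rec_comp[of nsnd]) (simp_all add: total_rec_def nsnd_def partial_recursive.right)

lemma total_rec_Suc: "total_rec g \<Longrightarrow> total_rec (\<lambda>n. Suc (g n))"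
  by (rule total_rec_comp[of Suc]) (simp_all add: total_rec_def partial_recursive.succ)

lemma total_rec_id: "total_rec (\<lambda>n. n)"
  using total_rec_pair[of "\<lambda>n. fst (prod_decode n)" "\<lambda>n. snd (prod_decode n)"]
    partial_recursive.left partial_recursive.right by (simp add: total_rec_def)

lemma total_rec_const: "total_rec (\<lambda>n. c)"
  by (induction c) (simp_all add: total_rec_Suc, simp add: total_rec_def partial_recursive.zero)

lemmas total_rec_intros = total_rec_pair total_rec_nfst total_rec_nsnd total_rec_Suc total_rec_id
  total_rec_const

lemma partial_recursive_pair_total:
  assumes "total_rec f" "partial_recursive g"
  shows "partial_recursive (\<lambda>n. map_option (\<lambda>y. prod_encode (f n, y)) (g n))"
  using partial_recursive.pair[OF assms(1)[unfolded total_rec_def] assms(2)]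
  by (simp add: map_conv_bind_option comp_def)

text \<open>
  For the filter of almost all elements of \<open>C\<close> this covers computations from representatives of
  hyper-elements, which are defined only almost everywhere; for \<open>principal UNIV\<close> it is ordinary
  total recursiveness in \<open>i\<close> and \<open>x\<close>.
\<close>

definition arec :: "nat filter \<Rightarrow> (nat \<Rightarrow> nat \<Rightarrow> nat) \<Rightarrow> bool" where
  "arec U f \<longleftrightarrow> (\<exists>\<psi>. partial_recursive \<psi> \<and> (\<forall>\<^sub>F i in U. \<forall>x. \<psi> (prod_encode (i, x)) = Some (f i x)))"

lemma arecI:
  "partial_recursive \<psi> \<Longrightarrow> \<forall>\<^sub>F i in U. \<forall>x. \<psi> (prod_encode (i, x)) = Some (f i x) \<Longrightarrow> arec U f"
  unfolding arec_def by blast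

lemma arec_cong:
  assumes "arec U f" "\<forall>\<^sub>F i in U. \<forall>x. f i x = g i x"
  shows "arec U g"
proof -
  obtain \<psi> where \<psi>: "partial_recursive \<psi>" "\<forall>\<^sub>F i in U. \<forall>x. \<psi> (prod_encode (i, x)) = Some (f i x)"
    using assms(1) unfolding arec_def by blast
  show ?thesis
    by (rule arecI[OF \<psi>(1)]) (use \<psi>(2) assms(2) in eventually_elim, simp)
qed

lemma arec_total_rec:
  assumes "total_rec f" shows "arec U (\<lambda>i x. f (prod_encode (i, x)))"
  by (rule arecI[OF assms[unfolded total_rec_def]]) simp

text \<open>Lets the closure rules for \<open>arec\<close> double as a calculus for ordinary
  recursiveness: over \<open>principal UNIV\<close> the index can be frozen at 0.\<close>

lemma total_rec_of_arec:
  assumes "arec (principal UNIV) (\<lambda>_ x. f x)" shows "total_rec f"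
proof -
  obtain \<psi> where \<psi>: "partial_recursive \<psi>" "\<forall>i x. \<psi> (prod_encode (i, x)) = Some (f x)"
    using assms unfolding arec_def by (auto simp: eventually_principal)
  have "partial_recursive (\<lambda>n. \<psi> (prod_encode (0, n)))"
    by (rule partial_recursive_comp_total[OF \<psi>(1)]) (intro total_rec_intros)
  then show ?thesis using \<psi>(2) by (simp add: total_rec_def)
qed

lemma arec_arg: "arec U (\<lambda>i x. x)"
  using arec_total_rec[OF total_rec_nsnd[OF total_rec_id]] by simp

lemma arec_index: "arec U (\<lambda>i x. i)"
  using arec_total_rec[OF total_rec_nfst[OF total_rec_id]] by simp

lemma arec_const: "arec U (\<lambda>i x. c)"
  using arec_total_rec[OF total_rec_const] by simp

text \<open>The outer function needs the index again, so the index is paired with the intermediate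
  value before the second computation starts.\<close>

lemma arec_comp:
  assumes "arec U f" "arec U g" shows "arec U (\<lambda>i x. f i (g i x))"
proof -
  obtain \<psi> where \<psi>: "partial_recursive \<psi>" "\<forall>\<^sub>F i in U. \<forall>x. \<psi> (prod_encode (i, x)) = Some (f i x)"
    using assms(1) unfolding arec_def by blast
  obtain \<chi> where \<chi>: "partial_recursive \<chi>" "\<forall>\<^sub>F i in U. \<forall>x. \<chi> (prod_encode (i, x)) = Some (g i x)"
    using assms(2) unfolding arec_def by blast
  let ?\<theta> = "\<lambda>n. Option.bind (map_option (\<lambda>y. prod_encode (nfst n, y)) (\<chi> n)) \<psi>"
  have "partial_recursive ?\<theta>"
    by (intro partial_recursive.comp \<psi>(1) partial_recursive_pair_total total_rec_intros \<chi>(1))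
  moreover have "\<forall>\<^sub>F i in U. \<forall>x. ?\<theta> (prod_encode (i, x)) = Some (f i (g i x))"
    using \<psi>(2) \<chi>(2) by eventually_elim simp
  ultimately show ?thesis by (rule arecI)
qed

lemma arec_pair:
  assumes "arec U f" "arec U g" shows "arec U (\<lambda>i x. prod_encode (f i x, g i x))"
proof -
  obtain \<psi> where \<psi>: "partial_recursive \<psi>" "\<forall>\<^sub>F i in U. \<forall>x. \<psi> (prod_encode (i, x)) = Some (f i x)"
    using assms(1) unfolding arec_def by blast
  obtain \<chi> where \<chi>: "partial_recursive \<chi>" "\<forall>\<^sub>F i in U. \<forall>x. \<chi> (prod_encode (i, x)) = Some (g i x)"
    using assms(2) unfolding arec_def by blast
  show ?thesis
    by (rule arecI[OF partial_recursive.pair[OF \<psi>(1) \<chi>(1)]])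
      (use \<psi>(2) \<chi>(2) in \<open>eventually_elim, simp\<close>)
qed

lemma arec_total:
  assumes "total_rec h" "arec U g" shows "arec U (\<lambda>i x. h (g i x))"
proof -
  have "arec U (\<lambda>i x. h x)"
    using arec_total_rec[OF total_rec_comp[OF assms(1) total_rec_nsnd[OF total_rec_id]], of U] by simp
  from arec_comp[OF this assms(2)] show ?thesis .
qed

lemmas arec_nfst = arec_total[OF total_rec_nfst[OF total_rec_id]]
lemmas arec_nsnd = arec_total[OF total_rec_nsnd[OF total_rec_id]]
lemmas arec_Suc = arec_total[OF total_rec_Suc[OF total_rec_id]]

text \<open>The clause \<open>prec\<close> expects parameter and depth packed into one argument.
  Here the whole input is the parameter, and the depth is itself computed from it.\<close>

lemma partial_recursive_rec:
  assumes "partial_recursive f" "partial_recursive g" "partial_recursive k"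
  shows "partial_recursive (\<lambda>n. Option.bind (k n) (\<lambda>m. rec_nat (f n)
    (\<lambda>j r. Option.bind r (\<lambda>y. g (prod_encode (n, prod_encode (j, y))))) m))"
proof -
  let ?h = "\<lambda>n. case prod_decode n of (a, k) \<Rightarrow>
      rec_nat (f a) (\<lambda>j r. Option.bind r (\<lambda>y. g (prod_encode (a, prod_encode (j, y))))) k"
  have "partial_recursive (\<lambda>n. Option.bind (map_option (\<lambda>y. prod_encode (n, y)) (k n)) ?h)"
    by (intro partial_recursive.comp partial_recursive.prec assms partial_recursive_pair_total
        total_rec_intros)
  then show ?thesis by (simp add: map_conv_bind_option comp_def)
qed

lemma arec_rec:
  assumes "arec U a" "arec U k"
    and "arec U (\<lambda>i z. b i (nfst z) (nfst (nsnd z)) (nsnd (nsnd z)))"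
  shows "arec U (\<lambda>i x. rec_nat (a i x) (b i x) (k i x))"
proof -
  obtain \<psi> where \<psi>: "partial_recursive \<psi>" "\<forall>\<^sub>F i in U. \<forall>x. \<psi> (prod_encode (i, x)) = Some (a i x)"
    using assms(1) unfolding arec_def by blast
  obtain \<chi> where \<chi>: "partial_recursive \<chi>" "\<forall>\<^sub>F i in U. \<forall>x. \<chi> (prod_encode (i, x)) = Some (k i x)"
    using assms(2) unfolding arec_def by blast
  obtain \<beta> where \<beta>: "partial_recursive \<beta>" "\<forall>\<^sub>F i in U. \<forall>z. \<beta> (prod_encode (i, z)) =
      Some (b i (nfst z) (nfst (nsnd z)) (nsnd (nsnd z)))"
    using assms(3) unfolding arec_def by blast
  \<comment> \<open>Regroups the argument ((i, x), (j, y)) handed over by the recursion as (i, (x,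
    (j, y))), the form that \<open>\<beta>\<close> expects.\<close>
  let ?m = "\<lambda>w. prod_encode (nfst (nfst w), prod_encode (nsnd (nfst w), nsnd w))"
  let ?g = "\<lambda>w. \<beta> (?m w)"
  have g: "partial_recursive ?g"
    by (rule partial_recursive_comp_total[OF \<beta>(1)]) (intro total_rec_intros)
  let ?\<theta> = "\<lambda>n. Option.bind (\<chi> n) (\<lambda>m. rec_nat (\<psi> n)
    (\<lambda>j r. Option.bind r (\<lambda>y. ?g (prod_encode (n, prod_encode (j, y))))) m)"
  have "partial_recursive ?\<theta>"
    by (rule partial_recursive_rec[OF \<psi>(1) g \<chi>(1)])
  moreover have "\<forall>\<^sub>F i in U. \<forall>x. ?\<theta> (prod_encode (i, x)) = Some (rec_nat (a i x) (b i x) (k i x))"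
    using \<psi>(2) \<chi>(2) \<beta>(2)
  proof eventually_elim
    case (elim i)
    show ?case
    proof
      fix x
      have "rec_nat (\<psi> (prod_encode (i, x))) (\<lambda>j r. Option.bind r
          (\<lambda>y. ?g (prod_encode (prod_encode (i, x), prod_encode (j, y))))) m =
          Some (rec_nat (a i x) (b i x) m)" for m
        by (induction m) (simp_all add: elim(1,3))
      then show "?\<theta> (prod_encode (i, x)) = Some (rec_nat (a i x) (b i x) (k i x))"
        by (simp add: elim(2))
    qed
  qed
  ultimately show ?thesis by (rule arecI)
qed

section \<open>Decidable predicates, coded lists and definition by cases\<close>

definition adec :: "nat filter \<Rightarrow> (nat \<Rightarrow> nat \<Rightarrow> bool) \<Rightarrow> bool" where
  "adec U P \<longleftrightarrow> arec U (\<lambda>i x. of_bool (P i x))"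

definition alist :: "nat filter \<Rightarrow> (nat \<Rightarrow> nat \<Rightarrow> nat list) \<Rightarrow> bool" where
  "alist U f \<longleftrightarrow> arec U (\<lambda>i x. list_encode (f i x))"

lemma adec_cong:
  assumes "adec U f" "\<forall>\<^sub>F i in U. \<forall>x. f i x = g i x"
  shows "adec U g"
  unfolding adec_def
  by (rule arec_cong[OF assms(1)[unfolded adec_def]]) (use assms(2) in eventually_elim, simp)

lemma arec_if:
  assumes "adec U P" "arec U f" "arec U g"
  shows "arec U (\<lambda>i x. if P i x then f i x else g i x)"
proof -
  \<comment> \<open>Recursion of depth 0 or 1, the truth value, acts as a case distinction.\<close>
  have "arec U (\<lambda>i x. rec_nat (g i x) (\<lambda>_ _. f i x) (of_bool (P i x)))"
    by (intro arec_rec assms assms(1)[unfolded adec_def] arec_comp[OF assms(2)] arec_nfst arec_arg)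
  then show ?thesis by (rule arec_cong) simp
qed

text \<open>Evaluating both branches first would diverge where \<open>\<phi>\<close> does. With the
  truth value as recursion depth, \<open>\<phi>\<close> is run only where \<open>P\<close> holds.
  This turns operations computable on a carrier into total ones with default 0.\<close>

lemma arec_if_partial:
  assumes "partial_recursive \<phi>" "adec U P" "arec U g"
    and "\<forall>\<^sub>F i in U. \<forall>x. P i x \<longrightarrow> \<phi> (g i x) = Some (h i x)"
  shows "arec U (\<lambda>i x. if P i x then h i x else 0)"
proof -
  obtain \<psi> where \<psi>: "partial_recursive \<psi>" "\<forall>\<^sub>F i in U. \<forall>x. \<psi> (prod_encode (i, x)) = Some (of_bool (P i x))"
    using assms(2) unfolding arec_def adec_def by blast
  obtain \<chi> where \<chi>: "partial_recursive \<chi>" "\<forall>\<^sub>F i in U. \<forall>x. \<chi> (prod_encode (i, x)) = Some (g i x)"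
    using assms(3) unfolding arec_def by blast
  let ?g = "\<lambda>w. Option.bind (\<chi> (nfst w)) \<phi>"
  let ?\<theta> = "\<lambda>n. Option.bind (\<psi> n) (\<lambda>m. rec_nat (Some 0)
    (\<lambda>j r. Option.bind r (\<lambda>y. ?g (prod_encode (n, prod_encode (j, y))))) m)"
  have "partial_recursive ?\<theta>"
    by (intro partial_recursive_rec partial_recursive.zero \<psi>(1) partial_recursive.comp assms(1)
       partial_recursive_comp_total[OF \<chi>(1)] total_rec_intros)
  moreover have "\<forall>\<^sub>F i in U. \<forall>x. ?\<theta> (prod_encode (i, x)) = Some (if P i x then h i x else 0)"
    using \<psi>(2) \<chi>(2) assms(4) by eventually_elim simp
  ultimately show ?thesis by (rule arecI)
qed

lemma adec_const: "adec U (\<lambda>i x. P)"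
  unfolding adec_def by (rule arec_const)

lemma adec_if:
  assumes "adec U P" "adec U Q" "adec U R"
  shows "adec U (\<lambda>i x. if P i x then Q i x else R i x)"
  using arec_if[OF assms(1) assms(2,3)[unfolded adec_def]] unfolding adec_def
  by (rule arec_cong) simp

lemma adec_not: "adec U P \<Longrightarrow> adec U (\<lambda>i x. \<not> P i x)"
  using adec_if[OF _ adec_const[of U False] adec_const[of U True]] by (rule adec_cong) auto

lemma adec_conj:
  assumes "adec U P" "adec U Q" shows "adec U (\<lambda>i x. P i x \<and> Q i x)"
  by (rule adec_cong[OF adec_if[OF assms(1) assms(2) adec_const[of U False]]]) simp

lemma adec_disj:
  assumes "adec U P" "adec U Q" shows "adec U (\<lambda>i x. P i x \<or> Q i x)"
  by (rule adec_cong[OF adec_if[OF assms(1) adec_const[of U True] assms(2)]]) simp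

lemma adec_imp:
  assumes "adec U P" "adec U Q" shows "adec U (\<lambda>i x. P i x \<longrightarrow> Q i x)"
  by (rule adec_cong[OF adec_if[OF assms(1) assms(2) adec_const[of U True]]]) simp

section \<open>Arithmetic, comparison, bounded quantifiers and search\<close>

lemma arec_add: assumes "arec U f" "arec U g" shows "arec U (\<lambda>i x. f i x + g i x)"
proof -
  have "arec U (\<lambda>i x. rec_nat (f i x) (\<lambda>_ r. Suc r) (g i x))"
    by (intro arec_rec assms arec_Suc arec_nsnd arec_arg)
  moreover have "rec_nat a (\<lambda>_ r. Suc r) b = a + b" for a b :: nat by (induction b) auto
  ultimately show ?thesis by simp
qed

lemma arec_pred: assumes "arec U f" shows "arec U (\<lambda>i x. f i x - 1)"
proof -
  have "arec U (\<lambda>i x. rec_nat 0 (\<lambda>j r. j) (f i x))"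
    by (intro arec_rec assms arec_nfst arec_nsnd arec_const arec_arg)
  moreover have "rec_nat 0 (\<lambda>j r. j) b = b - 1" for b :: nat by (cases b) auto
  ultimately show ?thesis by simp
qed

lemma arec_diff: assumes "arec U f" "arec U g" shows "arec U (\<lambda>i x. f i x - g i x)"
proof -
  have "arec U (\<lambda>i x. rec_nat (f i x) (\<lambda>_ r. r - 1) (g i x))"
    by (intro arec_rec assms arec_pred arec_nsnd arec_arg)
  moreover have "rec_nat a (\<lambda>_ r. r - 1) b = a - b" for a b :: nat by (induction b) auto
  ultimately show ?thesis by simp
qed

lemma adec_eq_0: assumes "arec U f" shows "adec U (\<lambda>i x. f i x = 0)"
proof -
  have "arec U (\<lambda>i x. 1 - f i x)" by (intro arec_diff assms arec_const)
  then show ?thesis unfolding adec_def by (rule arec_cong) auto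
qed

lemma adec_le: assumes "arec U f" "arec U g" shows "adec U (\<lambda>i x. f i x \<le> g i x)"
  using adec_eq_0[OF arec_diff[OF assms]] by simp

lemma adec_less: assumes "arec U f" "arec U g" shows "adec U (\<lambda>i x. f i x < g i x)"
  using adec_le[OF arec_Suc[OF assms(1)] assms(2)] by (simp add: Suc_le_eq)

lemma adec_eq: assumes "arec U f" "arec U g" shows "adec U (\<lambda>i x. f i x = g i x)"
  using adec_conj[OF adec_le[OF assms] adec_le[OF assms(2,1)]] by (simp add: eq_iff)

lemma adec_arec_comp:
  assumes "adec U P" "arec U g" shows "adec U (\<lambda>i x. P i (g i x))"
  using arec_comp[OF assms(1)[unfolded adec_def] assms(2)] unfolding adec_def .

lemma adec_total:
  assumes "total_rec (\<lambda>x. of_bool (P x))" "arec U g" shows "adec U (\<lambda>i x. P (g i x))"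
  using arec_total[OF assms] unfolding adec_def .

lemma adec_bex:
  assumes "arec U k" "adec U (\<lambda>i z. P i (nfst z) (nsnd z))"
  shows "adec U (\<lambda>i x. \<exists>j<k i x. P i x j)"
proof -
  let ?b = "\<lambda>i x j r. if P i x j then 1 else r"
  have "arec U (\<lambda>i x. rec_nat 0 (?b i x) (k i x))"
  proof (intro arec_rec assms arec_const arec_if arec_nsnd arec_arg)
    show "adec U (\<lambda>i z. P i (nfst z) (nfst (nsnd z)))"
      using adec_arec_comp[OF assms(2), of "\<lambda>i z. prod_encode (nfst z, nfst (nsnd z))"]
        arec_pair[OF arec_nfst[OF arec_arg] arec_nfst[OF arec_nsnd[OF arec_arg]], of U] by simp
  qed
  moreover have *: "rec_nat 0 (?b i x) m = of_bool (\<exists>j<m. P i x j)" for i x m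
    by (induction m) (auto simp: less_Suc_eq)
  ultimately show ?thesis unfolding adec_def by (simp only: *)
qed

lemma adec_ball:
  assumes "arec U k" "adec U (\<lambda>i z. P i (nfst z) (nsnd z))"
  shows "adec U (\<lambda>i x. \<forall>j<k i x. P i x j)"
  using adec_not[OF adec_bex[OF assms(1) adec_not[OF assms(2)]]] by simp

text \<open>The clause \<open>mu\<close> looks for a zero, hence it is applied to the characteristic
  function of the negation.\<close>

lemma arec_least:
  assumes "adec U (\<lambda>i z. P i (nfst z) (nsnd z))" "\<forall>\<^sub>F i in U. \<forall>x. \<exists>k. P i x k"
  shows "arec U (\<lambda>i x. LEAST k. P i x k)"
proof -
  obtain \<psi> where \<psi>: "partial_recursive \<psi>" "\<forall>\<^sub>F i in U. \<forall>z. \<psi> (prod_encode (i, z)) =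
      Some (of_bool (\<not> P i (nfst z) (nsnd z)))"
    using adec_not[OF assms(1)] unfolding arec_def adec_def by blast
  let ?f = "\<lambda>w. \<psi> (prod_encode (nfst (nfst w), prod_encode (nsnd (nfst w), nsnd w)))"
  have f: "partial_recursive ?f"
    by (rule partial_recursive_comp_total[OF \<psi>(1)]) (intro total_rec_intros)
  show ?thesis
    by (rule arecI[OF partial_recursive.mu[OF f]])
      (use \<psi>(2) assms(2) in \<open>eventually_elim, auto simp: of_bool_def\<close>)
qed

section \<open>Operations on coded lists\<close>

lemma list_encode_drop: "rec_nat (list_encode xs) (\<lambda>_ r. nsnd (r - 1)) n = list_encode (drop n xs)"
proof (induction n)
  case (Suc n)
  show ?case
  proof (cases "drop n xs")
    case Nil
    then have "drop (Suc n) xs = []" by simp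
    \<comment> \<open>The code 0 of the empty list is stable: \<open>0 - 1 = 0\<close>, and 0
      decodes to the pair (0, 0). Dropping past the end is therefore harmless.\<close>
    then show ?thesis using Suc Nil by (simp add: nsnd_def prod_decode_def prod_decode_aux.simps)
  next
    case (Cons y ys)
    then have "drop (Suc n) xs = ys" by (metis drop_Suc drop_tl list.sel(3) tl_drop)
    then show ?thesis using Suc Cons by simp
  qed
qed simp

lemma list_encode_eq_0 [simp]: "list_encode xs = 0 \<longleftrightarrow> xs = []"
  by (cases xs) auto

lemma list_encode_inj [simp]: "list_encode xs = list_encode ys \<longleftrightarrow> xs = ys"
  using inj_list_encode[of UNIV] by (simp add: inj_eq)

text \<open>The default 0 is what the projections yield on an exhausted code, so indexing is
  recursive without a test of the bounds.\<close>

definition nth0 :: "nat list \<Rightarrow> nat \<Rightarrow> nat" where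
  "nth0 xs n = (if n < length xs then xs ! n else 0)"

lemma nth0_encode: "nth0 xs n = nfst (list_encode (drop n xs) - 1)"
proof (cases "n < length xs")
  case True
  then have "drop n xs = xs ! n # drop (Suc n) xs" by (simp add: Cons_nth_drop_Suc)
  then show ?thesis using True by (simp add: nth0_def)
next
  case False
  then show ?thesis by (simp add: nth0_def nfst_def prod_decode_def prod_decode_aux.simps)
qed

lemma nth0_nth [simp]: "n < length xs \<Longrightarrow> nth0 xs n = xs ! n"
  by (simp add: nth0_def)

lemma arec_list_encode: "alist U f \<Longrightarrow> arec U (\<lambda>i x. list_encode (f i x))"
  by (simp add: alist_def)

lemma alist_decode: "arec U f \<Longrightarrow> alist U (\<lambda>i x. list_decode (f i x))"
  by (simp add: alist_def)

lemma alist_Nil: "alist U (\<lambda>i x. [])"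
  using arec_const[of U 0] by (simp add: alist_def)

lemma alist_Cons: "arec U f \<Longrightarrow> alist U l \<Longrightarrow> alist U (\<lambda>i x. f i x # l i x)"
  unfolding alist_def by (simp add: arec_Suc arec_pair)

lemma alist_drop:
  assumes "arec U n" "alist U l" shows "alist U (\<lambda>i x. drop (n i x) (l i x))"
proof -
  have "arec U (\<lambda>i x. rec_nat (list_encode (l i x)) (\<lambda>_ r. nsnd (r - 1)) (n i x))"
    by (intro arec_rec arec_list_encode assms arec_nsnd arec_pred arec_arg)
  then show ?thesis by (simp only: list_encode_drop alist_def)
qed

lemma adec_list_eq: "alist U l \<Longrightarrow> alist U l' \<Longrightarrow> adec U (\<lambda>i x. l i x = l' i x)"
  using adec_eq[of U "\<lambda>i x. list_encode (l i x)" "\<lambda>i x. list_encode (l' i x)"]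
  by (simp add: alist_def)

lemma alist_comp:
  assumes "alist U l" "arec U g" shows "alist U (\<lambda>i x. l i (g i x))"
  using arec_comp[OF assms(1)[unfolded alist_def] assms(2)] by (simp add: alist_def)

lemma arec_length:
  assumes "alist U l" shows "arec U (\<lambda>i x. length (l i x))"
proof -
  \<comment> \<open>The length is found as the least number of entries whose removal leaves
    nothing.\<close>
  have "arec U (\<lambda>i x. LEAST k. drop k (l i x) = [])"
  proof (rule arec_least)
    show "adec U (\<lambda>i z. drop (nsnd z) (l i (nfst z)) = [])"
      by (intro adec_list_eq alist_drop alist_Nil arec_nsnd arec_nfst arec_arg alist_comp[OF assms])
    show "\<forall>\<^sub>F i in U. \<forall>x. \<exists>k. drop k (l i x) = []"
      using drop_all[OF order_refl] by (intro always_eventually) blast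
  qed
  moreover have "(LEAST k. drop k xs = []) = length xs" for xs :: "nat list"
    by (rule Least_equality) auto
  ultimately show ?thesis by simp
qed

lemma arec_nth0: "alist U l \<Longrightarrow> arec U n \<Longrightarrow> arec U (\<lambda>i x. nth0 (l i x) (n i x))"
  unfolding nth0_encode by (intro arec_nfst arec_pred arec_list_encode alist_drop)

lemma alist_tabulate:
  assumes "arec U n" "arec U (\<lambda>i z. f i (nfst z) (nsnd z))"
  shows "alist U (\<lambda>i x. map (f i x) [0..<n i x])"
proof -
  have f: "arec U a \<Longrightarrow> arec U b \<Longrightarrow> arec U (\<lambda>i x. f i (a i x) (b i x))" for a b
    using arec_comp[OF assms(2) arec_pair[of U a b]] by simp
  have n: "arec U a \<Longrightarrow> arec U (\<lambda>i x. n i (a i x))" for a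
    using arec_comp[OF assms(1)] .
  \<comment> \<open>Codes of lists grow at the front, so the table is built from its last entry:
    step \<open>j\<close> puts entry number n - 1 - j in front.\<close>
  have "arec U (\<lambda>i x. rec_nat 0 (\<lambda>j r. Suc (prod_encode (f i x (n i x - 1 - j), r))) (n i x))"
    by (intro arec_rec arec_const assms(1) arec_Suc arec_pair f n arec_diff arec_nfst arec_nsnd arec_arg)
  moreover have "rec_nat 0 (\<lambda>j r. Suc (prod_encode (h (n - 1 - j), r))) m =
      list_encode (map h [n - m..<n])" if "m \<le> n" for h n m
    using that
  proof (induction m)
    case (Suc m)
    then have "[n - Suc m..<n] = (n - Suc m) # [n - m..<n]"
      by (subst upt_conv_Cons) (auto simp: Suc_diff_Suc)
    then show ?case using Suc by simp
  qed simp
  ultimately show ?thesis by (simp add: alist_def)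
qed

lemma map_nth0: "map (\<lambda>j. f (nth0 xs j)) [0..<length xs] = map f xs"
  by (rule nth_equalityI) auto

lemma alist_map:
  assumes "alist U l" "arec U (\<lambda>i z. f i (nfst z) (nsnd z))"
  shows "alist U (\<lambda>i x. map (f i x) (l i x))"
proof -
  have f: "arec U a \<Longrightarrow> arec U b \<Longrightarrow> arec U (\<lambda>i x. f i (a i x) (b i x))" for a b
    using arec_comp[OF assms(2) arec_pair[of U a b]] by simp
  have "alist U (\<lambda>i x. map (\<lambda>j. f i x (nth0 (l i x) j)) [0..<length (l i x)])"
    by (intro alist_tabulate arec_length assms(1) f arec_nth0 arec_nfst arec_nsnd arec_arg
        alist_comp[OF assms(1)])
  then show ?thesis by (simp only: map_nth0)
qed

lemma alist_append:
  assumes "alist U l" "alist U l'"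
  shows "alist U (\<lambda>i x. l i x @ l' i x)"
proof -
  have "alist U (\<lambda>i x. map (\<lambda>j. if j < length (l i x) then nth0 (l i x) j
      else nth0 (l' i x) (j - length (l i x))) [0..<length (l i x) + length (l' i x)])"
    by (intro alist_tabulate arec_length assms arec_if adec_less arec_nth0 arec_nfst arec_nsnd arec_arg
        arec_diff arec_add alist_comp[OF assms(1)] alist_comp[OF assms(2)])
  moreover have "map (\<lambda>j. if j < length xs then nth0 xs j else nth0 ys (j - length xs))
      [0..<length xs + length ys] = xs @ ys" for xs ys
    by (rule nth_equalityI) (auto simp: nth_append)
  ultimately show ?thesis by simp
qed

lemma adec_Ball_set:
  assumes "alist U l" "adec U (\<lambda>i z. P i (nfst z) (nsnd z))"
  shows "adec U (\<lambda>i x. \<forall>y\<in>set (l i x). P i x y)"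
proof -
  have P: "arec U a \<Longrightarrow> arec U b \<Longrightarrow> adec U (\<lambda>i x. P i (a i x) (b i x))" for a b
    using adec_arec_comp[OF assms(2) arec_pair[of U a b]] by simp
  have "adec U (\<lambda>i x. \<forall>j<length (l i x). P i x (nth0 (l i x) j))"
    by (intro adec_ball arec_length assms(1) P arec_nth0 arec_nfst arec_nsnd arec_arg
        alist_comp[OF assms(1)])
  then show ?thesis by (rule adec_cong) (auto simp: all_set_conv_all_nth)
qed

lemma adec_Bex_set:
  assumes "alist U l" "adec U (\<lambda>i z. P i (nfst z) (nsnd z))"
  shows "adec U (\<lambda>i x. \<exists>y\<in>set (l i x). P i x y)"
  using adec_not[OF adec_Ball_set[OF assms(1) adec_not[OF assms(2)]]] by simp

lemma adec_member: "alist U l \<Longrightarrow> arec U a \<Longrightarrow> adec U (\<lambda>i x. a i x \<in> set (l i x))"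
  using adec_Bex_set[of U l "\<lambda>i x y. a i x = y"]
  by (simp add: adec_eq arec_nsnd arec_arg arec_comp[of U a] arec_nfst)

lemma fold_nth0: "fold f xs a = rec_nat a (\<lambda>j r. f (nth0 xs j) r) (length xs)"
proof -
  have "fold f (take m xs) a = rec_nat a (\<lambda>j r. f (nth0 xs j) r) m" if "m \<le> length xs" for m
    using that by (induction m) (auto simp: take_Suc_conv_app_nth)
  from this[of "length xs"] show ?thesis by simp
qed

lemma arec_fold:
  assumes "alist U l" "arec U a"
    and "arec U (\<lambda>i z. f i (nfst z) (nfst (nsnd z)) (nsnd (nsnd z)))"
  shows "arec U (\<lambda>i x. fold (f i x) (l i x) (a i x))"
proof -
  have f: "arec U a \<Longrightarrow> arec U b \<Longrightarrow> arec U c \<Longrightarrow> arec U (\<lambda>i x. f i (a i x) (b i x) (c i x))" for a b c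
    using arec_comp[OF assms(3) arec_pair[of U a "\<lambda>i x. prod_encode (b i x, c i x)"]]
    by (simp add: arec_pair)
  show ?thesis unfolding fold_nth0
    by (intro arec_rec assms(1,2) arec_length f arec_nth0 arec_nfst arec_nsnd arec_arg
        alist_comp[OF assms(1)])
qed

lemmas arec_intros = arec_arg arec_index arec_const arec_pair arec_nfst arec_nsnd arec_Suc arec_add
  arec_pred arec_diff arec_length arec_nth0 arec_list_encode
  adec_const adec_not adec_conj adec_disj adec_imp adec_eq_0 adec_list_eq adec_le adec_less adec_eq
  adec_member adec_Ball_set adec_Bex_set adec_ball adec_bex
  alist_Nil alist_Cons alist_append alist_map alist_tabulate alist_decode alist_drop

section \<open>Hyper-elements as recursive sequences\<close>

text \<open>As a filter, "for almost all \<open>i\<close> in \<open>C\<close>" can be combined by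
  \<open>eventually_elim\<close>, and it is the parameter \<open>U\<close> of
  \<open>arec\<close>.\<close>

definition almost_all :: "nat set \<Rightarrow> nat filter" where
  "almost_all C = inf cofinite (principal C)"

lemma eventually_almost_all: "eventually P (almost_all C) \<longleftrightarrow> C \<subseteq>* {i. P i}"
  by (simp add: almost_all_def eventually_inf_principal eventually_cofinite almost_subset_def
      set_diff_eq)

text \<open>Only the values at almost all of \<open>C\<close> matter; elsewhere the total sequence
  \<open>f\<close> may be arbitrary and noncomputable.\<close>

definition hclass :: "nat set \<Rightarrow> (nat \<Rightarrow> nat) \<Rightarrow> hyper" where
  "hclass C f = coh_class C (\<lambda>i. Some (f i))"

definition val :: "hyper \<Rightarrow> nat \<Rightarrow> nat" where
  "val a i = the (rep a i)"

abbreviation seq_rec :: "nat set \<Rightarrow> (nat \<Rightarrow> nat) \<Rightarrow> bool" where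
  "seq_rec C f \<equiv> arec (almost_all C) (\<lambda>i _. f i)"

lemma seq_rec_iff:
  "seq_rec C f \<longleftrightarrow> (\<exists>\<psi>. partial_recursive \<psi> \<and> (\<forall>\<^sub>F i in almost_all C. \<psi> i = Some (f i)))"
proof
  assume "seq_rec C f"
  then obtain \<psi> where \<psi>: "partial_recursive \<psi>"
      "\<forall>\<^sub>F i in almost_all C. \<forall>x. \<psi> (prod_encode (i, x)) = Some (f i)"
    unfolding arec_def by blast
  have "partial_recursive (\<lambda>i. \<psi> (prod_encode (i, 0)))"
    by (rule partial_recursive_comp_total[OF \<psi>(1)]) (intro total_rec_intros)
  moreover have "\<forall>\<^sub>F i in almost_all C. \<psi> (prod_encode (i, 0)) = Some (f i)"
    using \<psi>(2) by eventually_elim simp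
  ultimately show "\<exists>\<psi>. partial_recursive \<psi> \<and> (\<forall>\<^sub>F i in almost_all C. \<psi> i = Some (f i))" by blast
next
  assume "\<exists>\<psi>. partial_recursive \<psi> \<and> (\<forall>\<^sub>F i in almost_all C. \<psi> i = Some (f i))"
  then obtain \<psi> where \<psi>: "partial_recursive \<psi>" "\<forall>\<^sub>F i in almost_all C. \<psi> i = Some (f i)" by blast
  have "partial_recursive (\<lambda>n. \<psi> (nfst n))"
    by (rule partial_recursive_comp_total[OF \<psi>(1)]) (intro total_rec_intros)
  then show "seq_rec C f"
    by (rule arecI) (use \<psi>(2) in eventually_elim, simp)
qed

lemma coh_class_alt: "coh_class C \<phi> =
    {\<psi>. partial_recursive \<psi> \<and> (\<forall>\<^sub>F i in almost_all C. \<exists>x. \<phi> i = Some x \<and> \<psi> i = Some x)}"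
  by (simp add: coh_class_def eventually_almost_all)

lemma coh_class_cong:
  assumes "\<forall>\<^sub>F i in almost_all C. \<phi> i = \<psi> i"
  shows "coh_class C \<phi> = coh_class C \<psi>"
proof -
  have "(\<forall>\<^sub>F i in almost_all C. \<exists>x. \<phi> i = Some x \<and> \<theta> i = Some x) \<longleftrightarrow>
      (\<forall>\<^sub>F i in almost_all C. \<exists>x. \<psi> i = Some x \<and> \<theta> i = Some x)" for \<theta>
    by (intro eventually_cong[OF assms]) simp
  then show ?thesis by (simp add: coh_class_alt)
qed

lemma coh_class_eq_hclass:
  assumes "\<forall>\<^sub>F i in almost_all C. \<phi> i = Some (f i)"
  shows "coh_class C \<phi> = hclass C f"
  unfolding hclass_def by (rule coh_class_cong[OF assms])

lemma hclass_cong: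
  assumes "\<forall>\<^sub>F i in almost_all C. f i = g i"
  shows "hclass C f = hclass C g"
  unfolding hclass_def by (rule coh_class_cong) (use assms in eventually_elim, simp)

lemma rep_hclass:
  assumes "seq_rec C f"
  shows "partial_recursive (rep (hclass C f))"
    "\<forall>\<^sub>F i in almost_all C. rep (hclass C f) i = Some (f i)"
proof -
  have "\<exists>\<psi>. \<psi> \<in> hclass C f"
    using assms[unfolded seq_rec_iff] by (auto simp: hclass_def coh_class_alt)
  then have "rep (hclass C f) \<in> hclass C f"
    unfolding rep_def by (rule someI_ex)
  then show "partial_recursive (rep (hclass C f))"
      "\<forall>\<^sub>F i in almost_all C. rep (hclass C f) i = Some (f i)"
    by (simp_all add: hclass_def coh_class_alt)
qed

lemma val_hclass:
  assumes "seq_rec C f" shows "\<forall>\<^sub>F i in almost_all C. val (hclass C f) i = f i"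
  using rep_hclass(2)[OF assms] by eventually_elim (simp add: val_def)

lemma almost_subset_dom: "C \<subseteq>* dom \<phi> \<longleftrightarrow> (\<forall>\<^sub>F i in almost_all C. \<phi> i = Some (the (\<phi> i)))"
proof -
  have "{i. \<phi> i = Some (the (\<phi> i))} = dom \<phi>" by (auto simp: dom_def)
  then show ?thesis by (simp add: eventually_almost_all)
qed

text \<open>Every cohesive product is literally a subset of the cohesive power of the naturals, so
  this normal form serves for group elements and coded tuples as well as for hypernatural
  indices.\<close>

lemma hyper_nat_iff: "a \<in> hyper_nat C \<longleftrightarrow> (\<exists>f. seq_rec C f \<and> a = hclass C f)"
proof
  assume "a \<in> hyper_nat C"
  then obtain \<phi> where \<phi>: "a = coh_class C \<phi>" "partial_recursive \<phi>" "C \<subseteq>* dom \<phi>"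
    unfolding hyper_nat_def coh_prod_def by blast
  have ev: "\<forall>\<^sub>F i in almost_all C. \<phi> i = Some (the (\<phi> i))"
    using \<phi>(3) unfolding almost_subset_dom .
  show "\<exists>f. seq_rec C f \<and> a = hclass C f"
    unfolding seq_rec_iff \<phi>(1) coh_class_eq_hclass[OF ev] using \<phi>(2) ev
    by (intro exI[of _ "\<lambda>i. the (\<phi> i)"] conjI exI[of _ \<phi>]) auto
next
  assume "\<exists>f. seq_rec C f \<and> a = hclass C f"
  then obtain f \<psi> where "a = hclass C f" "partial_recursive \<psi>"
      and ev: "\<forall>\<^sub>F i in almost_all C. \<psi> i = Some (f i)"
    unfolding seq_rec_iff by blast
  moreover have "C \<subseteq>* dom \<psi>"
    unfolding almost_subset_dom using ev by eventually_elim simp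
  ultimately show "a \<in> hyper_nat C"
    unfolding hyper_nat_def coh_prod_def
    using coh_class_eq_hclass[OF ev] by auto
qed

lemma hclass_hyper_nat: "seq_rec C f \<Longrightarrow> hclass C f \<in> hyper_nat C"
  by (auto simp: hyper_nat_iff)

lemma seq_rec_cong: "seq_rec C f \<Longrightarrow> \<forall>\<^sub>F i in almost_all C. f i = g i \<Longrightarrow> seq_rec C g"
  by (erule arec_cong) (erule eventually_mono, simp)

lemma hyper_nat_val:
  assumes "a \<in> hyper_nat C"
  shows "seq_rec C (val a)" "hclass C (val a) = a" "partial_recursive (rep a)"
    "\<forall>\<^sub>F i in almost_all C. rep a i = Some (val a i)"
proof -
  obtain f where f: "seq_rec C f" "a = hclass C f"
    using assms by (auto simp: hyper_nat_iff)
  note r = rep_hclass[OF f(1), folded f(2)]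
  have v: "\<forall>\<^sub>F i in almost_all C. f i = val a i"
    using r(2) by eventually_elim (simp add: val_def)
  show "seq_rec C (val a)" by (rule seq_rec_cong[OF f(1) v])
  show "hclass C (val a) = a" using hclass_cong[OF v] f(2) by metis
  show "partial_recursive (rep a)" by (rule r(1))
  show "\<forall>\<^sub>F i in almost_all C. rep a i = Some (val a i)"
    using r(2) by eventually_elim (simp add: val_def)
qed

lemma hyper_eqI:
  assumes "a \<in> hyper_nat C" "b \<in> hyper_nat C" "\<forall>\<^sub>F i in almost_all C. val a i = val b i"
  shows "a = b"
  using hclass_cong[OF assms(3)] hyper_nat_val(2) assms(1,2) by metis

lemma partial_recursive_seq:
  assumes "partial_recursive f" "partial_recursive g"
  shows "partial_recursive (\<lambda>i. Option.bind (f i) (\<lambda>_. g i))"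
proof -
  have "(\<lambda>i. Option.bind (Option.bind (f i) (\<lambda>x. Option.bind (g i) (\<lambda>y. Some (prod_encode (x, y)))))
      (\<lambda>n. Some (snd (prod_decode n)))) = (\<lambda>i. Option.bind (f i) (\<lambda>_. g i))" (is "?l = ?r")
  proof
    fix i
    show "?l i = ?r i" by (cases "f i"; cases "g i") auto
  qed
  with partial_recursive.comp[OF partial_recursive.right partial_recursive.pair[OF assms]]
  show ?thesis by simp
qed

text \<open>An unbounded search whose test ignores the candidate stops at once or never; it turns a
  decidable condition into a condition on termination.\<close>

lemma partial_recursive_guard:
  assumes "total_rec (\<lambda>z. of_bool (P z))"
  shows "partial_recursive (\<lambda>z. if P z then Some z else None)"
proof -
  have "total_rec (\<lambda>w. of_bool (\<not> P (nfst w)))"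
    using adec_not[of "principal UNIV" "\<lambda>i w. P (nfst w)"] arec_total[OF assms arec_nfst[OF arec_arg]]
    by (intro total_rec_of_arec) (simp add: adec_def)
  then have *: "partial_recursive (\<lambda>w. Some (of_bool (\<not> P (nfst w))))"
    by (simp add: total_rec_def)
  have "partial_recursive (\<lambda>z. Option.bind (if P z then Some (LEAST k::nat. P z) else None) (\<lambda>_. Some z))"
    by (rule partial_recursive_seq)
      (use partial_recursive.mu[OF *] total_rec_id in \<open>simp_all add: total_rec_def cong: if_cong\<close>)
  moreover have "(\<lambda>z. Option.bind (if P z then Some (LEAST k::nat. P z) else None) (\<lambda>_. Some z)) =
      (\<lambda>z. if P z then Some z else None)"
    by (rule ext) simp
  ultimately show ?thesis by simp
qed

text \<open>The definition of \<open>coh_prod\<close> wants a representative all of whose values,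
  even outside \<open>C\<close>, lie in the right sets. Any representative becomes such a one by
  letting it diverge where its value is wrong, which can be done because the sets are uniformly
  decidable.\<close>

lemma coh_prod_iff:
  assumes "partial_recursive \<nu>" "\<forall>\<^sub>F i in almost_all C. \<nu> i = Some (n i)"
    and "total_rec (\<lambda>z. of_bool (nsnd z \<in> S (nfst z)))"
  shows "a \<in> coh_prod C (\<lambda>i. map_option S (\<nu> i)) \<longleftrightarrow>
    a \<in> hyper_nat C \<and> (\<forall>\<^sub>F i in almost_all C. val a i \<in> S (n i))"
proof safe
  assume a: "a \<in> coh_prod C (\<lambda>i. map_option S (\<nu> i))"
  then obtain \<phi> where \<phi>: "a = coh_class C \<phi>" "partial_recursive \<phi>" "C \<subseteq>* dom \<phi>"
      "\<forall>i x. \<phi> i = Some x \<longrightarrow> (\<exists>T. map_option S (\<nu> i) = Some T \<and> x \<in> T)"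
    unfolding coh_prod_def by auto
  then show h: "a \<in> hyper_nat C"
    unfolding hyper_nat_def coh_prod_def by auto
  have "\<forall>\<^sub>F i in almost_all C. \<exists>x. \<phi> i = Some x \<and> \<phi> i = Some x"
    using \<phi>(3)[unfolded almost_subset_dom] by eventually_elim blast
  then have "\<phi> \<in> a" by (simp add: \<phi>(1,2) coh_class_alt)
  then have "rep a \<in> a" unfolding rep_def by (rule someI[of "\<lambda>\<phi>. \<phi> \<in> a"])
  then have "\<forall>\<^sub>F i in almost_all C. \<exists>x. \<phi> i = Some x \<and> rep a i = Some x"
    by (simp add: \<phi>(1) coh_class_alt)
  then show "\<forall>\<^sub>F i in almost_all C. val a i \<in> S (n i)"
    using assms(2)
  proof eventually_elim
    case (elim i)
    then obtain x where "\<phi> i = Some x" "rep a i = Some x" by blast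
    then show ?case using \<phi>(4)[rule_format, of i x] elim(2) by (auto simp: val_def)
  qed
next
  assume h: "a \<in> hyper_nat C" and S: "\<forall>\<^sub>F i in almost_all C. val a i \<in> S (n i)"
  let ?p = "\<lambda>i. Option.bind (\<nu> i) (\<lambda>k. Option.bind (rep a i) (\<lambda>x. Some (prod_encode (k, x))))"
  let ?\<mu> = "\<lambda>z. if nsnd z \<in> S (nfst z) then Some z else None"
  \<comment> \<open>The guard contributes only its termination; the value returned is that of
    \<open>rep a\<close>.\<close>
  let ?r = "\<lambda>i. Option.bind (Option.bind (?p i) ?\<mu>) (\<lambda>_. rep a i)"
  have r: "partial_recursive ?r"
    by (intro partial_recursive_seq partial_recursive.comp[OF partial_recursive_guard]
        partial_recursive.pair assms hyper_nat_val(3)[OF h])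
  have ev: "\<forall>\<^sub>F i in almost_all C. ?r i = Some (val a i)"
    using S assms(2) hyper_nat_val(4)[OF h] by eventually_elim auto
  have "a = coh_class C ?r"
    using coh_class_eq_hclass[OF ev] hyper_nat_val(2)[OF h] by simp
  moreover have "C \<subseteq>* dom ?r"
    unfolding almost_subset_dom using ev by eventually_elim simp
  moreover have "\<exists>T. map_option S (\<nu> i) = Some T \<and> x \<in> T" if "?r i = Some x" for i x
    using that by (auto simp: bind_eq_Some_conv split: if_splits)
  ultimately show "a \<in> coh_prod C (\<lambda>i. map_option S (\<nu> i))"
    using r unfolding coh_prod_def by blast
qed

section \<open>The dichotomies supplied by cohesiveness\<close>

lemma cohesive_semidec:
  assumes "cohesive C" "partial_recursive \<psi>"
    and "\<forall>\<^sub>F i in almost_all C. (\<psi> i \<noteq> None) = P i"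
  shows "(\<forall>\<^sub>F i in almost_all C. P i) \<or> (\<forall>\<^sub>F i in almost_all C. \<not> P i)"
proof -
  have "ce_set (dom \<psi>)" using assms(2) unfolding ce_set_def by blast
  then have "C \<subseteq>* dom \<psi> \<or> C \<subseteq>* - dom \<psi>" using assms(1) unfolding cohesive_def by blast
  then have "(\<forall>\<^sub>F i in almost_all C. \<psi> i \<noteq> None) \<or> (\<forall>\<^sub>F i in almost_all C. \<not> \<psi> i \<noteq> None)"
    unfolding eventually_almost_all by (simp add: dom_def Compl_eq)
  then show ?thesis
  proof
    assume "\<forall>\<^sub>F i in almost_all C. \<psi> i \<noteq> None"
    then have "\<forall>\<^sub>F i in almost_all C. P i" using assms(3) by eventually_elim simp
    then show ?thesis ..
  next
    assume "\<forall>\<^sub>F i in almost_all C. \<not> \<psi> i \<noteq> None"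
    then have "\<forall>\<^sub>F i in almost_all C. \<not> P i" using assms(3) by eventually_elim simp
    then show ?thesis ..
  qed
qed

text \<open>The indices with a witness form, up to finitely many elements of \<open>C\<close>, the
  domain of an unbounded search, hence a c.e. set that almost contains \<open>C\<close> or almost
  misses it. In the first case the search itself computes a sequence of witnesses.\<close>

lemma cohesive_search:
  assumes "cohesive C" "adec (almost_all C) (\<lambda>i k. P i k)"
  shows "(\<exists>f. seq_rec C f \<and> (\<forall>\<^sub>F i in almost_all C. P i (f i))) \<or> (\<forall>\<^sub>F i in almost_all C. \<forall>k. \<not> P i k)"
proof -
  obtain \<psi> where \<psi>: "partial_recursive \<psi>" "\<forall>\<^sub>F i in almost_all C. \<forall>k. \<psi> (prod_encode (i, k)) =
      Some (of_bool (\<not> P i k))"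
    using adec_not[OF assms(2)] unfolding arec_def adec_def by blast
  have "(\<forall>\<^sub>F i in almost_all C. \<exists>k. P i k) \<or> (\<forall>\<^sub>F i in almost_all C. \<not> (\<exists>k. P i k))"
    by (rule cohesive_semidec[OF assms(1) partial_recursive.mu[OF \<psi>(1)]])
      (use \<psi>(2) in \<open>eventually_elim, auto\<close>)
  then show ?thesis
  proof
    assume ev: "\<forall>\<^sub>F i in almost_all C. \<exists>k. P i k"
    have "seq_rec C (\<lambda>i. LEAST k. P i k)"
    proof (rule arec_least)
      show "adec (almost_all C) (\<lambda>i z. P i (nsnd z))"
        by (rule adec_arec_comp[OF assms(2) arec_nsnd[OF arec_arg]])
      show "\<forall>\<^sub>F i in almost_all C. \<forall>x::nat. \<exists>k. P i k" using ev by eventually_elim simp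
    qed
    moreover have "\<forall>\<^sub>F i in almost_all C. P i (LEAST k. P i k)"
      using ev by eventually_elim (auto intro: LeastI)
    ultimately show ?thesis by (intro disjI1 exI[of _ "\<lambda>i. LEAST k. P i k"] conjI)
  qed auto
qed

lemma cohesive_dec:
  assumes "cohesive C" "adec (almost_all C) (\<lambda>i _. P i)"
  shows "(\<forall>\<^sub>F i in almost_all C. P i) \<or> (\<forall>\<^sub>F i in almost_all C. \<not> P i)"
  using cohesive_search[OF assms] by auto

lemma seq_search:
  assumes "adec (almost_all C) (\<lambda>i k. P i k)" "\<forall>\<^sub>F i in almost_all C. \<exists>k. P i k"
  obtains f where "seq_rec C f" "\<forall>\<^sub>F i in almost_all C. P i (f i)"
proof
  show "seq_rec C (\<lambda>i. LEAST k. P i k)"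
  proof (rule arec_least)
    show "adec (almost_all C) (\<lambda>i z. P i (nsnd z))"
      by (rule adec_arec_comp[OF assms(1) arec_nsnd[OF arec_arg]])
    show "\<forall>\<^sub>F i in almost_all C. \<forall>x::nat. \<exists>k. P i k" using assms(2) by eventually_elim simp
  qed
  show "\<forall>\<^sub>F i in almost_all C. P i (LEAST k. P i k)"
    using assms(2) by eventually_elim (auto intro: LeastI)
qed

lemma almost_all_nontrivial: "cohesive C \<Longrightarrow> \<not> (\<forall>\<^sub>F i in almost_all C. False)"
  by (simp add: eventually_almost_all cohesive_def almost_subset_def)

section \<open>Computability of polynomial evaluation\<close>

text \<open>The field operations are extended by \<open>0\<close> outside the carrier, which makes them total recursive.\<close>

definition add0 :: "nat ring \<Rightarrow> nat \<Rightarrow> nat \<Rightarrow> nat" where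
  "add0 S x y = (if x \<in> carrier S \<and> y \<in> carrier S then x \<oplus>\<^bsub>S\<^esub> y else 0)"

definition mult0 :: "nat ring \<Rightarrow> nat \<Rightarrow> nat \<Rightarrow> nat" where
  "mult0 S x y = (if x \<in> carrier S \<and> y \<in> carrier S then x \<otimes>\<^bsub>S\<^esub> y else 0)"

definition pow0 :: "nat ring \<Rightarrow> nat \<Rightarrow> nat \<Rightarrow> nat" where
  "pow0 S x e = rec_nat \<one>\<^bsub>S\<^esub> (\<lambda>_ r. mult0 S r x) e"

definition nsmul0 :: "nat ring \<Rightarrow> nat \<Rightarrow> nat \<Rightarrow> nat" where
  "nsmul0 S k x = rec_nat \<zero>\<^bsub>S\<^esub> (\<lambda>_ r. add0 S r x) k"

text \<open>Negation is not among the operations given as computable, so it is searched for. The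
  implication inside \<open>LEAST\<close> makes the search stop at once outside the carrier.\<close>

definition neg0 :: "nat ring \<Rightarrow> nat \<Rightarrow> nat" where
  "neg0 S x = (LEAST y. x \<in> carrier S \<longrightarrow> y \<in> carrier S \<and> add0 S x y = \<zero>\<^bsub>S\<^esub>)"

definition padded :: "('a, 'b) ring_scheme \<Rightarrow> 'a list \<Rightarrow> nat \<Rightarrow> 'a" where
  "padded S xs j = (if j < length xs then xs ! j else \<zero>\<^bsub>S\<^esub>)"

definition padded0 :: "nat ring \<Rightarrow> nat list \<Rightarrow> nat \<Rightarrow> nat" where
  "padded0 S xs j = (if j < length xs then nth0 xs j else \<zero>\<^bsub>S\<^esub>)"

definition monom0 :: "nat ring \<Rightarrow> nat list \<Rightarrow> nat list \<Rightarrow> nat" where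
  "monom0 S xs es = rec_nat \<one>\<^bsub>S\<^esub> (\<lambda>j r. mult0 S r (pow0 S (padded0 S xs j) (nth0 es j))) (length es)"

text \<open>\<open>k\<close> is an integer in the coding of \<open>int_decode\<close>: an even code
  stands for \<open>k div 2\<close>, an odd one for the negative of
  \<open>Suc (k div 2)\<close>.\<close>

definition smul0 :: "nat ring \<Rightarrow> nat \<Rightarrow> nat \<Rightarrow> nat" where
  "smul0 S k x = (if k mod 2 = 0 then nsmul0 S (k div 2) x else neg0 S (nsmul0 S (Suc (k div 2)) x))"

definition peval0 :: "nat ring \<Rightarrow> nat \<Rightarrow> nat list \<Rightarrow> nat" where
  "peval0 S c xs = fold (\<lambda>t acc. add0 S acc (smul0 S (nfst t) (monom0 S xs (list_decode (nsnd t)))))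
     (list_decode c) \<zero>\<^bsub>S\<^esub>"

context
  fixes R :: "nat \<Rightarrow> nat ring"
  assumes R: "uniformly_computable_fields R"
begin

lemma total_rec_carrier: "total_rec (\<lambda>z. of_bool (nsnd z \<in> carrier (R (nfst z))))"
proof -
  obtain \<phi> where \<phi>: "partial_recursive \<phi>"
      "\<And>i x. \<phi> (list_encode [i, x]) = Some (of_bool (x \<in> carrier (R i)))"
    using R unfolding uniformly_computable_fields_def uniformly_computable_sets_def by blast
  have "partial_recursive (\<lambda>z. \<phi> (Suc (prod_encode (nfst z, Suc (prod_encode (nsnd z, 0))))))"
    by (rule partial_recursive_comp_total[OF \<phi>(1)]) (intro total_rec_intros)
  then show ?thesis using \<phi>(2) by (simp add: total_rec_def)
qed

lemma adec_carrier:
  assumes "arec U n" "arec U x" shows "adec U (\<lambda>i z. x i z \<in> carrier (R (n i z)))"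
  using adec_total[OF total_rec_carrier arec_pair[OF assms]] by simp

lemma arec_zero: "arec U n \<Longrightarrow> arec U (\<lambda>i z. \<zero>\<^bsub>R (n i z)\<^esub>)"
  and arec_one: "arec U n \<Longrightarrow> arec U (\<lambda>i z. \<one>\<^bsub>R (n i z)\<^esub>)"
  using R arec_total unfolding uniformly_computable_fields_def uniformly_computable_elements_def
    total_rec_def[symmetric] by auto

lemma arec_guarded_binop:
  assumes "uniformly_computable_binops (\<lambda>i. carrier (R i)) f" "arec U n" "arec U x" "arec U y"
  shows "arec U (\<lambda>i z. if x i z \<in> carrier (R (n i z)) \<and> y i z \<in> carrier (R (n i z))
    then f (n i z) (x i z) (y i z) else 0)"
proof -
  obtain \<phi> where \<phi>: "partial_recursive \<phi>"
      "\<forall>i. \<forall>x\<in>carrier (R i). \<forall>y\<in>carrier (R i). \<phi> (list_encode [i, x, y]) = Some (f i x y)"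
    using assms(1) unfolding uniformly_computable_binops_def by blast
  show ?thesis
    by (rule arec_if_partial[OF \<phi>(1), where g = "\<lambda>i z. list_encode [n i z, x i z, y i z]"])
      (use \<phi>(2) in \<open>auto intro!: arec_intros adec_carrier assms\<close>)
qed

lemma arec_add0: "arec U n \<Longrightarrow> arec U x \<Longrightarrow> arec U y \<Longrightarrow> arec U (\<lambda>i z. add0 (R (n i z)) (x i z) (y i z))"
  and arec_mult0: "arec U n \<Longrightarrow> arec U x \<Longrightarrow> arec U y \<Longrightarrow> arec U (\<lambda>i z. mult0 (R (n i z)) (x i z) (y i z))"
  unfolding add0_def mult0_def
  using arec_guarded_binop[where f = "\<lambda>i x y. x \<oplus>\<^bsub>R i\<^esub> y"]
    arec_guarded_binop[where f = "\<lambda>i x y. x \<otimes>\<^bsub>R i\<^esub> y"] R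
  unfolding uniformly_computable_fields_def by blast+

lemmas field_intros = adec_carrier arec_zero arec_one arec_add0 arec_mult0

lemma arec_pow0:
  assumes "arec U n" "arec U x" "arec U e"
  shows "arec U (\<lambda>i z. pow0 (R (n i z)) (x i z) (e i z))"
  unfolding pow0_def
  by (intro arec_rec field_intros arec_intros assms arec_comp[OF assms(1)] arec_comp[OF assms(2)])

lemma arec_nsmul0:
  assumes "arec U n" "arec U x" "arec U e"
  shows "arec U (\<lambda>i z. nsmul0 (R (n i z)) (e i z) (x i z))"
  unfolding nsmul0_def
  by (intro arec_rec field_intros arec_intros assms arec_comp[OF assms(1)] arec_comp[OF assms(2)])

lemma neg0_exists: "\<exists>y. x \<in> carrier (R i) \<longrightarrow> y \<in> carrier (R i) \<and> add0 (R i) x y = \<zero>\<^bsub>R i\<^esub>"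
proof -
  interpret field "R i" using R unfolding uniformly_computable_fields_def by blast
  show ?thesis by (intro exI[of _ "\<ominus>\<^bsub>R i\<^esub> x"]) (auto simp: add0_def r_neg)
qed

lemma arec_neg0:
  assumes "arec U n" "arec U x"
  shows "arec U (\<lambda>i z. neg0 (R (n i z)) (x i z))"
  unfolding neg0_def
  by (intro arec_least field_intros arec_intros assms arec_comp[OF assms(1)] arec_comp[OF assms(2)]
      always_eventually allI neg0_exists)

lemma arec_padded0:
  assumes "arec U n" "alist U xs" "arec U j"
  shows "arec U (\<lambda>i z. padded0 (R (n i z)) (xs i z) (j i z))"
  unfolding padded0_def by (intro arec_if arec_intros field_intros assms)

lemma arec_monom0:
  assumes "arec U n" "alist U xs" "alist U es"
  shows "arec U (\<lambda>i z. monom0 (R (n i z)) (xs i z) (es i z))"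
  unfolding monom0_def
  by (intro arec_rec field_intros arec_pow0 arec_padded0 arec_intros assms arec_comp[OF assms(1)]
      alist_comp[OF assms(2)] alist_comp[OF assms(3)])

lemma arec_mod2: assumes "arec U k" shows "arec U (\<lambda>i z. k i z mod 2)"
proof -
  have "arec U (\<lambda>i z. rec_nat 0 (\<lambda>_ r. 1 - r) (k i z))"
    by (intro arec_rec arec_intros assms)
  moreover have "rec_nat 0 (\<lambda>_ r. 1 - r) m = m mod 2" for m :: nat
    by (induction m) (auto simp: mod_Suc)
  ultimately show ?thesis by simp
qed

lemma arec_div2: assumes "arec U k" shows "arec U (\<lambda>i z. k i z div 2)"
proof -
  \<comment> \<open>Half of \<open>m\<close>, rounded down, counts the odd numbers below
    \<open>m\<close>.\<close>
  have "arec U (\<lambda>i z. rec_nat 0 (\<lambda>j r. r + j mod 2) (k i z))"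
    by (intro arec_rec arec_mod2 arec_intros assms)
  moreover have "rec_nat 0 (\<lambda>j r. r + j mod 2) m = m div 2" for m :: nat
  proof (induction m)
    case (Suc m)
    then show ?case by (simp, presburger)
  qed simp
  ultimately show ?thesis by simp
qed

lemma arec_smul0:
  assumes "arec U n" "arec U k" "arec U x"
  shows "arec U (\<lambda>i z. smul0 (R (n i z)) (k i z) (x i z))"
  unfolding smul0_def
  by (intro arec_if arec_neg0 arec_nsmul0 arec_mod2 arec_div2 arec_intros assms)

lemma arec_peval0:
  assumes "arec U n" "arec U c" "alist U xs"
  shows "arec U (\<lambda>i z. peval0 (R (n i z)) (c i z) (xs i z))"
  unfolding peval0_def
  by (intro arec_fold field_intros arec_smul0 arec_monom0 arec_intros assms arec_comp[OF assms(1)]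
      alist_comp[OF assms(3)])

end

section \<open>Agreement of the computed value with the algebraic one\<close>

definition monom_eval :: "('a, 'b) ring_scheme \<Rightarrow> 'a list \<Rightarrow> (nat \<Rightarrow>\<^sub>0 nat) \<Rightarrow> 'a" where
  "monom_eval R xs m = (\<Otimes>\<^bsub>R\<^esub>j\<in>Poly_Mapping.keys m. padded R xs j [^]\<^bsub>R\<^esub> Poly_Mapping.lookup m j)"

text \<open>
  Unlike \<^const>\<open>poly_eval\<close>, this is additive without any condition on the variables occurring in \<open>p\<close>; a sum of
  terms may have fewer variables than the terms.
\<close>

definition padded_eval :: "('a, 'b) ring_scheme \<Rightarrow> int_mpoly \<Rightarrow> 'a list \<Rightarrow> 'a" where
  "padded_eval R p xs = (\<Oplus>\<^bsub>R\<^esub>m\<in>Poly_Mapping.keys p. [Poly_Mapping.lookup p m] \<cdot>\<^bsub>R\<^esub> monom_eval R xs m)"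

lemma poly_var_less:
  assumes "m \<in> Poly_Mapping.keys p" "j \<in> Poly_Mapping.keys m" shows "j < poly_var p"
proof -
  have "finite (insert 0 (\<Union>m\<in>Poly_Mapping.keys p. Suc ` Poly_Mapping.keys m))" by simp
  then have "Suc j \<le> poly_var p"
    unfolding poly_var_def using assms by (intro Max_ge) auto
  then show ?thesis by simp
qed

context cring
begin

lemma padded_closed: "set xs \<subseteq> carrier R \<Longrightarrow> padded R xs j \<in> carrier R"
  by (auto simp: padded_def)

lemma monom_eval_closed: "set xs \<subseteq> carrier R \<Longrightarrow> monom_eval R xs m \<in> carrier R"
  unfolding monom_eval_def by (intro finprod_closed) (auto simp: padded_closed)

lemma padded_eval_closed: "set xs \<subseteq> carrier R \<Longrightarrow> padded_eval R p xs \<in> carrier R"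
  unfolding padded_eval_def by (intro finsum_closed) (auto simp: monom_eval_closed)

lemma poly_eval_padded:
  assumes "set xs \<subseteq> carrier R" "poly_var p \<le> length xs"
  shows "poly_eval R p xs = padded_eval R p xs"
  unfolding poly_eval_def padded_eval_def
proof (rule add.finprod_cong')
  fix m assume m: "m \<in> Poly_Mapping.keys p"
  have "(\<Otimes>j\<in>Poly_Mapping.keys m. (xs ! j) [^] Poly_Mapping.lookup m j) = monom_eval R xs m"
    unfolding monom_eval_def
  proof (rule finprod_cong')
    fix j assume "j \<in> Poly_Mapping.keys m"
    then have "j < length xs" using poly_var_less[OF m] assms(2) by fastforce
    then show "(xs ! j) [^] Poly_Mapping.lookup m j = padded R xs j [^] Poly_Mapping.lookup m j"
      by (simp add: padded_def)
  qed (use padded_closed[OF assms(1)] in auto)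
  then show "[Poly_Mapping.lookup p m] \<cdot> (\<Otimes>j\<in>Poly_Mapping.keys m. (xs ! j) [^] Poly_Mapping.lookup m j) =
      [Poly_Mapping.lookup p m] \<cdot> monom_eval R xs m" by simp
qed (use monom_eval_closed[OF assms(1)] in auto)

text \<open>Monomials outside the support have coefficient 0. This puts two polynomials on a common
  index set, where their sum can be taken termwise.\<close>

lemma padded_eval_superset:
  assumes "set xs \<subseteq> carrier R" "finite A" "Poly_Mapping.keys p \<subseteq> A"
  shows "padded_eval R p xs = (\<Oplus>m\<in>A. [Poly_Mapping.lookup p m] \<cdot> monom_eval R xs m)"
  unfolding padded_eval_def
  by (rule add.finprod_mono_neutral_cong_left)
    (use assms monom_eval_closed[OF assms(1)] in \<open>auto simp: in_keys_iff add_pow_int_ge\<close>)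

lemma padded_eval_add:
  assumes "set xs \<subseteq> carrier R"
  shows "padded_eval R (p + q) xs = padded_eval R p xs \<oplus> padded_eval R q xs"
proof -
  let ?A = "Poly_Mapping.keys p \<union> Poly_Mapping.keys q"
  have "padded_eval R (p + q) xs = (\<Oplus>m\<in>?A. [Poly_Mapping.lookup (p + q) m] \<cdot> monom_eval R xs m)"
    by (rule padded_eval_superset[OF assms]) (use Poly_Mapping.keys_add[of p q] in auto)
  also have "\<dots> = (\<Oplus>m\<in>?A. [Poly_Mapping.lookup p m] \<cdot> monom_eval R xs m \<oplus>
      [Poly_Mapping.lookup q m] \<cdot> monom_eval R xs m)"
    by (rule add.finprod_cong') (use monom_eval_closed[OF assms] in
      \<open>auto simp: lookup_add add.int_pow_mult\<close>)
  also have "\<dots> = padded_eval R p xs \<oplus> padded_eval R q xs"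
    using monom_eval_closed[OF assms]
    by (subst finsum_addf) (auto simp: padded_eval_superset[OF assms, of ?A, symmetric])
  finally show ?thesis .
qed

lemma padded_eval_single:
  assumes "set xs \<subseteq> carrier R"
  shows "padded_eval R (Poly_Mapping.single m k) xs = [k] \<cdot> monom_eval R xs m"
  using padded_eval_superset[OF assms, of "{m}" "Poly_Mapping.single m k"] monom_eval_closed[OF assms]
  by (auto simp: finsum_insert[of "{}" m])

lemma padded_eval_zero: "padded_eval R 0 xs = \<zero>"
  by (simp add: padded_eval_def)

lemma monom_eval_nth:
  assumes "set xs \<subseteq> carrier R"
  shows "monom_eval R xs (Poly_Mapping.nth es) =
    (\<Otimes>j\<in>{..<length es}. padded R xs j [^] nth_default 0 es j)"
  unfolding monom_eval_def
  by (rule finprod_mono_neutral_cong_left)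
    (use padded_closed[OF assms] in \<open>auto simp: in_keys_iff nth_default_def simp del: keys_nth split: if_splits\<close>)

end

lemma int_smul0:
  assumes "cring S" "x \<in> carrier S"
  shows "smul0 S k x = [int_decode k] \<cdot>\<^bsub>S\<^esub> x"
proof -
  interpret cring S by fact
  have n: "nsmul0 S m x = [m] \<cdot>\<^bsub>S\<^esub> x" for m :: nat
    using assms(2) by (induction m) (auto simp: nsmul0_def add0_def)
  have neg: "neg0 S y = \<ominus>\<^bsub>S\<^esub> y" if y: "y \<in> carrier S" for y
    unfolding neg0_def
  proof (rule Least_equality)
    show "y \<in> carrier S \<longrightarrow> \<ominus>\<^bsub>S\<^esub> y \<in> carrier S \<and> add0 S y (\<ominus>\<^bsub>S\<^esub> y) = \<zero>\<^bsub>S\<^esub>"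
      by (auto simp: add0_def r_neg)
    fix z assume "y \<in> carrier S \<longrightarrow> z \<in> carrier S \<and> add0 S y z = \<zero>\<^bsub>S\<^esub>"
    then have "z \<in> carrier S" "z \<oplus>\<^bsub>S\<^esub> y = \<zero>\<^bsub>S\<^esub>" using y by (auto simp: add0_def a_comm)
    then have "z = \<ominus>\<^bsub>S\<^esub> y" using y minus_equality by metis
    then show "\<ominus>\<^bsub>S\<^esub> y \<le> z" by simp
  qed
  show ?thesis
  proof (cases "even k")
    case True
    then show ?thesis
      by (simp add: smul0_def n int_decode_def sum_decode_def add_pow_int_ge even_iff_mod_2_eq_zero[symmetric])
  next
    case False
    then have "nat (- int_decode k) = Suc (k div 2)" "int_decode k < 0"
      by (auto simp: int_decode_def sum_decode_def)
    then show ?thesis using False assms(2) n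
      by (simp only: smul0_def even_iff_mod_2_eq_zero[symmetric] if_False neg add.nat_pow_closed add_pow_int_lt)
  qed
qed

lemma monom0_eq:
  assumes "cring S" "set xs \<subseteq> carrier S"
  shows "monom0 S xs es = monom_eval S xs (Poly_Mapping.nth es)"
proof -
  interpret cring S by fact
  have p: "pow0 S y e = y [^]\<^bsub>S\<^esub> e" if "y \<in> carrier S" for y e
    using that by (induction e) (auto simp: pow0_def mult0_def)
  have pad: "padded0 S xs = padded S xs"
    by (auto simp: padded0_def padded_def fun_eq_iff)
  have "rec_nat \<one>\<^bsub>S\<^esub> (\<lambda>j r. mult0 S r (pow0 S (padded0 S xs j) (nth0 es j))) m =
      (\<Otimes>\<^bsub>S\<^esub>j\<in>{..<m}. padded S xs j [^]\<^bsub>S\<^esub> nth_default 0 es j)" for m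
  proof (induction m)
    case (Suc m)
    have "(\<Otimes>\<^bsub>S\<^esub>j\<in>{..<m}. padded S xs j [^]\<^bsub>S\<^esub> nth_default 0 es j) \<in> carrier S"
      by (intro finprod_closed) (use padded_closed[OF assms(2)] in auto)
    then show ?case using Suc padded_closed[OF assms(2)]
      by (simp add: lessThan_Suc finprod_insert mult0_def p pad m_comm nth0_def nth_default_def)
  qed simp
  then show ?thesis by (simp add: monom0_def monom_eval_nth[OF assms(2)])
qed

text \<open>A presentation may repeat monomials, and terms may cancel. The fold adds one listed term
  at a time, and additivity of \<open>padded_eval\<close> identifies the running total.\<close>

lemma peval0_eq:
  assumes "cring S" "set xs \<subseteq> carrier S"
  shows "peval0 S c xs = padded_eval S (poly_decode c) xs"
proof -
  interpret cring S by fact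
  let ?t = "\<lambda>t. case prod_decode t of (k, es) \<Rightarrow>
     Poly_Mapping.single (Poly_Mapping.nth (list_decode es)) (int_decode k)"
  have "fold (\<lambda>t acc. add0 S acc (smul0 S (nfst t) (monom0 S xs (list_decode (nsnd t))))) ts a =
      a \<oplus>\<^bsub>S\<^esub> padded_eval S (\<Sum>t\<leftarrow>ts. ?t t) xs" if "a \<in> carrier S" for ts a
    using that
  proof (induction ts arbitrary: a)
    case Nil
    then show ?case by (simp add: padded_eval_zero)
  next
    case (Cons t ts)
    let ?m = "monom0 S xs (list_decode (nsnd t))"
    have m: "?m = monom_eval S xs (Poly_Mapping.nth (list_decode (nsnd t)))"
      by (rule monom0_eq[OF assms])
    then have mc: "?m \<in> carrier S" by (simp add: monom_eval_closed[OF assms(2)])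
    have s: "smul0 S (nfst t) ?m = padded_eval S (?t t) xs"
      unfolding m int_smul0[OF assms(1) monom_eval_closed[OF assms(2)]]
      by (simp only: nfst_def nsnd_def case_prod_beta padded_eval_single[OF assms(2)])
    then show ?case
      using Cons padded_eval_closed[OF assms(2)]
      by (simp add: add0_def padded_eval_add[OF assms(2)] a_assoc)
  qed
  then show ?thesis
    by (simp add: peval0_def poly_decode_def padded_eval_closed[OF assms(2)])
qed

text \<open>Integer multiples are iterated sums or negatives of such, so a ring homomorphism
  respects the coefficients.\<close>

lemma poly_eval_hom:
  assumes "cring R" "cring S" "h \<in> ring_hom R S" "set xs \<subseteq> carrier R" "poly_var p \<le> length xs"
  shows "h (poly_eval R p xs) = poly_eval S p (map h xs)"
proof -
  interpret ring_hom_cring R S h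
    using assms(1-3) by (simp add: ring_hom_cring_def ring_hom_cring_axioms_def)
  have m: "set (map h xs) \<subseteq> carrier S" using assms(4) by auto
  have pad: "h (padded R xs j) = padded S (map h xs) j" for j
    by (simp add: padded_def)
  have pw: "h (y [^]\<^bsub>R\<^esub> (e::nat)) = h y [^]\<^bsub>S\<^esub> e" if "y \<in> carrier R" for y e
    using that by (induction e) auto
  have ns: "h ([k] \<cdot>\<^bsub>R\<^esub> y) = [k] \<cdot>\<^bsub>S\<^esub> h y" if "y \<in> carrier R" for k :: nat and y
    using that by (induction k) auto
  have smul: "h ([k] \<cdot>\<^bsub>R\<^esub> y) = [k] \<cdot>\<^bsub>S\<^esub> h y" if "y \<in> carrier R" for k :: int and y
    using that ns by (cases "k \<ge> 0") (simp_all add: add_pow_int_ge add_pow_int_lt)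
  have mon: "h (monom_eval R xs k) = monom_eval S (map h xs) k" for k
    unfolding monom_eval_def
    by (subst hom_finprod)
      (auto simp: pw R.padded_closed[OF assms(4)] pad S.padded_closed[OF m] intro!: S.finprod_cong')
  have "h (padded_eval R p xs) = padded_eval S p (map h xs)"
    unfolding padded_eval_def
    by (subst hom_finsum)
      (auto simp: smul R.monom_eval_closed[OF assms(4)] mon S.monom_eval_closed[OF m] intro!: S.add.finprod_cong')
  then show ?thesis
    using assms(5) by (simp add: R.poly_eval_padded[OF assms(4)] S.poly_eval_padded[OF m])
qed

section \<open>Hyper-embeddings\<close>

definition lval :: "hyper \<Rightarrow> nat \<Rightarrow> nat list" where
  "lval a i = list_decode (val a i)"

definition hlist :: "nat set \<Rightarrow> (nat \<Rightarrow> nat list) \<Rightarrow> hyper" where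
  "hlist C f = hclass C (\<lambda>i. list_encode (f i))"

abbreviation seq_list :: "nat set \<Rightarrow> (nat \<Rightarrow> nat list) \<Rightarrow> bool" where
  "seq_list C f \<equiv> alist (almost_all C) (\<lambda>i _. f i)"

lemma hlist_hyper_nat: "seq_list C f \<Longrightarrow> hlist C f \<in> hyper_nat C"
  unfolding hlist_def by (rule hclass_hyper_nat) (simp add: alist_def)

lemma lval_hlist: "seq_list C f \<Longrightarrow> \<forall>\<^sub>F i in almost_all C. lval (hlist C f) i = f i"
  unfolding hlist_def
  by (rule eventually_mono[OF val_hclass]) (auto simp: alist_def lval_def)

lemma hlist_cong: "\<forall>\<^sub>F i in almost_all C. f i = g i \<Longrightarrow> hlist C f = hlist C g"
  unfolding hlist_def by (rule hclass_cong) (erule eventually_mono, simp)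

lemma lval_rec: "a \<in> hyper_nat C \<Longrightarrow> seq_list C (lval a)"
  using hyper_nat_val(1)[of a C] unfolding lval_def by (intro arec_intros)

lemma hlist_lval: "a \<in> hyper_nat C \<Longrightarrow> hlist C (lval a) = a"
  using hyper_nat_val(2)[of a C] by (simp add: hlist_def lval_def)

lemma hyper_list_eqI:
  assumes "a \<in> hyper_nat C" "b \<in> hyper_nat C" "\<forall>\<^sub>F i in almost_all C. lval a i = lval b i"
  shows "a = b"
  using hlist_cong[OF assms(3)] hlist_lval assms(1,2) by metis

lemma hclass_eq_iff:
  assumes "seq_rec C f" "seq_rec C g"
  shows "hclass C f = hclass C g \<longleftrightarrow> (\<forall>\<^sub>F i in almost_all C. f i = g i)"
proof
  assume *: "hclass C f = hclass C g"
  have "\<forall>\<^sub>F i in almost_all C. val (hclass C f) i = g i"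
    using val_hclass[OF assms(2)] by (simp add: *)
  then show "\<forall>\<^sub>F i in almost_all C. f i = g i"
    using val_hclass[OF assms(1)] by eventually_elim simp
qed (rule hclass_cong)

lemma hlist_eq_iff:
  assumes "seq_list C f" "seq_list C g"
  shows "hlist C f = hlist C g \<longleftrightarrow> (\<forall>\<^sub>F i in almost_all C. f i = g i)"
  using hclass_eq_iff[OF assms[unfolded alist_def]] by (simp add: hlist_def)

lemma hyper_prefix_iff:
  assumes "a \<in> hyper_nat C" "b \<in> hyper_nat C"
  shows "hyper_prefix C a b \<longleftrightarrow> (\<forall>\<^sub>F i in almost_all C. prefix (lval a i) (lval b i))"
proof -
  have "(\<forall>\<^sub>F i in almost_all C. \<exists>x y. rep a i = Some x \<and> rep b i = Some y \<and>
      prefix (list_decode x) (list_decode y)) \<longleftrightarrow> (\<forall>\<^sub>F i in almost_all C. prefix (lval a i) (lval b i))"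
  proof (rule eventually_cong[OF eventually_conj[OF hyper_nat_val(4)[OF assms(1)] hyper_nat_val(4)[OF assms(2)]]])
  qed (auto simp: lval_def)
  then show ?thesis by (simp add: hyper_prefix_def eventually_almost_all)
qed

lemma hyper_append_eq:
  assumes "a \<in> hyper_nat C" "b \<in> hyper_nat C"
  shows "hyper_append C a b = hlist C (\<lambda>i. lval a i @ lval b i)"
  unfolding hyper_append_def hlist_def
  by (rule coh_class_eq_hclass)
    (use hyper_nat_val(4)[OF assms(1)] hyper_nat_val(4)[OF assms(2)] in \<open>eventually_elim, simp add: lval_def\<close>)

lemma arity_eq:
  assumes "a \<in> hyper_nat C" shows "arity C a = hclass C (\<lambda>i. length (lval a i))"
  unfolding arity_def
  by (rule coh_class_eq_hclass) (use hyper_nat_val(4)[OF assms] in \<open>eventually_elim, simp add: lval_def\<close>)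

lemma arity_eq_iff:
  assumes "a \<in> hyper_nat C" "b \<in> hyper_nat C"
  shows "arity C a = arity C b \<longleftrightarrow> (\<forall>\<^sub>F i in almost_all C. length (lval a i) = length (lval b i))"
  unfolding arity_eq[OF assms(1)] arity_eq[OF assms(2)]
  by (intro hclass_eq_iff arec_length lval_rec assms)

lemma hyper_singleton_eq:
  assumes "\<forall>\<^sub>F i in almost_all C. rep a i = Some (f i)"
  shows "hyper_singleton C a = hlist C (\<lambda>i. [f i])"
  unfolding hyper_singleton_def hlist_def
  by (rule coh_class_eq_hclass) (use assms in \<open>eventually_elim, simp\<close>)

text \<open>Covers the levels, with \<open>n\<close> the values of a hypernatural, and constant
  sequences, with \<open>n = 0\<close>. The partial function \<open>\<nu>\<close> is kept beside
  \<open>n\<close> because \<open>L\<close> has to be literally the partial sequence occurring in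
  the theorem, undefined where the representative is.\<close>

definition hyper_field :: "nat set \<Rightarrow> (nat \<Rightarrow> nat ring) \<Rightarrow> (nat \<Rightarrow> nat) \<Rightarrow> (nat \<Rightarrow> nat ring option) \<Rightarrow> bool"
where
  "hyper_field C R n L \<longleftrightarrow> uniformly_computable_fields R \<and> seq_rec C n \<and>
    (\<exists>\<nu>. partial_recursive \<nu> \<and> (\<forall>\<^sub>F i in almost_all C. \<nu> i = Some (n i)) \<and> L = (\<lambda>i. map_option R (\<nu> i)))"

lemma hyper_field_eventually:
  "hyper_field C R n L \<Longrightarrow> \<forall>\<^sub>F i in almost_all C. L i = Some (R (n i))"
  unfolding hyper_field_def by (auto elim: eventually_mono)

lemma hyper_field_field: "hyper_field C R n L \<Longrightarrow> field (R i)"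
  unfolding hyper_field_def uniformly_computable_fields_def by blast

lemma hyper_field_cring: "hyper_field C R n L \<Longrightarrow> cring (R i)"
  using hyper_field_field by (blast intro: fieldE)

lemma coh_tuples_iff:
  assumes "hyper_field C R n L"
  shows "a \<in> coh_tuples C L \<longleftrightarrow> a \<in> hyper_nat C \<and> (\<forall>\<^sub>F i in almost_all C. set (lval a i) \<subseteq> carrier (R (n i)))"
proof -
  obtain \<nu> where R: "uniformly_computable_fields R"
      and \<nu>: "partial_recursive \<nu>" "\<forall>\<^sub>F i in almost_all C. \<nu> i = Some (n i)"
      and L: "L = (\<lambda>i. map_option R (\<nu> i))"
    using assms unfolding hyper_field_def by blast
  let ?S = "\<lambda>k. list_encode ` lists (carrier (R k))"
  have S: "x \<in> ?S k \<longleftrightarrow> (\<forall>y\<in>set (list_decode x). y \<in> carrier (R k))" for x k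
  proof
    assume "\<forall>y\<in>set (list_decode x). y \<in> carrier (R k)"
    then have "list_decode x \<in> lists (carrier (R k))" by auto
    then show "x \<in> ?S k" using list_decode_inverse by (metis image_eqI)
  qed auto
  have "adec (principal UNIV) (\<lambda>_ z. \<forall>y\<in>set (list_decode (nsnd z)). y \<in> carrier (R (nfst z)))"
    by (intro arec_intros adec_carrier[OF R])
  then have t: "total_rec (\<lambda>z. of_bool (nsnd z \<in> ?S (nfst z)))"
    unfolding S adec_def by (rule total_rec_of_arec)
  show ?thesis
    using coh_prod_iff[OF \<nu> t] unfolding coh_tuples_def L S
    by (simp add: option.map_comp comp_def lval_def subset_eq)
qed

lemma coh_tuples_hyper_nat: "hyper_field C R n L \<Longrightarrow> a \<in> coh_tuples C L \<Longrightarrow> a \<in> hyper_nat C"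
  by (simp add: coh_tuples_iff)

lemma hlist_tuple:
  assumes "hyper_field C R n L" "seq_list C f" "\<forall>\<^sub>F i in almost_all C. set (f i) \<subseteq> carrier (R (n i))"
  shows "hlist C f \<in> coh_tuples C L"
proof -
  have "\<forall>\<^sub>F i in almost_all C. set (lval (hlist C f) i) \<subseteq> carrier (R (n i))"
    using assms(3) lval_hlist[OF assms(2)] by eventually_elim simp
  then show ?thesis by (simp add: coh_tuples_iff[OF assms(1)] hlist_hyper_nat[OF assms(2)])
qed

lemma hyper_append_tuple:
  assumes "hyper_field C R n L" "a \<in> coh_tuples C L" "b \<in> coh_tuples C L"
  shows "hyper_append C a b \<in> coh_tuples C L"
proof -
  note T = coh_tuples_iff[OF assms(1)]
  have h: "a \<in> hyper_nat C" "b \<in> hyper_nat C" using assms(2,3) by (simp_all add: T)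
  have "\<forall>\<^sub>F i in almost_all C. set (lval a i @ lval b i) \<subseteq> carrier (R (n i))"
    using assms(2)[unfolded T, THEN conjunct2] assms(3)[unfolded T, THEN conjunct2]
    by eventually_elim simp
  then show ?thesis
    unfolding hyper_append_eq[OF h]
    by (intro hlist_tuple[OF assms(1)] alist_append lval_rec h)
qed

lemma lval_append:
  assumes "a \<in> hyper_nat C" "b \<in> hyper_nat C"
  shows "\<forall>\<^sub>F i in almost_all C. lval (hyper_append C a b) i = lval a i @ lval b i"
  unfolding hyper_append_eq[OF assms] by (intro lval_hlist alist_append lval_rec assms)

text \<open>Reduces evaluation of a hyper-polynomial to evaluation of one honest polynomial at each
  of almost all \<open>i\<close>, with the right number of arguments. All later uses of
  \<open>hyper_eval\<close> pass through this.\<close>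

lemma hyper_evalE:
  assumes L: "hyper_field C R n L" and a: "a \<in> coh_tuples C L"
    and p: "hyper_poly C p" "arity C a = hyper_var C p"
  obtains q where "\<forall>\<^sub>F i in almost_all C. p i = Some (q i)"
    "\<forall>\<^sub>F i in almost_all C. poly_var (q i) = length (lval a i)"
    "seq_list C (\<lambda>i. [poly_eval (R (n i)) (q i) (lval a i)])"
    "hyper_singleton C (hyper_eval C L p a) = hlist C (\<lambda>i. [poly_eval (R (n i)) (q i) (lval a i)])"
    "hyper_singleton C (hyper_eval C L p a) \<in> coh_tuples C L"
proof -
  have R: "uniformly_computable_fields R" and n: "seq_rec C n"
    using L unfolding hyper_field_def by blast+
  have ah: "a \<in> hyper_nat C" and ac: "\<forall>\<^sub>F i in almost_all C. set (lval a i) \<subseteq> carrier (R (n i))"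
    using a by (simp_all add: coh_tuples_iff[OF L])
  obtain \<phi> where \<phi>: "C \<subseteq>* dom p" "partial_recursive \<phi>" "p = (\<lambda>i. map_option poly_decode (\<phi> i))"
    using p(1) unfolding hyper_poly_def by blast
  define c where "c i = the (\<phi> i)" for i
  have c: "\<forall>\<^sub>F i in almost_all C. \<phi> i = Some (c i)"
    using \<phi>(1)[unfolded almost_subset_dom] by eventually_elim (auto simp: c_def \<phi>(3))
  have cr: "seq_rec C c" unfolding seq_rec_iff using \<phi>(2) c by blast
  define q where "q i = poly_decode (c i)" for i
  have pq: "\<forall>\<^sub>F i in almost_all C. p i = Some (q i)"
    using c by eventually_elim (simp add: \<phi>(3) q_def)
  have "arity C a = hclass C (\<lambda>i. length (lval a i))" by (rule arity_eq[OF ah])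
  moreover have "seq_rec C (\<lambda>i. length (lval a i))" by (intro arec_length lval_rec ah)
  \<comment> \<open>Equal classes can be compared only through a common member. The lengths form a
    recursive sequence, so their class is inhabited and its chosen representative is such a
    member.\<close>
  ultimately have "rep (arity C a) \<in> arity C a"
    using rep_hclass[of C "\<lambda>i. length (lval a i)"] by (simp add: hclass_def coh_class_alt)
  then have "rep (arity C a) \<in> coh_class C (\<lambda>i. map_option poly_var (p i))"
      "rep (arity C a) \<in> coh_class C (\<lambda>i. Some (length (lval a i)))"
    using p(2) arity_eq[OF ah] by (simp_all add: hyper_var_def hclass_def)
  then have "\<forall>\<^sub>F i in almost_all C. \<exists>x. map_option poly_var (p i) = Some x \<and> rep (arity C a) i = Some x"
      "\<forall>\<^sub>F i in almost_all C. rep (arity C a) i = Some (length (lval a i))"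
    by (simp_all add: coh_class_alt)
  then have var: "\<forall>\<^sub>F i in almost_all C. poly_var (q i) = length (lval a i)"
    using pq by eventually_elim auto
  let ?e = "\<lambda>i. poly_eval (R (n i)) (q i) (lval a i)"
  \<comment> \<open>The algebraic value is almost everywhere the one computed from the code of the
    polynomial, which makes it a recursive sequence.\<close>
  have ev: "\<forall>\<^sub>F i in almost_all C. ?e i = peval0 (R (n i)) (c i) (lval a i) \<and> ?e i \<in> carrier (R (n i))"
    using var ac
  proof eventually_elim
    case (elim i)
    note cr = hyper_field_cring[OF L, of "n i"]
    show ?case
      using elim peval0_eq[OF cr elim(2), of "c i"] cring.poly_eval_padded[OF cr elim(2), of "q i"]
        cring.padded_eval_closed[OF cr elim(2)] by (simp add: q_def)
  qed
  have "seq_rec C (\<lambda>i. peval0 (R (n i)) (c i) (lval a i))"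
    by (intro arec_peval0[OF R] n cr lval_rec ah)
  then have er: "seq_rec C ?e"
    by (rule seq_rec_cong) (use ev in eventually_elim, simp)
  have "\<forall>\<^sub>F i in almost_all C. Option.bind (L i) (\<lambda>S. Option.bind (p i) (\<lambda>q. Option.bind (rep a i)
      (\<lambda>x. Some (poly_eval S q (list_decode x))))) = Some (?e i)"
    using hyper_field_eventually[OF L] pq hyper_nat_val(4)[OF ah] by eventually_elim (simp add: lval_def)
  then have e: "hyper_eval C L p a = hclass C ?e"
    unfolding hyper_eval_def by (rule coh_class_eq_hclass)
  have s: "hyper_singleton C (hyper_eval C L p a) = hlist C (\<lambda>i. [?e i])"
    unfolding e by (rule hyper_singleton_eq[OF rep_hclass(2)[OF er]])
  have sr: "seq_list C (\<lambda>i. [?e i])" by (intro alist_Cons alist_Nil er)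
  have "hyper_singleton C (hyper_eval C L p a) \<in> coh_tuples C L"
    unfolding s by (rule hlist_tuple[OF L sr]) (use ev in \<open>eventually_elim, auto\<close>)
  with pq var sr s that show thesis by blast
qed

text \<open>The laws of a hyper-automorphism without bijectivity and with different source and
  target. Inclusions of levels, group actions and restrictions are all treated through this
  notion.\<close>

definition hyper_embedding ::
  "nat set \<Rightarrow> (nat \<Rightarrow> nat ring option) \<Rightarrow> (nat \<Rightarrow> nat ring option) \<Rightarrow> (hyper \<Rightarrow> hyper) \<Rightarrow> bool"
where
  "hyper_embedding C L L' J \<longleftrightarrow>
    (\<forall>a\<in>coh_tuples C L. J a \<in> coh_tuples C L') \<and>
    (\<forall>a\<in>coh_tuples C L. \<forall>b\<in>coh_tuples C L. hyper_prefix C (J a) (J b) \<longleftrightarrow> hyper_prefix C a b) \<and>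
    (\<forall>a\<in>coh_tuples C L. \<forall>b\<in>coh_tuples C L. J (hyper_append C a b) = hyper_append C (J a) (J b)) \<and>
    (\<forall>a\<in>coh_tuples C L. arity C (J a) = arity C a) \<and>
    (\<forall>p. \<forall>a\<in>coh_tuples C L. hyper_poly C p \<and> arity C a = hyper_var C p \<longrightarrow>
       hyper_singleton C (hyper_eval C L' p (J a)) = J (hyper_singleton C (hyper_eval C L p a)))"

lemma hyper_prefix_antisym:
  assumes "a \<in> hyper_nat C" "b \<in> hyper_nat C" "hyper_prefix C a b" "hyper_prefix C b a"
  shows "a = b"
proof (rule hyper_list_eqI[OF assms(1,2)])
  show "\<forall>\<^sub>F i in almost_all C. lval a i = lval b i"
    using assms(3,4)[unfolded hyper_prefix_iff[OF assms(1,2)] hyper_prefix_iff[OF assms(2,1)]]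
    by eventually_elim (rule prefix_order.antisym)
qed

lemma hyper_prefix_refl: "a \<in> hyper_nat C \<Longrightarrow> hyper_prefix C a a"
  by (simp add: hyper_prefix_iff)

text \<open>Equal images are prefixes of each other, and the prefix order is reflected and
  antisymmetric.\<close>

lemma hyper_embedding_inj:
  assumes "hyper_field C R n L" "hyper_field C R' n' L'" "hyper_embedding C L L' J"
  shows "inj_on J (coh_tuples C L)"
proof (rule inj_onI)
  fix a b assume *: "a \<in> coh_tuples C L" "b \<in> coh_tuples C L" "J a = J b"
  then have h: "a \<in> hyper_nat C" "b \<in> hyper_nat C" "J a \<in> hyper_nat C"
    using assms coh_tuples_hyper_nat unfolding hyper_embedding_def by blast+
  have "hyper_prefix C (J a) (J b)" "hyper_prefix C (J b) (J a)"
    using hyper_prefix_refl[OF h(3)] by (simp_all flip: *(3))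
  then show "a = b"
    using assms(3) * hyper_prefix_antisym[OF h(1,2)] unfolding hyper_embedding_def by blast
qed

lemma field_hauts_iff:
  assumes "hyper_field C R n L"
  shows "\<sigma> \<in> field_hauts C L \<longleftrightarrow>
    \<sigma> \<in> extensional (coh_tuples C L) \<and> \<sigma> ` coh_tuples C L = coh_tuples C L \<and> hyper_embedding C L L \<sigma>"
proof
  assume "\<sigma> \<in> field_hauts C L"
  then show "\<sigma> \<in> extensional (coh_tuples C L) \<and> \<sigma> ` coh_tuples C L = coh_tuples C L \<and> hyper_embedding C L L \<sigma>"
    unfolding field_hauts_def tree_hauts_def hyper_embedding_def Bij_def bij_betw_def by auto
next
  assume *: "\<sigma> \<in> extensional (coh_tuples C L) \<and> \<sigma> ` coh_tuples C L = coh_tuples C L \<and> hyper_embedding C L L \<sigma>"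
  then have "\<sigma> \<in> Bij (coh_tuples C L)"
    using hyper_embedding_inj[OF assms assms] by (simp add: Bij_def bij_betw_def)
  then show "\<sigma> \<in> field_hauts C L"
    using * unfolding field_hauts_def tree_hauts_def hyper_embedding_def by simp
qed

lemma hyper_embedding_cong:
  assumes "hyper_field C R n L" "hyper_embedding C L L' J" "\<And>a. a \<in> coh_tuples C L \<Longrightarrow> J' a = J a"
  shows "hyper_embedding C L L' J'"
proof -
  have "hyper_singleton C (hyper_eval C L p a) \<in> coh_tuples C L"
    if "a \<in> coh_tuples C L" "hyper_poly C p" "arity C a = hyper_var C p" for a p
    using that by (rule hyper_evalE[OF assms(1)])
  then show ?thesis
    using assms(2,3) hyper_append_tuple[OF assms(1)] unfolding hyper_embedding_def by simp
qed

lemma hyper_embedding_comp: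
  assumes "hyper_field C R n L" "hyper_embedding C L L' J" "hyper_embedding C L' L'' J'"
  shows "hyper_embedding C L L'' (\<lambda>a. J' (J a))"
proof -
  have "hyper_singleton C (hyper_eval C L p a) \<in> coh_tuples C L"
    if "a \<in> coh_tuples C L" "hyper_poly C p" "arity C a = hyper_var C p" for a p
    using that by (rule hyper_evalE[OF assms(1)])
  then show ?thesis
    using assms(2,3) unfolding hyper_embedding_def by simp
qed

text \<open>An injective \<open>J\<close> preserving the structure also reflects it, so it can be
  cancelled on the left. This yields the laws for inverses and for restrictions to a level, which
  are defined by pulling back along an embedding.\<close>

lemma hyper_embedding_factor:
  assumes L: "hyper_field C R n L" "hyper_field C R' n' L'" "hyper_field C R0 n0 L0"
    and J: "hyper_embedding C L L' J" and H: "hyper_embedding C L0 L' (\<lambda>a. J (H a))"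
    and "\<And>a. a \<in> coh_tuples C L0 \<Longrightarrow> H a \<in> coh_tuples C L"
  shows "hyper_embedding C L0 L H"
proof -
  note inj = inj_onD[OF hyper_embedding_inj[OF L(1,2) J]]
  have s: "hyper_singleton C (hyper_eval C L0 p a) \<in> coh_tuples C L0"
    if "a \<in> coh_tuples C L0" "hyper_poly C p" "arity C a = hyper_var C p" for a p
    using that by (rule hyper_evalE[OF L(3)])
  have s': "hyper_singleton C (hyper_eval C L p a) \<in> coh_tuples C L"
    if "a \<in> coh_tuples C L" "hyper_poly C p" "arity C a = hyper_var C p" for a p
    using that by (rule hyper_evalE[OF L(1)])
  have ar: "arity C (H a) = arity C a" if "a \<in> coh_tuples C L0" for a
    using that J H assms(6) unfolding hyper_embedding_def by metis
  have pr: "hyper_prefix C (H a) (H b) \<longleftrightarrow> hyper_prefix C a b"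
    if "a \<in> coh_tuples C L0" "b \<in> coh_tuples C L0" for a b
    using that J H assms(6) unfolding hyper_embedding_def by metis
  have ap: "H (hyper_append C a b) = hyper_append C (H a) (H b)"
    if "a \<in> coh_tuples C L0" "b \<in> coh_tuples C L0" for a b
  proof (rule inj)
    show "J (H (hyper_append C a b)) = J (hyper_append C (H a) (H b))"
      using that J H assms(6) unfolding hyper_embedding_def by metis
  qed (use that assms(6) hyper_append_tuple[OF L(1)] hyper_append_tuple[OF L(3)] in auto)
  have ev: "hyper_singleton C (hyper_eval C L p (H a)) = H (hyper_singleton C (hyper_eval C L0 p a))"
    if "a \<in> coh_tuples C L0" "hyper_poly C p" "arity C a = hyper_var C p" for a p
  proof (rule inj)
    have "J (hyper_singleton C (hyper_eval C L p (H a))) = hyper_singleton C (hyper_eval C L' p (J (H a)))"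
      using that J assms(6) ar[OF that(1)] unfolding hyper_embedding_def by metis
    also have "\<dots> = J (H (hyper_singleton C (hyper_eval C L0 p a)))"
      using that H unfolding hyper_embedding_def by metis
    finally show "J (hyper_singleton C (hyper_eval C L p (H a))) = J (H (hyper_singleton C (hyper_eval C L0 p a)))" .
  qed (use that assms(6) ar s s' in auto)
  show ?thesis
    unfolding hyper_embedding_def using assms(6) ar pr ap ev by blast
qed

section \<open>Maps induced coordinatewise by ring homomorphisms\<close>

definition pointwise :: "nat set \<Rightarrow> (nat \<Rightarrow> nat \<Rightarrow> nat) \<Rightarrow> hyper \<Rightarrow> hyper" where
  "pointwise C e a = hlist C (\<lambda>i. map (e i) (lval a i))"

lemma pointwise_hyper_nat:
  assumes "arec (almost_all C) e" "a \<in> hyper_nat C"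
  shows "pointwise C e a \<in> hyper_nat C"
    "\<forall>\<^sub>F i in almost_all C. lval (pointwise C e a) i = map (e i) (lval a i)"
proof -
  have "seq_list C (\<lambda>i. map (e i) (lval a i))"
    by (intro alist_map lval_rec assms arec_comp[OF assms(1)] arec_intros)
  then show "pointwise C e a \<in> hyper_nat C"
      "\<forall>\<^sub>F i in almost_all C. lval (pointwise C e a) i = map (e i) (lval a i)"
    unfolding pointwise_def by (rule hlist_hyper_nat, rule lval_hlist)
qed

lemma hyper_map_eq_pointwise:
  assumes "hyper_field C R n L" "a \<in> coh_tuples C L"
    and "\<forall>\<^sub>F i in almost_all C. \<exists>e'. E i = Some e' \<and> (\<forall>x\<in>carrier (R (n i)). e' x = e i x)"
  shows "hyper_map C E a = pointwise C e a"
proof -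
  have h: "a \<in> hyper_nat C" "\<forall>\<^sub>F i in almost_all C. set (lval a i) \<subseteq> carrier (R (n i))"
    using assms(2) by (simp_all add: coh_tuples_iff[OF assms(1)])
  show ?thesis
    unfolding hyper_map_def pointwise_def hlist_def
  proof (rule coh_class_eq_hclass)
    show "\<forall>\<^sub>F i in almost_all C. Option.bind (E i) (\<lambda>e. Option.bind (rep a i)
        (\<lambda>x. Some (list_encode (map e (list_decode x))))) = Some (list_encode (map (e i) (lval a i)))"
      using assms(3) h(2) hyper_nat_val(4)[OF h(1)]
      by eventually_elim (auto simp: lval_def subset_iff)
  qed
qed

text \<open>Homomorphisms between fields are injective, which gives the reflection of prefixes; the
  law for polynomials is \<open>poly_eval_hom\<close> at each index.\<close>

lemma pointwise_embedding:
  assumes L: "hyper_field C R n L" "hyper_field C R' n' L'" and e: "arec (almost_all C) e"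
    and hom: "\<forall>\<^sub>F i in almost_all C. e i \<in> ring_hom (R (n i)) (R' (n' i))"
  shows "hyper_embedding C L L' (pointwise C e)"
proof -
  note T = coh_tuples_iff[OF L(1)] and P = pointwise_hyper_nat[OF e]
  have inj: "\<forall>\<^sub>F i in almost_all C. inj_on (e i) (carrier (R (n i)))"
    using hom
  proof eventually_elim
    case (elim i)
    show ?case
      using elim hyper_field_field[OF L(1)] hyper_field_field[OF L(2)]
      by (intro non_trivial_field_hom_is_inj)
  qed
  show ?thesis unfolding hyper_embedding_def
  proof (intro conjI ballI allI impI)
    fix a assume a: "a \<in> coh_tuples C L"
    then have ah: "a \<in> hyper_nat C" and ac: "\<forall>\<^sub>F i in almost_all C. set (lval a i) \<subseteq> carrier (R (n i))"
      by (simp_all add: T)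
    note Pa = P[OF ah]
    have "\<forall>\<^sub>F i in almost_all C. set (lval (pointwise C e a) i) \<subseteq> carrier (R' (n' i))"
      using Pa(2) ac hom by eventually_elim (auto simp: ring_hom_def Pi_iff)
    then show Pt: "pointwise C e a \<in> coh_tuples C L'"
      by (simp add: coh_tuples_iff[OF L(2)] Pa)
    show "arity C (pointwise C e a) = arity C a"
      unfolding arity_eq_iff[OF Pa(1) ah] using Pa(2) by eventually_elim simp
    {
      fix b assume b: "b \<in> coh_tuples C L"
      then have bh: "b \<in> hyper_nat C" and bc: "\<forall>\<^sub>F i in almost_all C. set (lval b i) \<subseteq> carrier (R (n i))"
        by (simp_all add: T)
      note Pb = P[OF bh]
      have "\<forall>\<^sub>F i in almost_all C. prefix (lval (pointwise C e a) i) (lval (pointwise C e b) i) \<longleftrightarrow>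
          prefix (lval a i) (lval b i)"
        using Pa(2) Pb(2) inj ac bc
      proof eventually_elim
        case (elim i)
        have "prefix (map (e i) (lval a i)) (map (e i) (lval b i)) \<longleftrightarrow> prefix (lval a i) (lval b i)"
        proof
          assume "prefix (map (e i) (lval a i)) (map (e i) (lval b i))"
          then obtain zs where "map (e i) (lval b i) = map (e i) (lval a i) @ zs" by (rule prefixE)
          then have "map (e i) (take (length (lval a i)) (lval b i)) = map (e i) (lval a i)"
            by (metis append_eq_conv_conj length_map take_map)
          then have "take (length (lval a i)) (lval b i) = lval a i"
            using elim(3-5) set_take_subset[of "length (lval a i)" "lval b i"]
            by (subst (asm) inj_on_map_eq_map) (auto intro: inj_on_subset)
          then show "prefix (lval a i) (lval b i)" by (metis take_is_prefix)
        qed (rule map_mono_prefix)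
        then show ?case using elim by simp
      qed
      then show "hyper_prefix C (pointwise C e a) (pointwise C e b) \<longleftrightarrow> hyper_prefix C a b"
        unfolding hyper_prefix_iff[OF ah bh] hyper_prefix_iff[OF Pa(1) Pb(1)] by (rule eventually_subst)
      show "pointwise C e (hyper_append C a b) = hyper_append C (pointwise C e a) (pointwise C e b)"
        unfolding hyper_append_eq[OF Pa(1) Pb(1)] pointwise_def[of C e "hyper_append C a b"]
        by (rule hlist_cong) (use lval_append[OF ah bh] Pa(2) Pb(2) in eventually_elim, simp)
    }
    fix p assume p: "hyper_poly C p \<and> arity C a = hyper_var C p"
    have p': "hyper_poly C p" "arity C (pointwise C e a) = hyper_var C p"
      using p \<open>arity C (pointwise C e a) = arity C a\<close> by auto
    obtain q where q: "\<forall>\<^sub>F i in almost_all C. p i = Some (q i)"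
      "\<forall>\<^sub>F i in almost_all C. poly_var (q i) = length (lval a i)"
      "seq_list C (\<lambda>i. [poly_eval (R (n i)) (q i) (lval a i)])"
      "hyper_singleton C (hyper_eval C L p a) = hlist C (\<lambda>i. [poly_eval (R (n i)) (q i) (lval a i)])"
      by (rule hyper_evalE[OF L(1) a conjunct1[OF p] conjunct2[OF p]]) (rule that)
    obtain q' where q': "\<forall>\<^sub>F i in almost_all C. p i = Some (q' i)"
      "hyper_singleton C (hyper_eval C L' p (pointwise C e a)) =
        hlist C (\<lambda>i. [poly_eval (R' (n' i)) (q' i) (lval (pointwise C e a) i)])"
      by (rule hyper_evalE[OF L(2) Pt p']) (rule that)
    show "hyper_singleton C (hyper_eval C L' p (pointwise C e a)) =
        pointwise C e (hyper_singleton C (hyper_eval C L p a))"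
      unfolding q(4) q'(2) pointwise_def[of C e "hlist C f" for f]
    proof (rule hlist_cong)
      show "\<forall>\<^sub>F i in almost_all C. [poly_eval (R' (n' i)) (q' i) (lval (pointwise C e a) i)] =
          map (e i) (lval (hlist C (\<lambda>i. [poly_eval (R (n i)) (q i) (lval a i)])) i)"
        using lval_hlist[OF q(3)] q(1,2) q'(1) hom Pa(2) ac
      proof eventually_elim
        case (elim i)
        have "e i (poly_eval (R (n i)) (q i) (lval a i)) = poly_eval (R' (n' i)) (q i) (map (e i) (lval a i))"
          by (rule poly_eval_hom[OF hyper_field_cring[OF L(1)] hyper_field_cring[OF L(2)] elim(5,7)])
            (simp add: elim(3))
        then show ?case using elim by simp
      qed
    qed
  qed
qed

section \<open>Hyper-automorphisms and derivable pairs\<close>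

text \<open>
  If a hyper-automorphism fixing \<open>D\<close> maps a tuple \<open>a\<close> to \<open>b\<close> and \<open>A\<close> consists of the pairs
  \<open>(a\<^sub>j, b\<^sub>j)\<close>, these are pairs of an element and its image.
\<close>

inductive_set gen_pairs :: "('a, 'b) ring_scheme \<Rightarrow> 'a set \<Rightarrow> ('a \<times> 'a) set \<Rightarrow> ('a \<times> 'a) set"
  for S D A where
  const: "c \<in> D \<Longrightarrow> (c, c) \<in> gen_pairs S D A"
| base: "p \<in> A \<Longrightarrow> p \<in> gen_pairs S D A"
| add: "(x, y) \<in> gen_pairs S D A \<Longrightarrow> (x', y') \<in> gen_pairs S D A \<Longrightarrow>
    (x \<oplus>\<^bsub>S\<^esub> x', y \<oplus>\<^bsub>S\<^esub> y') \<in> gen_pairs S D A"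
| mult: "(x, y) \<in> gen_pairs S D A \<Longrightarrow> (x', y') \<in> gen_pairs S D A \<Longrightarrow>
    (x \<otimes>\<^bsub>S\<^esub> x', y \<otimes>\<^bsub>S\<^esub> y') \<in> gen_pairs S D A"

text \<open>
  A derivation of a pair is a list of codes of triples \<open>(c, x, y)\<close>, latest step first, where \<open>c\<close> is the
  preimage in \<open>F\<close> of \<open>x = y\<close> if the step is a constant.
\<close>

abbreviation step_const :: "nat \<Rightarrow> nat" where "step_const p \<equiv> nfst p"
abbreviation step_fst :: "nat \<Rightarrow> nat" where "step_fst p \<equiv> nfst (nsnd p)"
abbreviation step_snd :: "nat \<Rightarrow> nat" where "step_snd p \<equiv> nsnd (nsnd p)"

text \<open>\<open>ps\<close> holds the earlier steps. Recording the preimage in \<open>F\<close>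
  keeps the rule for constants decidable: membership in \<open>F\<close> is decidable, whereas
  membership in its image would require a search.\<close>

definition deriv_step ::
  "nat ring \<Rightarrow> nat ring \<Rightarrow> (nat \<Rightarrow> nat) \<Rightarrow> nat list \<Rightarrow> nat list \<Rightarrow> nat \<Rightarrow> nat list \<Rightarrow> bool"
where
  "deriv_step S F e a b p ps \<longleftrightarrow>
    step_const p \<in> carrier F \<and> step_fst p = e (step_const p) \<and> step_snd p = e (step_const p) \<or>
    (\<exists>j<length a. step_fst p = nth0 a j \<and> step_snd p = nth0 b j) \<or>
    (\<exists>q\<in>set ps. \<exists>r\<in>set ps. step_fst p = add0 S (step_fst q) (step_fst r) \<and>
      step_snd p = add0 S (step_snd q) (step_snd r)) \<or>
    (\<exists>q\<in>set ps. \<exists>r\<in>set ps. step_fst p = mult0 S (step_fst q) (step_fst r) \<and>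
      step_snd p = mult0 S (step_snd q) (step_snd r))"

text \<open>Phrased with positions and \<open>drop\<close> so that the recursiveness rules for
  bounded quantifiers and lists apply; \<open>derivation_Cons\<close> gives back the recursive
  reading.\<close>

definition derivation ::
  "nat ring \<Rightarrow> nat ring \<Rightarrow> (nat \<Rightarrow> nat) \<Rightarrow> nat list \<Rightarrow> nat list \<Rightarrow> nat list \<Rightarrow> bool"
where
  "derivation S F e a b ps \<longleftrightarrow> (\<forall>s<length ps. deriv_step S F e a b (nth0 ps s) (drop (Suc s) ps))"

lemma derivation_Nil: "derivation S F e a b []"
  by (simp add: derivation_def)

lemma derivation_Cons:
  "derivation S F e a b (p # ps) \<longleftrightarrow> deriv_step S F e a b p ps \<and> derivation S F e a b ps"
  unfolding derivation_def by (auto simp: less_Suc_eq_0_disj nth0_def)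

lemma deriv_step_mono: "deriv_step S F e a b p ps \<Longrightarrow> set ps \<subseteq> set qs \<Longrightarrow> deriv_step S F e a b p qs"
  unfolding deriv_step_def by blast

text \<open>A step stays valid when more earlier entries are present, so the derivations of two
  operands can be stacked.\<close>

lemma derivation_append:
  "derivation S F e a b ps \<Longrightarrow> derivation S F e a b qs \<Longrightarrow> derivation S F e a b (ps @ qs)"
  by (induction ps) (auto simp: derivation_Cons intro: deriv_step_mono)

lemma derivation_closed:
  assumes "cring S" "e \<in> carrier F \<rightarrow> carrier S" "set a \<subseteq> carrier S" "set b \<subseteq> carrier S"
    "length a = length b" "derivation S F e a b ps" "p \<in> set ps"
  shows "step_fst p \<in> carrier S \<and> step_snd p \<in> carrier S"
  using assms(6,7)
proof (induction ps arbitrary: p)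
  case (Cons q ps)
  interpret cring S by fact
  have ps: "r \<in> set ps \<Longrightarrow> step_fst r \<in> carrier S \<and> step_snd r \<in> carrier S" for r
    using Cons by (simp add: derivation_Cons)
  have nth: "nth0 a j \<in> carrier S" "nth0 b j \<in> carrier S" "a ! j \<in> carrier S" "b ! j \<in> carrier S"
    if "j < length a" for j
    using that assms(3-5) by (auto simp: subset_iff)
  have "step_fst q \<in> carrier S \<and> step_snd q \<in> carrier S"
    using Cons.prems(1) assms(2) unfolding derivation_Cons deriv_step_def
    by (auto simp: add0_def mult0_def ps nth Pi_iff)
  then show ?case using Cons.prems(2) ps by auto
qed simp

lemma derivation_exists:
  assumes "cring S" "e \<in> carrier F \<rightarrow> carrier S" "set a \<subseteq> carrier S" "set b \<subseteq> carrier S"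
    "length a = length b" "(x, y) \<in> gen_pairs S (e ` carrier F) (set (zip a b))"
  shows "\<exists>ps p. derivation S F e a b (p # ps) \<and> step_fst p = x \<and> step_snd p = y"
  using assms(6)
proof (induction "(x, y)" arbitrary: x y rule: gen_pairs.induct)
  case (const c)
  then obtain d where "d \<in> carrier F" "c = e d" by blast
  then show ?case
    by (intro exI[of _ "[]"] exI[of _ "prod_encode (d, prod_encode (c, c))"])
      (simp add: derivation_Cons derivation_Nil deriv_step_def)
next
  case base
  then obtain j where "j < length a" "x = a ! j" "y = b ! j" using assms(5) by (auto simp: set_zip)
  then show ?case
    by (intro exI[of _ "[]"] exI[of _ "prod_encode (0, prod_encode (x, y))"])
      (use assms(5) in \<open>auto simp: derivation_Cons derivation_Nil deriv_step_def\<close>)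
next
  case (add x y x' y')
  then obtain ps p qs q where *: "derivation S F e a b (p # ps)" "step_fst p = x" "step_snd p = y"
    "derivation S F e a b (q # qs)" "step_fst q = x'" "step_snd q = y'" by blast
  let ?r = "prod_encode (0, prod_encode (x \<oplus>\<^bsub>S\<^esub> x', y \<oplus>\<^bsub>S\<^esub> y'))"
  have "deriv_step S F e a b ?r ((p # ps) @ (q # qs))"
    unfolding deriv_step_def
    using derivation_closed[OF assms(1-5) *(1), of p] derivation_closed[OF assms(1-5) *(4), of q] *
    by (intro disjI2 disjI1 bexI[of _ p] bexI[of _ q]) (auto simp: add0_def)
  then have "derivation S F e a b (?r # (p # ps) @ (q # qs))"
    using derivation_append[OF *(1,4)] by (simp only: derivation_Cons)
  then show ?case by (intro exI[of _ "(p # ps) @ (q # qs)"] exI[of _ ?r]) simp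
next
  case (mult x y x' y')
  then obtain ps p qs q where *: "derivation S F e a b (p # ps)" "step_fst p = x" "step_snd p = y"
    "derivation S F e a b (q # qs)" "step_fst q = x'" "step_snd q = y'" by blast
  let ?r = "prod_encode (0, prod_encode (x \<otimes>\<^bsub>S\<^esub> x', y \<otimes>\<^bsub>S\<^esub> y'))"
  have "deriv_step S F e a b ?r ((p # ps) @ (q # qs))"
    unfolding deriv_step_def
    using derivation_closed[OF assms(1-5) *(1), of p] derivation_closed[OF assms(1-5) *(4), of q] *
    by (intro disjI2 bexI[of _ p] bexI[of _ q]) (auto simp: mult0_def)
  then have "derivation S F e a b (?r # (p # ps) @ (q # qs))"
    using derivation_append[OF *(1,4)] by (simp only: derivation_Cons)
  then show ?case by (intro exI[of _ "(p # ps) @ (q # qs)"] exI[of _ ?r]) simp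
qed

text \<open>In the list presentation the exponent list \<open>[1]\<close> is x1,
  \<open>[0, 1]\<close> is x2, and \<open>[1, 1]\<close> in \<open>product_poly\<close> is x1
  x2.\<close>

definition sum_poly :: nat where
  "sum_poly = list_encode [prod_encode (int_encode 1, list_encode [1]), prod_encode (int_encode 1, list_encode [0, 1])]"

definition product_poly :: nat where
  "product_poly = list_encode [prod_encode (int_encode 1, list_encode [1, 1])]"

lemma poly_decode_sum: "poly_decode sum_poly =
    Poly_Mapping.single (Poly_Mapping.nth [1]) 1 + Poly_Mapping.single (Poly_Mapping.nth [0, 1]) 1"
  by (simp add: poly_decode_def sum_poly_def)

lemma poly_decode_product: "poly_decode product_poly = Poly_Mapping.single (Poly_Mapping.nth [1, 1]) 1"
  by (simp add: poly_decode_def product_poly_def)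

lemma keys_nth_01:
  "Poly_Mapping.keys (Poly_Mapping.nth [1 :: nat]) = {0}"
  "Poly_Mapping.keys (Poly_Mapping.nth [0, 1 :: nat]) = {1}"
  "Poly_Mapping.keys (Poly_Mapping.nth [1, 1 :: nat]) = {0, 1}"
  by (auto simp: in_keys_iff nth_default_def less_Suc_eq nth_Cons split: if_splits nat.splits
      simp del: keys_nth)

lemmas keys_nth_Suc_0 = keys_nth_01[unfolded One_nat_def]

lemma poly_var_sum: "poly_var (poly_decode sum_poly) = 2"
proof -
  have "Poly_Mapping.keys (poly_decode sum_poly) = {Poly_Mapping.nth [1], Poly_Mapping.nth [0, 1]}"
    unfolding poly_decode_sum by (auto simp: in_keys_iff lookup_add lookup_single when_def split: if_splits)
  then show ?thesis
    by (simp add: poly_var_def keys_nth_Suc_0 del: keys_nth)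
qed

lemma poly_var_product: "poly_var (poly_decode product_poly) = 2"
  unfolding poly_decode_product by (simp add: poly_var_def keys_nth_Suc_0 del: keys_nth)

lemma (in cring) poly_eval_sum_product:
  assumes "x \<in> carrier R" "y \<in> carrier R"
  shows "poly_eval R (poly_decode sum_poly) [x, y] = x \<oplus> y"
    and "poly_eval R (poly_decode product_poly) [x, y] = x \<otimes> y"
proof -
  have c: "set [x, y] \<subseteq> carrier R" using assms by simp
  have s: "add_pow R (1 :: int) z = z" if "z \<in> carrier R" for z using that by (simp add: add_pow_int_ge)
  have m: "monom_eval R [x, y] (Poly_Mapping.nth [1]) = x" "monom_eval R [x, y] (Poly_Mapping.nth [0, 1]) = y"
      "monom_eval R [x, y] (Poly_Mapping.nth [1, 1]) = x \<otimes> y"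
    unfolding monom_eval_nth[OF c]
    by (simp_all add: lessThan_Suc padded_def nth_default_def assms m_comm)
  have "poly_eval R (poly_decode sum_poly) [x, y] = padded_eval R (poly_decode sum_poly) [x, y]"
    by (rule poly_eval_padded[OF c]) (simp add: poly_var_sum)
  also have "\<dots> = x \<oplus> y"
    unfolding poly_decode_sum padded_eval_add[OF c] padded_eval_single[OF c] m by (simp only: s assms)
  finally show "poly_eval R (poly_decode sum_poly) [x, y] = x \<oplus> y" .
  have "poly_eval R (poly_decode product_poly) [x, y] = padded_eval R (poly_decode product_poly) [x, y]"
    by (rule poly_eval_padded[OF c]) (simp add: poly_var_product)
  also have "\<dots> = x \<otimes> y"
    unfolding poly_decode_product padded_eval_single[OF c] m by (simp only: s m_closed assms)
  finally show "poly_eval R (poly_decode product_poly) [x, y] = x \<otimes> y" .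
qed

lemma singleton_eq_nth0: "length ms = Suc 0 \<Longrightarrow> length us = s \<Longrightarrow> ms = [nth0 (us @ ms @ rs) s]"
  by (auto simp: nth0_def length_Suc_conv)

text \<open>The common setting of the levels and of the top. \<open>E\<close> is the partial
  sequence of embeddings of \<open>F\<close> appearing in the theorem; \<open>e\<close> is a total
  version of it that agrees on \<open>F\<close> and can be used in computations.\<close>

locale hyper_extension =
  fixes C :: "nat set" and R :: "nat \<Rightarrow> nat ring" and n :: "nat \<Rightarrow> nat"
    and L :: "nat \<Rightarrow> nat ring option" and F :: "nat ring"
    and E :: "nat \<Rightarrow> (nat \<Rightarrow> nat) option" and e :: "nat \<Rightarrow> nat \<Rightarrow> nat"
  assumes coh: "cohesive C" and L: "hyper_field C R n L" and F: "computable_field F"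
    and e: "arec (almost_all C) e" and e_hom: "\<forall>\<^sub>F i in almost_all C. e i \<in> ring_hom F (R (n i))"
    and E: "\<forall>\<^sub>F i in almost_all C. \<exists>e'. E i = Some e' \<and> (\<forall>x\<in>carrier F. e' x = e i x)"
begin

abbreviation "ev P \<equiv> eventually P (almost_all C)"
abbreviation "T \<equiv> coh_tuples C L"
abbreviation "S i \<equiv> R (n i)"

lemma base_field: "hyper_field C (\<lambda>_. F) (\<lambda>_. 0) (\<lambda>_. Some F)"
  unfolding hyper_field_def
  by (intro conjI F arec_const exI[of _ "\<lambda>_. Some 0"] partial_recursive.zero) auto

lemmas T_iff = coh_tuples_iff[OF L]
lemmas T_nat = coh_tuples_hyper_nat[OF L]
lemmas S_cring = hyper_field_cring[OF L]

lemma R_computable: "uniformly_computable_fields R" and n_rec: "seq_rec C n"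
  using L unfolding hyper_field_def by auto

definition sing :: "(nat \<Rightarrow> nat) \<Rightarrow> hyper" where "sing x = hlist C (\<lambda>i. [x i])"

lemma sing_T: "seq_rec C x \<Longrightarrow> ev (\<lambda>i. x i \<in> carrier (S i)) \<Longrightarrow> sing x \<in> T"
  unfolding sing_def by (rule hlist_tuple[OF L]) (auto intro: alist_Cons alist_Nil elim: eventually_mono)

lemma sing_eq_iff: "seq_rec C x \<Longrightarrow> seq_rec C y \<Longrightarrow> sing x = sing y \<longleftrightarrow> ev (\<lambda>i. x i = y i)"
  unfolding sing_def by (subst hlist_eq_iff) (auto intro: alist_Cons alist_Nil)

lemma sing_cong: "ev (\<lambda>i. x i = y i) \<Longrightarrow> sing x = sing y"
  unfolding sing_def by (rule hlist_cong) (erule eventually_mono, simp)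

definition relative_hauts :: "(hyper \<Rightarrow> hyper) set" where
  "relative_hauts = carrier (haut_group C L F E)"

lemma relative_hauts_iff: "\<sigma> \<in> relative_hauts \<longleftrightarrow>
    \<sigma> \<in> extensional T \<and> \<sigma> ` T = T \<and> hyper_embedding C L L \<sigma> \<and>
    (\<forall>a\<in>coh_tuples C (\<lambda>_. Some F). \<sigma> (pointwise C e a) = pointwise C e a)"
proof -
  have "hyper_map C E a = pointwise C e a" if "a \<in> coh_tuples C (\<lambda>_. Some F)" for a
    by (rule hyper_map_eq_pointwise[OF base_field that E])
  then show ?thesis
    unfolding relative_hauts_def haut_group_def by (simp add: field_hauts_iff[OF L])
qed

context
  fixes \<sigma> assumes \<sigma>: "\<sigma> \<in> relative_hauts"
begin

lemma \<sigma>_emb: "hyper_embedding C L L \<sigma>" and \<sigma>_surj: "\<sigma> ` T = T"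
  and \<sigma>_fix: "a \<in> coh_tuples C (\<lambda>_. Some F) \<Longrightarrow> \<sigma> (pointwise C e a) = pointwise C e a"
  using \<sigma> by (auto simp: relative_hauts_iff)

lemma \<sigma>_T: "a \<in> T \<Longrightarrow> \<sigma> a \<in> T"
  and \<sigma>_append: "a \<in> T \<Longrightarrow> b \<in> T \<Longrightarrow> \<sigma> (hyper_append C a b) = hyper_append C (\<sigma> a) (\<sigma> b)"
  and \<sigma>_arity: "a \<in> T \<Longrightarrow> arity C (\<sigma> a) = arity C a"
  and \<sigma>_eval: "a \<in> T \<Longrightarrow> hyper_poly C p \<Longrightarrow> arity C a = hyper_var C p \<Longrightarrow>
       hyper_singleton C (hyper_eval C L p (\<sigma> a)) = \<sigma> (hyper_singleton C (hyper_eval C L p a))"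
  using \<sigma>_emb unfolding hyper_embedding_def by blast+

lemma \<sigma>_inj: "inj_on \<sigma> T"
  by (rule hyper_embedding_inj[OF L L \<sigma>_emb])

lemma \<sigma>_length: "a \<in> T \<Longrightarrow> ev (\<lambda>i. length (lval (\<sigma> a) i) = length (lval a i))"
  using \<sigma>_arity \<sigma>_T T_nat by (subst arity_eq_iff[symmetric]) auto

text \<open>The position \<open>s i\<close> may vary with \<open>i\<close>. The tuple is split into
  a part before, a part of length one and a part after; \<sigma> preserves concatenation and arity,
  so the image splits at the same places.\<close>

lemma \<sigma>_coord:
  assumes a: "a \<in> T" and s: "seq_rec C s" "ev (\<lambda>i. s i < length (lval a i))"
  shows "\<sigma> (sing (\<lambda>i. nth0 (lval a i) (s i))) = sing (\<lambda>i. nth0 (lval (\<sigma> a) i) (s i))"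
proof -
  note ah = T_nat[OF a] and bh = T_nat[OF \<sigma>_T[OF a]]
  have ac: "ev (\<lambda>i. set (lval a i) \<subseteq> carrier (S i))" using a by (simp add: T_iff)
  let ?u = "\<lambda>i. map (\<lambda>j. nth0 (lval a i) j) [0..<s i]"
  let ?m = "\<lambda>i. [nth0 (lval a i) (s i)]"
  let ?r = "\<lambda>i. drop (Suc (s i)) (lval a i)"
  have rec: "seq_list C ?u" "seq_list C ?m" "seq_list C ?r"
    by (intro arec_intros lval_rec ah s alist_comp[OF lval_rec[OF ah]])+
  have dec: "ev (\<lambda>i. ?u i = take (s i) (lval a i) \<and> lval a i = ?u i @ ?m i @ ?r i)"
    using s(2)
  proof eventually_elim
    case (elim i)
    have "?u i = take (s i) (lval a i)"
      using elim by (intro nth_equalityI) auto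
    then show ?case using elim by (simp add: id_take_nth_drop[symmetric])
  qed
  have "ev (\<lambda>i. set (?u i) \<subseteq> carrier (S i) \<and> set (?m i) \<subseteq> carrier (S i) \<and> set (?r i) \<subseteq> carrier (S i))"
    using dec ac
  proof eventually_elim
    case (elim i)
    then have "set (?u i @ ?m i @ ?r i) \<subseteq> carrier (S i)" by metis
    then show ?case by simp
  qed
  then have "ev (\<lambda>i. set (?u i) \<subseteq> carrier (S i))" "ev (\<lambda>i. set (?m i) \<subseteq> carrier (S i))"
      "ev (\<lambda>i. set (?r i) \<subseteq> carrier (S i))"
    by (simp_all add: eventually_conj_iff)
  note t = hlist_tuple[OF L rec(1) this(1)] hlist_tuple[OF L rec(2) this(2)] hlist_tuple[OF L rec(3) this(3)]
  note th = t[THEN T_nat] and st = t[THEN \<sigma>_T] and sl = t[THEN \<sigma>_length]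
  note sh = st[THEN T_nat]
  note lv = lval_hlist[OF rec(1)] lval_hlist[OF rec(2)] lval_hlist[OF rec(3)]
  have mr: "hyper_append C (hlist C ?m) (hlist C ?r) \<in> T" by (rule hyper_append_tuple[OF L t(2,3)])
  have "a = hyper_append C (hlist C ?u) (hyper_append C (hlist C ?m) (hlist C ?r))"
  proof (rule hyper_list_eqI[OF ah])
    show "hyper_append C (hlist C ?u) (hyper_append C (hlist C ?m) (hlist C ?r)) \<in> hyper_nat C"
      by (rule T_nat[OF hyper_append_tuple[OF L t(1) mr]])
    show "ev (\<lambda>i. lval a i = lval (hyper_append C (hlist C ?u) (hyper_append C (hlist C ?m) (hlist C ?r))) i)"
      using lval_append[OF th(1) T_nat[OF mr]] lval_append[OF th(2,3)] lv dec
    proof eventually_elim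
      case (elim i)
      show ?case unfolding elim(1-5) by (rule conjunct2[OF elim(6)])
    qed
  qed
  then have sa: "\<sigma> a = hyper_append C (\<sigma> (hlist C ?u)) (hyper_append C (\<sigma> (hlist C ?m)) (\<sigma> (hlist C ?r)))"
    using \<sigma>_append[OF t(1) mr] \<sigma>_append[OF t(2,3)] by simp
  have eq: "ev (\<lambda>i. lval (\<sigma> a) i = lval (\<sigma> (hlist C ?u)) i @ lval (\<sigma> (hlist C ?m)) i @ lval (\<sigma> (hlist C ?r)) i)"
    unfolding sa
    using lval_append[OF sh(1) T_nat[OF hyper_append_tuple[OF L st(2,3)]]] lval_append[OF sh(2,3)]
    by eventually_elim simp
  have "ev (\<lambda>i. lval (\<sigma> (hlist C ?m)) i = [nth0 (lval (\<sigma> a) i) (s i)])"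
    using eq sl lv
  proof eventually_elim
    case (elim i)
    then have "length (lval (\<sigma> (hlist C ?m)) i) = Suc 0" "length (lval (\<sigma> (hlist C ?u)) i) = s i" by simp_all
    then show ?case
      unfolding elim(1) by (intro singleton_eq_nth0)
  qed
  moreover have "seq_list C (\<lambda>i. [nth0 (lval (\<sigma> a) i) (s i)])"
    by (intro arec_intros lval_rec bh s)
  ultimately have "\<sigma> (hlist C ?m) = hlist C (\<lambda>i. [nth0 (lval (\<sigma> a) i) (s i)])"
    using hlist_lval[OF sh(2)] hlist_cong by metis
  then show ?thesis by (simp add: sing_def)
qed

text \<open>A fixed polynomial is a constant hyper-polynomial, and its two arguments form the
  concatenation of two one-entry tuples, whose images are known.\<close>

lemma \<sigma>_poly:
  assumes c: "poly_var (poly_decode c) = 2"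
    and x: "seq_rec C x" "ev (\<lambda>i. x i \<in> carrier (S i))" and y: "seq_rec C y" "ev (\<lambda>i. y i \<in> carrier (S i))"
    and x': "seq_rec C x'" "ev (\<lambda>i. x' i \<in> carrier (S i))" and y': "seq_rec C y'" "ev (\<lambda>i. y' i \<in> carrier (S i))"
    and "\<sigma> (sing x) = sing x'" "\<sigma> (sing y) = sing y'"
  shows "\<sigma> (sing (\<lambda>i. poly_eval (S i) (poly_decode c) [x i, y i])) =
    sing (\<lambda>i. poly_eval (S i) (poly_decode c) [x' i, y' i])"
proof -
  let ?p = "\<lambda>_::nat. Some (poly_decode c)"
  have p: "hyper_poly C ?p"
    unfolding hyper_poly_def
    using total_rec_const[of c] by (auto simp: total_rec_def almost_subset_def intro!: exI[of _ "\<lambda>_. Some c"])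
  have app: "hyper_append C (sing u) (sing v) = hlist C (\<lambda>i. [u i, v i])"
    if "seq_rec C u" "seq_rec C v" for u v
  proof -
    have r: "seq_list C (\<lambda>i. [u i])" "seq_list C (\<lambda>i. [v i])"
      using that by (auto intro: alist_Cons alist_Nil)
    show ?thesis
      unfolding sing_def hyper_append_eq[OF hlist_hyper_nat[OF r(1)] hlist_hyper_nat[OF r(2)]]
      by (rule hlist_cong) (use lval_hlist[OF r(1)] lval_hlist[OF r(2)] in eventually_elim, simp)
  qed
  have ev2: "hlist C (\<lambda>i. [u i, v i]) \<in> T" "arity C (hlist C (\<lambda>i. [u i, v i])) = hyper_var C ?p"
    "hyper_singleton C (hyper_eval C L ?p (hlist C (\<lambda>i. [u i, v i]))) =
      sing (\<lambda>i. poly_eval (S i) (poly_decode c) [u i, v i])"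
    if "seq_rec C u" "ev (\<lambda>i. u i \<in> carrier (S i))" "seq_rec C v" "ev (\<lambda>i. v i \<in> carrier (S i))" for u v
  proof -
    have r: "seq_list C (\<lambda>i. [u i, v i])" by (intro alist_Cons alist_Nil that)
    show t: "hlist C (\<lambda>i. [u i, v i]) \<in> T"
      by (rule hlist_tuple[OF L r]) (use that(2,4) in eventually_elim, simp)
    show ar: "arity C (hlist C (\<lambda>i. [u i, v i])) = hyper_var C ?p"
      unfolding arity_eq[OF T_nat[OF t]] hyper_var_def
      by (rule coh_class_eq_hclass[symmetric]) (use lval_hlist[OF r] in eventually_elim, simp add: c)
    obtain q where q: "ev (\<lambda>i. ?p i = Some (q i))"
      "hyper_singleton C (hyper_eval C L ?p (hlist C (\<lambda>i. [u i, v i]))) =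
        hlist C (\<lambda>i. [poly_eval (S i) (q i) (lval (hlist C (\<lambda>i. [u i, v i])) i)])"
      by (rule hyper_evalE[OF L t p ar]) (rule that)
    show "hyper_singleton C (hyper_eval C L ?p (hlist C (\<lambda>i. [u i, v i]))) =
        sing (\<lambda>i. poly_eval (S i) (poly_decode c) [u i, v i])"
      unfolding q(2) sing_def
      by (rule hlist_cong) (use lval_hlist[OF r] q(1) in eventually_elim, simp)
  qed
  have "\<sigma> (hlist C (\<lambda>i. [x i, y i])) = hlist C (\<lambda>i. [x' i, y' i])"
    using \<sigma>_append[OF sing_T[OF x] sing_T[OF y]] assms(10,11) by (simp add: app x y x' y')
  then show ?thesis
    using \<sigma>_eval[OF ev2(1)[OF x y] p ev2(2)[OF x y]] ev2(3)[OF x y] ev2(3)[OF x' y'] by simp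
qed

lemma \<sigma>_add_mult:
  assumes x: "seq_rec C x" "ev (\<lambda>i. x i \<in> carrier (S i))" and y: "seq_rec C y" "ev (\<lambda>i. y i \<in> carrier (S i))"
    and x': "seq_rec C x'" "ev (\<lambda>i. x' i \<in> carrier (S i))" and y': "seq_rec C y'" "ev (\<lambda>i. y' i \<in> carrier (S i))"
    and "\<sigma> (sing x) = sing x'" "\<sigma> (sing y) = sing y'"
  shows "\<sigma> (sing (\<lambda>i. add0 (S i) (x i) (y i))) = sing (\<lambda>i. add0 (S i) (x' i) (y' i))"
    and "\<sigma> (sing (\<lambda>i. mult0 (S i) (x i) (y i))) = sing (\<lambda>i. mult0 (S i) (x' i) (y' i))"
proof -
  have *: "sing (\<lambda>i. add0 (S i) (u i) (v i)) = sing (\<lambda>i. poly_eval (S i) (poly_decode sum_poly) [u i, v i])"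
      "sing (\<lambda>i. mult0 (S i) (u i) (v i)) = sing (\<lambda>i. poly_eval (S i) (poly_decode product_poly) [u i, v i])"
    if "ev (\<lambda>i. u i \<in> carrier (S i))" "ev (\<lambda>i. v i \<in> carrier (S i))" for u v
    by (rule sing_cong, use that in eventually_elim, simp add: add0_def mult0_def cring.poly_eval_sum_product[OF S_cring])+
  show "\<sigma> (sing (\<lambda>i. add0 (S i) (x i) (y i))) = sing (\<lambda>i. add0 (S i) (x' i) (y' i))"
    unfolding *[OF x(2) y(2)] *[OF x'(2) y'(2)] by (rule \<sigma>_poly[OF poly_var_sum assms])
  show "\<sigma> (sing (\<lambda>i. mult0 (S i) (x i) (y i))) = sing (\<lambda>i. mult0 (S i) (x' i) (y' i))"
    unfolding *[OF x(2) y(2)] *[OF x'(2) y'(2)] by (rule \<sigma>_poly[OF poly_var_product assms])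
qed

lemma \<sigma>_const:
  assumes c: "seq_rec C c" "ev (\<lambda>i. c i \<in> carrier F)"
  shows "\<sigma> (sing (\<lambda>i. e i (c i))) = sing (\<lambda>i. e i (c i))"
proof -
  have r: "seq_list C (\<lambda>i. [c i])" using c by (auto intro: alist_Cons alist_Nil)
  have t: "hlist C (\<lambda>i. [c i]) \<in> coh_tuples C (\<lambda>_. Some F)"
    by (rule hlist_tuple[OF base_field r]) (use c(2) in eventually_elim, simp)
  have "pointwise C e (hlist C (\<lambda>i. [c i])) = sing (\<lambda>i. e i (c i))"
    unfolding pointwise_def sing_def by (rule hlist_cong) (use lval_hlist[OF r] in eventually_elim, simp)
  then show ?thesis using \<sigma>_fix[OF t] by simp
qed

end

end

section \<open>Transfer of zeros along derivations\<close>

context hyper_extension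
begin

context
  fixes \<sigma> a assumes \<sigma>: "\<sigma> \<in> relative_hauts" and a: "a \<in> T"
begin

abbreviation "A i \<equiv> lval a i"
abbreviation "B i \<equiv> lval (\<sigma> a) i"

lemma A_rec: "seq_list C (\<lambda>i. A i)" and B_rec: "seq_list C (\<lambda>i. B i)"
  using lval_rec T_nat \<sigma>_T[OF \<sigma>] a by auto

lemma A_B_wf: "ev (\<lambda>i. set (A i) \<subseteq> carrier (S i) \<and> set (B i) \<subseteq> carrier (S i) \<and> length (A i) = length (B i) \<and>
    e i \<in> carrier F \<rightarrow> carrier (S i))"
  using a[unfolded T_iff, THEN conjunct2] \<sigma>_T[OF \<sigma> a, unfolded T_iff, THEN conjunct2] \<sigma>_length[OF \<sigma> a] e_hom
  by eventually_elim (simp add: ring_hom_def)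

lemma derivation_transfer:
  assumes D: "seq_list C D" "ev (\<lambda>i. derivation (S i) F (e i) (A i) (B i) (D i))"
  shows "\<sigma> (hlist C (\<lambda>i. map step_fst (D i))) = hlist C (\<lambda>i. map step_snd (D i))"
proof -
  let ?w = "hlist C (\<lambda>i. map step_fst (D i))"
  have w_rec: "seq_list C (\<lambda>i. map step_fst (D i))" and w'_rec: "seq_list C (\<lambda>i. map step_snd (D i))"
    by (intro arec_intros D(1))+
  have Dc: "ev (\<lambda>i. \<forall>p\<in>set (D i). step_fst p \<in> carrier (S i) \<and> step_snd p \<in> carrier (S i))"
    using A_B_wf D(2)
  proof eventually_elim
    case (elim i)
    then show ?case using derivation_closed[OF S_cring, of "e i" F] by blast
  qed
  have wT: "?w \<in> T"
    by (rule hlist_tuple[OF L w_rec]) (use Dc in \<open>eventually_elim, auto\<close>)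
  have wl: "ev (\<lambda>i. lval ?w i = map step_fst (D i))" by (rule lval_hlist[OF w_rec])
  define V where "V i = lval (\<sigma> ?w) i" for i
  have V_rec: "seq_list C V" unfolding V_def using lval_rec T_nat \<sigma>_T[OF \<sigma> wT] by blast
  have Vl: "ev (\<lambda>i. length (V i) = length (D i))"
    using \<sigma>_length[OF \<sigma> wT] wl by eventually_elim (simp add: V_def)
  have step_rec: "seq_rec C (\<lambda>i. step_fst (nth0 (D i) (s i)))" "seq_rec C (\<lambda>i. step_snd (nth0 (D i) (s i)))"
      "seq_rec C (\<lambda>i. step_const (nth0 (D i) (s i)))"
    if "seq_rec C s" for s
    by (intro arec_intros D(1) that)+
  have step_carr: "ev (\<lambda>i. step_fst (nth0 (D i) (s i)) \<in> carrier (S i))"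
      "ev (\<lambda>i. step_snd (nth0 (D i) (s i)) \<in> carrier (S i))"
    if "ev (\<lambda>i. s i < length (D i))" for s
    using that Dc by (eventually_elim, simp)+
  have img: "\<sigma> (sing (\<lambda>i. step_fst (nth0 (D i) (s i)))) = sing (\<lambda>i. nth0 (V i) (s i))"
    if s: "seq_rec C s" "ev (\<lambda>i. s i < length (D i))" for s
  proof -
    have "ev (\<lambda>i. s i < length (lval ?w i))" using s(2) wl by eventually_elim simp
    from \<sigma>_coord[OF \<sigma> wT s(1) this]
    have "\<sigma> (sing (\<lambda>i. nth0 (lval ?w i) (s i))) = sing (\<lambda>i. nth0 (V i) (s i))" by (simp add: V_def)
    moreover have "sing (\<lambda>i. nth0 (lval ?w i) (s i)) = sing (\<lambda>i. step_fst (nth0 (D i) (s i)))"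
      by (rule sing_cong) (use s(2) wl in eventually_elim, simp)
    ultimately show ?thesis by simp
  qed
  let ?good = "\<lambda>i s. nth0 (V i) s = step_snd (nth0 (D i) s)"
  \<comment> \<open>The last wrong position. Since lists are in reverse order of computation, this
    is the earliest wrong step, and everything it uses is correct.\<close>
  let ?bad = "\<lambda>i s. s < length (D i) \<and> \<not> ?good i s \<and> (\<forall>t<length (D i). s < t \<longrightarrow> ?good i t)"
  have good_dec: "adec (almost_all C) (\<lambda>i z. ?good i (f i z))" if "arec (almost_all C) f" for f
    by (intro arec_intros V_rec D(1) that)
  have "adec (almost_all C) ?bad"
    by (intro arec_intros good_dec D(1))
  from cohesive_search[OF coh this]
  have "ev (\<lambda>i. \<forall>s. \<not> ?bad i s)"
  proof
    assume "\<exists>f. seq_rec C f \<and> ev (\<lambda>i. ?bad i (f i))"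
    then obtain s where s: "seq_rec C s" "ev (\<lambda>i. ?bad i (s i))" by blast
    have sl: "ev (\<lambda>i. s i < length (D i))" using s(2) by eventually_elim simp
    have no: False if "\<sigma> (sing (\<lambda>i. step_fst (nth0 (D i) (s i)))) = sing (\<lambda>i. step_snd (nth0 (D i) (s i)))"
    proof -
      have "ev (\<lambda>i. nth0 (V i) (s i) = step_snd (nth0 (D i) (s i)))"
        using that img[OF s(1) sl] by (subst sing_eq_iff[symmetric]) (auto intro!: step_rec s(1) arec_nth0 V_rec)
      then have "ev (\<lambda>i. False)" using s(2) by eventually_elim blast
      then show False using almost_all_nontrivial[OF coh] by simp
    qed
    have good_img: "\<sigma> (sing (\<lambda>i. step_fst (nth0 (D i) (t i)))) = sing (\<lambda>i. step_snd (nth0 (D i) (t i)))"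
      if t: "seq_rec C t" "ev (\<lambda>i. t i < length (D i))" "ev (\<lambda>i. s i < t i)" for t
      unfolding img[OF t(1,2)] by (rule sing_cong) (use s(2) t(2,3) in eventually_elim, simp)
    let ?p = "\<lambda>i. nth0 (D i) (s i)"
    let ?Q1 = "\<lambda>i. step_const (?p i) \<in> carrier F \<and> step_fst (?p i) = e i (step_const (?p i)) \<and>
      step_snd (?p i) = e i (step_const (?p i))"
    let ?Q2 = "\<lambda>i j. j < length (A i) \<and> step_fst (?p i) = nth0 (A i) j \<and> step_snd (?p i) = nth0 (B i) j"
    \<comment> \<open>The witness \<open>z\<close> codes the positions of the two premises, both
      beyond \<open>s i\<close> and hence correct.\<close>
    let ?Q3 = "\<lambda>op i z. nfst z < length (D i) \<and> nsnd z < length (D i) \<and> s i < nfst z \<and> s i < nsnd z \<and>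
      step_fst (?p i) = op (S i) (step_fst (nth0 (D i) (nfst z))) (step_fst (nth0 (D i) (nsnd z))) \<and>
      step_snd (?p i) = op (S i) (step_snd (nth0 (D i) (nfst z))) (step_snd (nth0 (D i) (nsnd z)))"
    have dec1: "adec (almost_all C) (\<lambda>i _. ?Q1 i)"
      by (intro arec_intros adec_carrier[OF F arec_const[of _ 0]] e[THEN arec_comp] D(1) s(1))
    have dec2: "adec (almost_all C) ?Q2"
      by (intro arec_intros D(1) s(1) A_rec B_rec)
    have dec3: "adec (almost_all C) (?Q3 add0)"
      by (intro arec_intros arec_add0[OF R_computable] n_rec D(1) s(1))
    have dec4: "adec (almost_all C) (?Q3 mult0)"
      by (intro arec_intros arec_mult0[OF R_computable] n_rec D(1) s(1))
    have c1: "\<not> ev ?Q1"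
    proof
      assume q: "ev ?Q1"
      have "\<sigma> (sing (\<lambda>i. e i (step_const (?p i)))) = sing (\<lambda>i. e i (step_const (?p i)))"
        by (rule \<sigma>_const[OF \<sigma> step_rec(3)[OF s(1)]]) (use q in eventually_elim, simp)
      moreover have "sing (\<lambda>i. e i (step_const (?p i))) = sing (\<lambda>i. step_fst (?p i))"
          "sing (\<lambda>i. e i (step_const (?p i))) = sing (\<lambda>i. step_snd (?p i))"
        by (rule sing_cong, use q in eventually_elim, simp)+
      ultimately show False using no by simp
    qed
    have c2: "\<not> (\<exists>f. seq_rec C f \<and> ev (\<lambda>i. ?Q2 i (f i)))"
    proof
      assume "\<exists>f. seq_rec C f \<and> ev (\<lambda>i. ?Q2 i (f i))"
      then obtain j where j: "seq_rec C j" "ev (\<lambda>i. ?Q2 i (j i))" by blast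
      have "\<sigma> (sing (\<lambda>i. nth0 (A i) (j i))) = sing (\<lambda>i. nth0 (B i) (j i))"
        by (rule \<sigma>_coord[OF \<sigma> a j(1)]) (use j(2) in eventually_elim, simp)
      moreover have "sing (\<lambda>i. nth0 (A i) (j i)) = sing (\<lambda>i. step_fst (?p i))"
          "sing (\<lambda>i. nth0 (B i) (j i)) = sing (\<lambda>i. step_snd (?p i))"
        by (rule sing_cong, use j(2) in eventually_elim, simp)+
      ultimately show False using no by simp
    qed
    have c3: "\<not> (\<exists>f. seq_rec C f \<and> ev (\<lambda>i. ?Q3 op i (f i)))" if "op = add0 \<or> op = mult0" for op
    proof
      assume "\<exists>f. seq_rec C f \<and> ev (\<lambda>i. ?Q3 op i (f i))"
      then obtain z where z: "seq_rec C z" "ev (\<lambda>i. ?Q3 op i (z i))" by blast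
      let ?t = "\<lambda>i. nfst (z i)" and ?u = "\<lambda>i. nsnd (z i)"
      have r: "seq_rec C ?t" "seq_rec C ?u" by (intro arec_intros z(1))+
      have b: "ev (\<lambda>i. ?t i < length (D i))" "ev (\<lambda>i. ?u i < length (D i))" "ev (\<lambda>i. s i < ?t i)" "ev (\<lambda>i. s i < ?u i)"
        using z(2) by (eventually_elim, simp)+
      note args = step_rec(1)[OF r(1)] step_carr(1)[OF b(1)] step_rec(1)[OF r(2)] step_carr(1)[OF b(2)]
        step_rec(2)[OF r(1)] step_carr(2)[OF b(1)] step_rec(2)[OF r(2)] step_carr(2)[OF b(2)]
        good_img[OF r(1) b(1,3)] good_img[OF r(2) b(2,4)]
      have "\<sigma> (sing (\<lambda>i. op (S i) (step_fst (nth0 (D i) (?t i))) (step_fst (nth0 (D i) (?u i))))) =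
          sing (\<lambda>i. op (S i) (step_snd (nth0 (D i) (?t i))) (step_snd (nth0 (D i) (?u i))))"
        using that \<sigma>_add_mult[OF \<sigma> args] by blast
      moreover have "sing (\<lambda>i. op (S i) (step_fst (nth0 (D i) (?t i))) (step_fst (nth0 (D i) (?u i)))) = sing (\<lambda>i. step_fst (?p i))"
          "sing (\<lambda>i. op (S i) (step_snd (nth0 (D i) (?t i))) (step_snd (nth0 (D i) (?u i)))) = sing (\<lambda>i. step_snd (?p i))"
        by (rule sing_cong, use z(2) in eventually_elim, simp only:)+
      ultimately show False using no by simp
    qed
    \<comment> \<open>By cohesiveness each rule justifies the wrong step almost everywhere, with
      recursive witnesses, or almost nowhere. The first alternative has been refuted for all four,
      so almost everywhere no rule justifies the step.\<close>
    have "ev (\<lambda>i. \<not> ?Q1 i)" "ev (\<lambda>i. \<forall>j. \<not> ?Q2 i j)" "ev (\<lambda>i. \<forall>z. \<not> ?Q3 add0 i z)" "ev (\<lambda>i. \<forall>z. \<not> ?Q3 mult0 i z)"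
      using cohesive_dec[OF coh dec1] cohesive_search[OF coh dec2] cohesive_search[OF coh dec3]
        cohesive_search[OF coh dec4] c1 c2 c3 by blast+
    then have "ev (\<lambda>i. False)"
      using D(2) sl
    proof eventually_elim
      case (elim i)
      have "deriv_step (S i) F (e i) (A i) (B i) (?p i) (drop (Suc (s i)) (D i))"
        using elim(5,6) by (simp add: derivation_def)
      moreover have *: "\<exists>t<length (D i). s i < t \<and> q = nth0 (D i) t" if q: "q \<in> set (drop (Suc (s i)) (D i))" for q
      proof -
        obtain k where "k < length (D i) - Suc (s i)" "q = D i ! (Suc (s i) + k)"
          using q by (auto simp: in_set_conv_nth)
        then show ?thesis by (intro exI[of _ "Suc (s i) + k"]) simp
      qed
      have **: "\<exists>z. ?Q3 op i z"
        if qr: "q \<in> set (drop (Suc (s i)) (D i))" "r \<in> set (drop (Suc (s i)) (D i))"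
          "step_fst (?p i) = op (S i) (step_fst q) (step_fst r)" "step_snd (?p i) = op (S i) (step_snd q) (step_snd r)" for op q r
      proof -
        obtain t u where "t < length (D i)" "s i < t" "q = nth0 (D i) t" "u < length (D i)" "s i < u" "r = nth0 (D i) u"
          using *[OF qr(1)] *[OF qr(2)] by blast
        then show ?thesis using qr(3,4) by (intro exI[of _ "prod_encode (t, u)"]) simp
      qed
      ultimately show ?case
        unfolding deriv_step_def using elim(1,2,3,4) **[of _ _ add0] **[of _ _ mult0] by blast
    qed
    then show "ev (\<lambda>i. \<forall>s. \<not> ?bad i s)" using almost_all_nontrivial[OF coh] by simp
  qed
  then have "ev (\<lambda>i. V i = map step_snd (D i))"
    using Vl
  proof eventually_elim
    case (elim i)
    have "\<forall>s<length (D i). ?good i s"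
    proof (rule ccontr)
      assume "\<not> (\<forall>s<length (D i). ?good i s)"
      then have ne: "{s. s < length (D i) \<and> \<not> ?good i s} \<noteq> {}" by blast
      have fin: "finite {s. s < length (D i) \<and> \<not> ?good i s}" by simp
      have "?bad i (Max {s. s < length (D i) \<and> \<not> ?good i s})"
        using Max_in[OF fin ne] Max_ge[OF fin] by (auto simp: not_le[symmetric] simp del: nth0_nth)
      then show False using elim(1) by blast
    qed
    then show ?case using elim(2) by (intro nth_equalityI) auto
  qed
  then show ?thesis
    using hlist_lval[OF T_nat[OF \<sigma>_T[OF \<sigma> wT]]] hlist_cong unfolding V_def by metis
qed

lemma gen_pairs_transfer:
  "ev (\<lambda>i. \<forall>x y. (x, y) \<in> gen_pairs (S i) (e i ` carrier F) (set (zip (A i) (B i))) \<longrightarrow>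
     (x = \<zero>\<^bsub>S i\<^esub> \<longleftrightarrow> y = \<zero>\<^bsub>S i\<^esub>))"
proof -
  \<comment> \<open>\<open>k\<close> codes a derivation whose final step, at position 0, has exactly
    one component equal to zero.\<close>
  let ?Q = "\<lambda>i k. derivation (S i) F (e i) (A i) (B i) (list_decode k) \<and> 0 < length (list_decode k) \<and>
    \<not> (step_fst (nth0 (list_decode k) 0) = \<zero>\<^bsub>S i\<^esub> \<longleftrightarrow> step_snd (nth0 (list_decode k) 0) = \<zero>\<^bsub>S i\<^esub>)"
  have iff: "adec U (\<lambda>i x. P i x = Q i x)" if "adec U P" "adec U Q" for U and P Q :: "nat \<Rightarrow> nat \<Rightarrow> bool"
    using adec_conj[OF adec_imp[OF that] adec_imp[OF that(2,1)]]
    by (rule adec_cong) (intro always_eventually allI, blast)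
  have "adec (almost_all C) ?Q"
    unfolding derivation_def deriv_step_def
    by (intro arec_intros iff adec_carrier[OF F arec_const[of _ 0]] e[THEN arec_comp] A_rec B_rec
        arec_add0[OF R_computable] arec_mult0[OF R_computable] arec_zero[OF R_computable] n_rec)
  from cohesive_search[OF coh this] show ?thesis
  proof
    assume "\<exists>f. seq_rec C f \<and> ev (\<lambda>i. ?Q i (f i))"
    then obtain f where f: "seq_rec C f" "ev (\<lambda>i. ?Q i (f i))" by blast
    define D where "D i = list_decode (f i)" for i
    have D: "seq_list C D" "ev (\<lambda>i. derivation (S i) F (e i) (A i) (B i) (D i))" "ev (\<lambda>i. 0 < length (D i))"
      unfolding D_def using f(2) by (auto intro: alist_decode f(1) elim: eventually_mono)
    let ?x = "\<lambda>i. step_fst (nth0 (D i) 0)" and ?y = "\<lambda>i. step_snd (nth0 (D i) 0)" and ?z = "\<lambda>i. \<zero>\<^bsub>S i\<^esub>"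
    have ne: "ev (\<lambda>i. \<not> (?x i = ?z i \<longleftrightarrow> ?y i = ?z i))"
      using f(2) unfolding D_def by eventually_elim blast
    have xr: "seq_rec C ?x" "seq_rec C ?y" "seq_rec C ?z" by (intro arec_intros D(1) arec_zero[OF R_computable] n_rec)+
    have zc: "ev (\<lambda>i. ?z i \<in> carrier (S i))"
      using cring.cring_simprules(2)[OF S_cring] by simp
    have xc: "ev (\<lambda>i. ?x i \<in> carrier (S i))"
      using A_B_wf D(2,3)
    proof eventually_elim
      case (elim i)
      then show ?case using derivation_closed[OF S_cring, where e = "e i" and F = F and a = "A i" and b = "B i" and ps = "D i" and p = "D i ! 0"] by simp
    qed
    have wr: "seq_list C (\<lambda>i. map step_fst (D i))" and w'r: "seq_list C (\<lambda>i. map step_snd (D i))"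
      by (intro arec_intros D(1))+
    have wT: "hlist C (\<lambda>i. map step_fst (D i)) \<in> T"
    proof (rule hlist_tuple[OF L wr])
      show "ev (\<lambda>i. set (map step_fst (D i)) \<subseteq> carrier (S i))"
        using A_B_wf D(2)
      proof eventually_elim
        case (elim i)
        then show ?case using derivation_closed[OF S_cring, where e = "e i" and F = F and a = "A i" and b = "B i" and ps = "D i"] by auto
      qed
    qed
    have "ev (\<lambda>i. 0 < length (lval (hlist C (\<lambda>i. map step_fst (D i))) i))"
      using lval_hlist[OF wr] D(3) by eventually_elim simp
    from \<sigma>_coord[OF \<sigma> wT arec_const this]
    have "\<sigma> (sing (\<lambda>i. nth0 (lval (hlist C (\<lambda>i. map step_fst (D i))) i) 0)) =
        sing (\<lambda>i. nth0 (lval (hlist C (\<lambda>i. map step_snd (D i))) i) 0)"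
      using derivation_transfer[OF D(1,2)] by simp
    moreover have "sing (\<lambda>i. nth0 (lval (hlist C (\<lambda>i. map step_fst (D i))) i) 0) = sing ?x"
      by (rule sing_cong) (use lval_hlist[OF wr] D(3) in eventually_elim, simp)
    moreover have "sing (\<lambda>i. nth0 (lval (hlist C (\<lambda>i. map step_snd (D i))) i) 0) = sing ?y"
      by (rule sing_cong) (use lval_hlist[OF w'r] D(3) in eventually_elim, simp)
    ultimately have xy: "\<sigma> (sing ?x) = sing ?y" by simp
    \<comment> \<open>Zero comes from the base field, so \<sigma> fixes it.\<close>
    have F0: "ev (\<lambda>i. e i \<zero>\<^bsub>F\<^esub> = ?z i)"
      using e_hom
    proof eventually_elim
      case (elim i)
      then show ?case
        using hyper_field_field[OF L, of "n i"] hyper_field_field[OF base_field]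
        by (intro ring_hom_zero) (auto intro: fieldE cring.axioms field.is_ring)
    qed
    have "\<sigma> (sing (\<lambda>i. e i \<zero>\<^bsub>F\<^esub>)) = sing (\<lambda>i. e i \<zero>\<^bsub>F\<^esub>)"
      by (rule \<sigma>_const[OF \<sigma> arec_const])
        (use cring.cring_simprules(2)[OF hyper_field_cring[OF base_field]] in simp)
    then have zz: "\<sigma> (sing ?z) = sing ?z" using sing_cong[OF F0] by simp
    \<comment> \<open>The first component vanishes almost everywhere or almost nowhere. Then
      \<sigma> would send zero to a nonzero element, or, against injectivity, a nonzero element to
      zero.\<close>
    have "adec (almost_all C) (\<lambda>i _. ?x i = ?z i)" by (intro arec_intros xr)
    from cohesive_dec[OF coh this] have "ev (\<lambda>i. False)"
    proof
      assume x0: "ev (\<lambda>i. ?x i = ?z i)"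
      then have "sing ?y = sing ?z" using xy zz sing_cong by metis
      then have "ev (\<lambda>i. ?y i = ?z i)" by (simp add: sing_eq_iff xr)
      then show ?thesis using x0 ne by eventually_elim simp
    next
      assume x0: "ev (\<lambda>i. ?x i \<noteq> ?z i)"
      then have "ev (\<lambda>i. ?y i = ?z i)" using ne by eventually_elim simp
      then have "\<sigma> (sing ?x) = \<sigma> (sing ?z)" using xy zz sing_cong by metis
      then have "sing ?x = sing ?z"
        using \<sigma>_inj[OF \<sigma>] sing_T[OF xr(1) xc] sing_T[OF xr(3) zc] by (auto dest: inj_onD)
      then have "ev (\<lambda>i. ?x i = ?z i)" by (simp add: sing_eq_iff xr)
      then show ?thesis using x0 by eventually_elim simp
    qed
    then show ?thesis using almost_all_nontrivial[OF coh] by simp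
  next
    assume "ev (\<lambda>i. \<forall>k. \<not> ?Q i k)"
    then show ?thesis using A_B_wf
    proof eventually_elim
      case (elim i)
      show ?case
      proof (intro allI impI, rule ccontr)
        fix x y
        assume xy: "(x, y) \<in> gen_pairs (S i) (e i ` carrier F) (set (zip (A i) (B i)))"
          and ne: "(x = \<zero>\<^bsub>S i\<^esub>) \<noteq> (y = \<zero>\<^bsub>S i\<^esub>)"
        obtain ps p where "derivation (S i) F (e i) (A i) (B i) (p # ps)" "step_fst p = x" "step_snd p = y"
          using derivation_exists[OF S_cring _ _ _ _ xy] elim(2) by blast
        then have "?Q i (list_encode (p # ps))" using ne by (simp del: list_encode.simps)
        then show False using elim(1) by blast
      qed
    qed
  qed
qed

end

end

section \<open>Separating polynomials of finite Galois groups\<close>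

text \<open>\<open>D\<close> stands for the image of the base field; the axiom \<open>fixed\<close>
  is what places sums over the group in it.\<close>

locale galois_action = K: field K + G: group G
  for K :: "('a, 'm) ring_scheme" and G :: "('g, 'n) monoid_scheme" +
  fixes act :: "'g \<Rightarrow> 'a \<Rightarrow> 'a" and D :: "'a set"
  assumes finite_G: "finite (carrier G)"
    and act_hom: "g \<in> carrier G \<Longrightarrow> act g \<in> ring_hom K K"
    and act_mult: "g \<in> carrier G \<Longrightarrow> h \<in> carrier G \<Longrightarrow> x \<in> carrier K \<Longrightarrow>
      act (g \<otimes>\<^bsub>G\<^esub> h) x = act g (act h x)"
    and act_one: "x \<in> carrier K \<Longrightarrow> act \<one>\<^bsub>G\<^esub> x = x"
    and faithful: "g \<in> carrier G \<Longrightarrow> (\<And>x. x \<in> carrier K \<Longrightarrow> act g x = x) \<Longrightarrow> g = \<one>\<^bsub>G\<^esub>"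
    and fixed: "x \<in> carrier K \<Longrightarrow> (\<And>g. g \<in> carrier G \<Longrightarrow> act g x = x) \<Longrightarrow> x \<in> D"
begin

lemma act_closed: "g \<in> carrier G \<Longrightarrow> x \<in> carrier K \<Longrightarrow> act g x \<in> carrier K"
  using act_hom by (rule ring_hom_closed)

lemma act_K_mult: "g \<in> carrier G \<Longrightarrow> x \<in> carrier K \<Longrightarrow> y \<in> carrier K \<Longrightarrow>
    act g (x \<otimes>\<^bsub>K\<^esub> y) = act g x \<otimes>\<^bsub>K\<^esub> act g y"
  using act_hom by (blast intro: ring_hom_mult)

lemma act_ring_hom_cring: "g \<in> carrier G \<Longrightarrow> ring_hom_cring K K (act g)"
  using act_hom K.is_cring by (simp add: ring_hom_cring_def ring_hom_cring_axioms_def)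

lemma act_K_minus: "g \<in> carrier G \<Longrightarrow> x \<in> carrier K \<Longrightarrow> act g (\<ominus>\<^bsub>K\<^esub> x) = \<ominus>\<^bsub>K\<^esub> act g x"
  by (rule ring_hom_cring.hom_a_inv[OF act_ring_hom_cring])

lemma act_inv_cancel: "g \<in> carrier G \<Longrightarrow> x \<in> carrier K \<Longrightarrow> act g (act (inv\<^bsub>G\<^esub> g) x) = x"
  by (simp flip: act_mult add: act_one)

lemma K_self_minus: "x \<in> carrier K \<Longrightarrow> x \<ominus>\<^bsub>K\<^esub> x = \<zero>\<^bsub>K\<^esub>"
  by (simp add: K.r_right_minus_eq)

lemma eq_of_free:
  assumes free: "\<And>g. g \<in> carrier G \<Longrightarrow> map (act g) u = u \<Longrightarrow> g = \<one>\<^bsub>G\<^esub>"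
    and gh: "g \<in> carrier G" "h \<in> carrier G" "map (act g) u = map (act h) u" and u: "set u \<subseteq> carrier K"
  shows "g = h"
proof -
  let ?k = "inv\<^bsub>G\<^esub> h"
  have "map (act (?k \<otimes>\<^bsub>G\<^esub> g)) u = map (act ?k) (map (act g) u)"
    using gh u by (auto simp: act_mult subset_iff)
  also have "\<dots> = u"
    unfolding gh(3) using gh u act_inv_cancel[OF G.inv_closed[OF gh(2)]]
    by (auto simp: subset_iff intro!: map_idI)
  finally have "?k \<otimes>\<^bsub>G\<^esub> g = \<one>\<^bsub>G\<^esub>" using free gh by simp
  then show ?thesis using gh(1,2) G.inv_equality[of ?k g] G.inv_inv by fastforce
qed

section \<open>The trace and separation over the base field\<close>

definition trace :: "'a \<Rightarrow> 'a" where "trace x = (\<Oplus>\<^bsub>K\<^esub>g\<in>carrier G. act g x)"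

lemma trace_closed: "x \<in> carrier K \<Longrightarrow> trace x \<in> carrier K"
  unfolding trace_def by (intro K.finsum_closed) (auto simp: act_closed)

lemma trace_in_D:
  assumes "x \<in> carrier K" shows "trace x \<in> D"
proof (rule fixed[OF trace_closed[OF assms]])
  fix h assume h: "h \<in> carrier G"
  interpret h: ring_hom_cring K K "act h" by (rule act_ring_hom_cring[OF h])
  have inj: "inj_on (\<lambda>g. h \<otimes>\<^bsub>G\<^esub> g) (carrier G)" using h by (auto intro: inj_onI)
  have img: "(\<lambda>g. h \<otimes>\<^bsub>G\<^esub> g) ` carrier G = carrier G"
    using finite_G h inj by (intro card_subset_eq) (auto simp: card_image)
  have "act h (trace x) = (\<Oplus>\<^bsub>K\<^esub>g\<in>carrier G. act h (act g x))"
    unfolding trace_def using assms by (subst h.hom_finsum) (auto simp: act_closed comp_def)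
  also have "\<dots> = (\<Oplus>\<^bsub>K\<^esub>g\<in>carrier G. act (h \<otimes>\<^bsub>G\<^esub> g) x)"
    using assms h by (intro K.finsum_cong') (auto simp: act_mult act_closed)
  also have "\<dots> = (\<Oplus>\<^bsub>K\<^esub>g\<in>(\<lambda>g. h \<otimes>\<^bsub>G\<^esub> g) ` carrier G. act g x)"
    using assms h by (intro K.finsum_reindex[symmetric] inj) (auto simp: act_closed)
  finally show "act h (trace x) = trace x" by (simp add: img trace_def)
qed

lemma finsum_single:
  assumes "u \<in> carrier G \<rightarrow> carrier K" "\<And>g. g \<in> carrier G \<Longrightarrow> g \<noteq> \<one>\<^bsub>G\<^esub> \<Longrightarrow> u g = \<zero>\<^bsub>K\<^esub>"
  shows "(\<Oplus>\<^bsub>K\<^esub>g\<in>carrier G. u g) = u \<one>\<^bsub>G\<^esub>"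
proof -
  have "(\<Oplus>\<^bsub>K\<^esub>g\<in>carrier G. u g) = (\<Oplus>\<^bsub>K\<^esub>g\<in>carrier G. if \<one>\<^bsub>G\<^esub> = g then u g else \<zero>\<^bsub>K\<^esub>)"
    using assms by (intro K.finsum_cong') auto
  also have "\<dots> = u \<one>\<^bsub>G\<^esub>"
    using assms finite_G by (intro K.finsum_singleton) auto
  finally show ?thesis .
qed

text \<open>
  If the trace vanished, so would \<open>\<Sum>\<^sub>g u(g) g(\<mu>)\<close> for all \<open>\<mu>\<close> and all products \<open>u\<close> of functions
  \<open>g \<mapsto> g(x) - q\<close>, one of which is nonzero exactly at \<open>1\<close>.
\<close>

lemma trace_nonzero: "\<exists>x\<in>carrier K. trace x \<noteq> \<zero>\<^bsub>K\<^esub>"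
proof (rule ccontr)
  assume "\<not> ?thesis"
  then have tr: "trace x = \<zero>\<^bsub>K\<^esub>" if "x \<in> carrier K" for x using that by blast
  define Z where "Z = {u \<in> carrier G \<rightarrow> carrier K. \<forall>\<mu>\<in>carrier K. (\<Oplus>\<^bsub>K\<^esub>g\<in>carrier G. u g \<otimes>\<^bsub>K\<^esub> act g \<mu>) = \<zero>\<^bsub>K\<^esub>}"
  have one: "(\<lambda>_. \<one>\<^bsub>K\<^esub>) \<in> Z"
  proof -
    have "(\<Oplus>\<^bsub>K\<^esub>g\<in>carrier G. \<one>\<^bsub>K\<^esub> \<otimes>\<^bsub>K\<^esub> act g \<mu>) = trace \<mu>" if "\<mu> \<in> carrier K" for \<mu>
      unfolding trace_def using that by (intro K.finsum_cong') (auto simp: act_closed)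
    then show ?thesis by (simp add: Z_def tr)
  qed
  \<comment> \<open>Since g(x) g(\<mu>) = g(x \<mu>), the factor g(x) is absorbed by changing \<mu>,
    and the constant \<open>q\<close> leaves the sum. Hence multiplying \<open>u\<close> by a linear
    factor preserves the defining property of \<open>Z\<close>.\<close>
  have step: "(\<lambda>g. u g \<otimes>\<^bsub>K\<^esub> (act g x \<ominus>\<^bsub>K\<^esub> q)) \<in> Z" if u: "u \<in> Z" and x: "x \<in> carrier K" "q \<in> carrier K" for u x q
  proof -
    have uc: "u g \<in> carrier K" if "g \<in> carrier G" for g using u that by (auto simp: Z_def)
    have "(\<Oplus>\<^bsub>K\<^esub>g\<in>carrier G. u g \<otimes>\<^bsub>K\<^esub> (act g x \<ominus>\<^bsub>K\<^esub> q) \<otimes>\<^bsub>K\<^esub> act g \<mu>) = \<zero>\<^bsub>K\<^esub>" if \<mu>: "\<mu> \<in> carrier K" for \<mu>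
    proof -
      have "(\<Oplus>\<^bsub>K\<^esub>g\<in>carrier G. u g \<otimes>\<^bsub>K\<^esub> (act g x \<ominus>\<^bsub>K\<^esub> q) \<otimes>\<^bsub>K\<^esub> act g \<mu>) =
          (\<Oplus>\<^bsub>K\<^esub>g\<in>carrier G. u g \<otimes>\<^bsub>K\<^esub> act g (x \<otimes>\<^bsub>K\<^esub> \<mu>) \<oplus>\<^bsub>K\<^esub> \<ominus>\<^bsub>K\<^esub> q \<otimes>\<^bsub>K\<^esub> (u g \<otimes>\<^bsub>K\<^esub> act g \<mu>))"
      proof (intro K.finsum_cong' refl)
        fix g assume g: "g \<in> carrier G"
        note cl = uc[OF g] act_closed[OF g x(1)] act_closed[OF g \<mu>] x(2)
        show "u g \<otimes>\<^bsub>K\<^esub> (act g x \<ominus>\<^bsub>K\<^esub> q) \<otimes>\<^bsub>K\<^esub> act g \<mu> =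
            u g \<otimes>\<^bsub>K\<^esub> act g (x \<otimes>\<^bsub>K\<^esub> \<mu>) \<oplus>\<^bsub>K\<^esub> \<ominus>\<^bsub>K\<^esub> q \<otimes>\<^bsub>K\<^esub> (u g \<otimes>\<^bsub>K\<^esub> act g \<mu>)"
          unfolding act_K_mult[OF g x(1) \<mu>] using cl by algebra
      qed (use uc act_closed x \<mu> in auto)
      also have "\<dots> = (\<Oplus>\<^bsub>K\<^esub>g\<in>carrier G. u g \<otimes>\<^bsub>K\<^esub> act g (x \<otimes>\<^bsub>K\<^esub> \<mu>)) \<oplus>\<^bsub>K\<^esub>
          \<ominus>\<^bsub>K\<^esub> q \<otimes>\<^bsub>K\<^esub> (\<Oplus>\<^bsub>K\<^esub>g\<in>carrier G. u g \<otimes>\<^bsub>K\<^esub> act g \<mu>)"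
        using uc act_closed x \<mu> finite_G by (simp add: K.finsum_addf K.finsum_rdistr Pi_def)
      also have "\<dots> = \<zero>\<^bsub>K\<^esub>" using u x \<mu> by (simp add: Z_def)
      finally show ?thesis .
    qed
    then show ?thesis using uc act_closed x by (auto simp: Z_def)
  qed
  have "\<exists>u\<in>Z. u \<one>\<^bsub>G\<^esub> \<noteq> \<zero>\<^bsub>K\<^esub> \<and> (\<forall>g\<in>H. u g = \<zero>\<^bsub>K\<^esub>)" if "finite H" "H \<subseteq> carrier G - {\<one>\<^bsub>G\<^esub>}" for H
    using that
  proof (induction H)
    case empty
    then show ?case using one by (intro bexI[of _ "\<lambda>_. \<one>\<^bsub>K\<^esub>"]) auto
  next
    case (insert h H)
    then obtain u where u: "u \<in> Z" "u \<one>\<^bsub>G\<^esub> \<noteq> \<zero>\<^bsub>K\<^esub>" "\<forall>g\<in>H. u g = \<zero>\<^bsub>K\<^esub>" by auto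
    have h: "h \<in> carrier G" "h \<noteq> \<one>\<^bsub>G\<^esub>" using insert.prems by auto
    \<comment> \<open>The new factor g(x) - h(x) vanishes at g = h, and at the identity it is x -
      h(x), which is nonzero.\<close>
    obtain x where x: "x \<in> carrier K" "act h x \<noteq> x" using faithful[OF h(1)] h(2) by blast
    have uc: "u g \<in> carrier K" if "g \<in> carrier G" for g using u(1) that by (auto simp: Z_def)
    have xq: "x \<ominus>\<^bsub>K\<^esub> act h x \<noteq> \<zero>\<^bsub>K\<^esub>" using x act_closed[OF h(1) x(1)] by (metis K.r_right_minus_eq)
    have ne: "u \<one>\<^bsub>G\<^esub> \<otimes>\<^bsub>K\<^esub> (act \<one>\<^bsub>G\<^esub> x \<ominus>\<^bsub>K\<^esub> act h x) \<noteq> \<zero>\<^bsub>K\<^esub>"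
      using u(2) xq uc[OF G.one_closed] x(1) act_closed[OF h(1) x(1)]
      by (auto simp: act_one K.integral_iff)
    have z: "u g \<otimes>\<^bsub>K\<^esub> (act g x \<ominus>\<^bsub>K\<^esub> act h x) = \<zero>\<^bsub>K\<^esub>" if "g \<in> insert h H" for g
    proof (cases "g = h")
      case True
      then show ?thesis using uc[OF h(1)] act_closed[OF h(1) x(1)] by (simp add: K_self_minus)
    next
      case False
      then have "g \<in> carrier G" "u g = \<zero>\<^bsub>K\<^esub>" using that insert.prems u(3) by auto
      then show ?thesis using act_closed[OF _ x(1)] h(1) by simp
    qed
    show ?case
      by (rule bexI[OF _ step[OF u(1) x(1) act_closed[OF h(1) x(1)]]]) (use ne z in blast)
  qed
  from this[of "carrier G - {\<one>\<^bsub>G\<^esub>}"] obtain u where u: "u \<in> Z" "u \<one>\<^bsub>G\<^esub> \<noteq> \<zero>\<^bsub>K\<^esub>"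
      "\<forall>g\<in>carrier G - {\<one>\<^bsub>G\<^esub>}. u g = \<zero>\<^bsub>K\<^esub>" using finite_G by auto
  have uc: "u \<in> carrier G \<rightarrow> carrier K" using u(1) by (simp add: Z_def)
  have "(\<Oplus>\<^bsub>K\<^esub>g\<in>carrier G. u g \<otimes>\<^bsub>K\<^esub> act g \<one>\<^bsub>K\<^esub>) = u \<one>\<^bsub>G\<^esub> \<otimes>\<^bsub>K\<^esub> act \<one>\<^bsub>G\<^esub> \<one>\<^bsub>K\<^esub>"
    using u(3) uc act_closed by (intro finsum_single) auto
  then show False using u(1,2) uc by (auto simp: Z_def act_one Pi_iff)
qed

text \<open>
  \<open>W\<close> consists of functions \<open>f\<close> of tuples, polynomial over \<open>K\<close>, such that the pair of values
  at \<open>a\<close> and \<open>b\<close> of the trace of \<open>\<lambda>f\<close> belongs to the generated subring. A product of linear factors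
  vanishing on the orbits of \<open>a\<close> and \<open>b\<close> except at \<open>a\<close> has traces \<open>1\<close> and \<open>0\<close>.
\<close>

lemma one_zero_in_gen_pairs:
  assumes ab: "set a \<subseteq> carrier K" "set b \<subseteq> carrier K" "length a = length b"
    and free: "\<And>g. g \<in> carrier G \<Longrightarrow> map (act g) a = a \<Longrightarrow> g = \<one>\<^bsub>G\<^esub>"
    and orbit: "\<And>g. g \<in> carrier G \<Longrightarrow> b \<noteq> map (act g) a"
  shows "(\<one>\<^bsub>K\<^esub>, \<zero>\<^bsub>K\<^esub>) \<in> gen_pairs K D (set (zip a b))"
proof -
  let ?S = "gen_pairs K D (set (zip a b))"
  let ?X = "{x. set x \<subseteq> carrier K \<and> length x = length a}"
  \<comment> \<open>The trace of l f, evaluated at \<open>y\<close>, for the action of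
    \<open>G\<close> on functions by conjugation: g sends \<open>f\<close> to the function with
    value g(f(g^-1 y)) at \<open>y\<close>.\<close>
  define val where "val f y l = (\<Oplus>\<^bsub>K\<^esub>g\<in>carrier G. act g (l \<otimes>\<^bsub>K\<^esub> f (map (act (inv\<^bsub>G\<^esub> g)) y)))" for f y l
  define W where "W = {f \<in> ?X \<rightarrow> carrier K. \<forall>l\<in>carrier K. (val f a l, val f b l) \<in> ?S}"
  have pts: "map (act g) y \<in> ?X" if "y \<in> ?X" "g \<in> carrier G" for y g
    using that act_closed by auto
  have aX: "a \<in> ?X" and bX: "b \<in> ?X" using ab by auto
  have one: "(\<lambda>_. \<one>\<^bsub>K\<^esub>) \<in> W"
  proof -
    have "val (\<lambda>_. \<one>\<^bsub>K\<^esub>) y l = trace l" if "l \<in> carrier K" for y l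
      unfolding val_def trace_def using that by (intro K.finsum_cong') (auto simp: act_closed)
    then show ?thesis by (simp add: W_def gen_pairs.const trace_in_D)
  qed
  have step: "(\<lambda>x. f x \<otimes>\<^bsub>K\<^esub> (x ! j \<ominus>\<^bsub>K\<^esub> q)) \<in> W" if f: "f \<in> W" and j: "j < length a" and q: "q \<in> carrier K" for f j q
  proof -
    have fc: "f x \<in> carrier K" if "x \<in> ?X" for x using f that by (auto simp: W_def)
    have jc: "x ! j \<in> carrier K" if "x \<in> ?X" for x using that j by (auto simp: subset_iff)
    \<comment> \<open>A coordinate function is invariant under conjugation and leaves the trace as
      the factor \<open>y ! j\<close>, while the constant \<open>q\<close> is moved into the
      multiplier. This is why \<open>W\<close> requires its condition for every multiplier
      \<open>l\<close>.\<close>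
    have v: "val (\<lambda>x. f x \<otimes>\<^bsub>K\<^esub> (x ! j \<ominus>\<^bsub>K\<^esub> q)) y l =
        y ! j \<otimes>\<^bsub>K\<^esub> val f y l \<oplus>\<^bsub>K\<^esub> val f y (\<ominus>\<^bsub>K\<^esub> (l \<otimes>\<^bsub>K\<^esub> q))" if y: "y \<in> ?X" and l: "l \<in> carrier K" for y l
    proof -
      have "val (\<lambda>x. f x \<otimes>\<^bsub>K\<^esub> (x ! j \<ominus>\<^bsub>K\<^esub> q)) y l = (\<Oplus>\<^bsub>K\<^esub>g\<in>carrier G.
          y ! j \<otimes>\<^bsub>K\<^esub> act g (l \<otimes>\<^bsub>K\<^esub> f (map (act (inv\<^bsub>G\<^esub> g)) y)) \<oplus>\<^bsub>K\<^esub>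
          act g (\<ominus>\<^bsub>K\<^esub> (l \<otimes>\<^bsub>K\<^esub> q) \<otimes>\<^bsub>K\<^esub> f (map (act (inv\<^bsub>G\<^esub> g)) y)))"
        unfolding val_def
      proof (intro K.finsum_cong' refl)
        fix g assume g: "g \<in> carrier G"
        let ?z = "map (act (inv\<^bsub>G\<^esub> g)) y"
        have z: "?z \<in> ?X" using pts[OF y G.inv_closed[OF g]] .
        interpret g: ring_hom_cring K K "act g" by (rule act_ring_hom_cring[OF g])
        have zj: "act g (?z ! j) = y ! j" using y j jc[OF y] by (simp add: act_inv_cancel[OF g])
        have "l \<otimes>\<^bsub>K\<^esub> (f ?z \<otimes>\<^bsub>K\<^esub> (?z ! j \<ominus>\<^bsub>K\<^esub> q)) =
            ?z ! j \<otimes>\<^bsub>K\<^esub> (l \<otimes>\<^bsub>K\<^esub> f ?z) \<oplus>\<^bsub>K\<^esub> \<ominus>\<^bsub>K\<^esub> (l \<otimes>\<^bsub>K\<^esub> q) \<otimes>\<^bsub>K\<^esub> f ?z"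
          using fc[OF z] jc[OF z] l q by algebra
        then show "act g (l \<otimes>\<^bsub>K\<^esub> (f ?z \<otimes>\<^bsub>K\<^esub> (?z ! j \<ominus>\<^bsub>K\<^esub> q))) =
          y ! j \<otimes>\<^bsub>K\<^esub> act g (l \<otimes>\<^bsub>K\<^esub> f ?z) \<oplus>\<^bsub>K\<^esub> act g (\<ominus>\<^bsub>K\<^esub> (l \<otimes>\<^bsub>K\<^esub> q) \<otimes>\<^bsub>K\<^esub> f ?z)"
          using fc[OF z] jc[OF z] l q zj by (simp only: g.hom_add g.hom_mult K.m_closed K.a_inv_closed)
      qed (use y l q fc[OF pts[OF y G.inv_closed]] jc[OF y] act_closed in auto)
      then show ?thesis
        unfolding val_def using y l q fc[OF pts[OF y G.inv_closed]] jc[OF y] act_closed finite_G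
        by (simp add: K.finsum_addf K.finsum_rdistr Pi_def)
    qed
    have "(a ! j, b ! j) \<in> set (zip a b)" using j ab(3) by (metis in_set_zip fst_conv snd_conv)
    then have "(a ! j \<otimes>\<^bsub>K\<^esub> val f a l \<oplus>\<^bsub>K\<^esub> val f a (\<ominus>\<^bsub>K\<^esub> (l \<otimes>\<^bsub>K\<^esub> q)),
        b ! j \<otimes>\<^bsub>K\<^esub> val f b l \<oplus>\<^bsub>K\<^esub> val f b (\<ominus>\<^bsub>K\<^esub> (l \<otimes>\<^bsub>K\<^esub> q))) \<in> ?S" if "l \<in> carrier K" for l
      using f q that by (intro gen_pairs.add[OF gen_pairs.mult[OF gen_pairs.base]]) (auto simp: W_def)
    then show ?thesis
      using v[OF aX] v[OF bX] fc jc q by (auto simp: W_def)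
  qed
  have vanish: "\<exists>f\<in>W. f a \<noteq> \<zero>\<^bsub>K\<^esub> \<and> (\<forall>x\<in>Q. f x = \<zero>\<^bsub>K\<^esub>)" if "finite Q" "Q \<subseteq> ?X - {a}" for Q
    using that
  proof (induction Q)
    case empty
    then show ?case using one by (intro bexI[of _ "\<lambda>_. \<one>\<^bsub>K\<^esub>"]) auto
  next
    case (insert y Q)
    then obtain f where f: "f \<in> W" "f a \<noteq> \<zero>\<^bsub>K\<^esub>" "\<forall>x\<in>Q. f x = \<zero>\<^bsub>K\<^esub>" by auto
    have y: "y \<in> ?X" "y \<noteq> a" using insert.prems by auto
    then obtain j where j: "j < length a" "y ! j \<noteq> a ! j" by (auto simp: list_eq_iff_nth_eq)
    have jc: "x ! j \<in> carrier K" if "x \<in> ?X" for x using that j by (auto simp: subset_iff)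
    have fc: "f x \<in> carrier K" if "x \<in> ?X" for x using f(1) that by (auto simp: W_def)
    have "a ! j \<ominus>\<^bsub>K\<^esub> y ! j \<noteq> \<zero>\<^bsub>K\<^esub>" using j(2) jc[OF aX] jc[OF y(1)] by (metis K.r_right_minus_eq)
    then have ne: "f a \<otimes>\<^bsub>K\<^esub> (a ! j \<ominus>\<^bsub>K\<^esub> y ! j) \<noteq> \<zero>\<^bsub>K\<^esub>"
      using f(2) fc[OF aX] jc[OF aX] jc[OF y(1)] by (simp add: K.integral_iff)
    have z: "f x \<otimes>\<^bsub>K\<^esub> (x ! j \<ominus>\<^bsub>K\<^esub> y ! j) = \<zero>\<^bsub>K\<^esub>" if "x \<in> insert y Q" for x
    proof (cases "x = y")
      case True
      then show ?thesis using fc[OF y(1)] jc[OF y(1)] by (simp add: K_self_minus)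
    next
      case False
      then have "x \<in> ?X" "f x = \<zero>\<^bsub>K\<^esub>" using that insert.prems f(3) by auto
      then show ?thesis using jc[of x] jc[OF y(1)] by simp
    qed
    show ?case by (rule bexI[OF _ step[OF f(1) j(1) jc[OF y(1)]]]) (use ne z in blast)
  qed
  \<comment> \<open>The points other than \<open>a\<close> at which \<open>val f a\<close> and
    \<open>val f b\<close> evaluate \<open>f\<close>. If \<open>f\<close> vanishes on them, only the
    summand of the identity survives at \<open>a\<close>, and none at \<open>b\<close>.\<close>
  let ?Q = "(\<lambda>g. map (act g) a) ` (carrier G - {\<one>\<^bsub>G\<^esub>}) \<union> (\<lambda>g. map (act g) b) ` carrier G"
  have fin: "finite ((\<lambda>g. map (act g) a) ` (carrier G - {\<one>\<^bsub>G\<^esub>}) \<union> (\<lambda>g. map (act g) b) ` carrier G)"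
    using finite_G by simp
  have sub: "?Q \<subseteq> ?X - {a}"
  proof -
    have ba: "map (act g) b \<noteq> a" if g: "g \<in> carrier G" for g
    proof
      assume "map (act g) b = a"
      then have "map (act (inv\<^bsub>G\<^esub> g)) a = map (\<lambda>x. act (inv\<^bsub>G\<^esub> g) (act g x)) b" by auto
      also have "\<dots> = b"
        using ab(2) act_inv_cancel[OF G.inv_closed[OF g]] g by (auto intro!: map_idI)
      finally show False using orbit[OF G.inv_closed[OF g]] by simp
    qed
    show ?thesis
    proof
      fix x assume "x \<in> ?Q"
      then consider g where "g \<in> carrier G" "g \<noteq> \<one>\<^bsub>G\<^esub>" "x = map (act g) a"
        | g where "g \<in> carrier G" "x = map (act g) b" by blast
      then show "x \<in> ?X - {a}"
      proof cases
        case (1 g)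
        then show ?thesis using free[OF 1(1)] pts[OF aX 1(1)] by auto
      next
        case (2 g)
        then show ?thesis using ba[OF 2(1)] pts[OF bX 2(1)] by simp
      qed
    qed
  qed
  obtain f where f0: "f \<in> W" "f a \<noteq> \<zero>\<^bsub>K\<^esub>" "\<forall>x\<in>?Q. f x = \<zero>\<^bsub>K\<^esub>"
    using vanish[OF fin sub] by auto
  then have f: "f \<in> W" "f a \<noteq> \<zero>\<^bsub>K\<^esub>"
      "\<And>g. g \<in> carrier G - {\<one>\<^bsub>G\<^esub>} \<Longrightarrow> f (map (act g) a) = \<zero>\<^bsub>K\<^esub>" "\<And>g. g \<in> carrier G \<Longrightarrow> f (map (act g) b) = \<zero>\<^bsub>K\<^esub>"
    by blast+
  have fc: "f x \<in> carrier K" if "x \<in> ?X" for x using f(1) that by (auto simp: W_def)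
  \<comment> \<open>This multiplier normalises the surviving summand to 1.\<close>
  let ?l = "inv\<^bsub>K\<^esub> (f a)"
  have unit: "f a \<in> Units K" using f(2) fc[OF aX] by (simp add: K.field_Units)
  have l: "?l \<in> carrier K" "?l \<otimes>\<^bsub>K\<^esub> f a = \<one>\<^bsub>K\<^esub>" using unit by auto
  have act0: "act g \<zero>\<^bsub>K\<^esub> = \<zero>\<^bsub>K\<^esub>" if "g \<in> carrier G" for g
    using ring_hom_cring.hom_zero[OF act_ring_hom_cring[OF that]] .
  have a1: "map (act \<one>\<^bsub>G\<^esub>) a = a" using ab(1) act_one by (auto intro!: map_idI)
  have "val f a ?l = act \<one>\<^bsub>G\<^esub> (?l \<otimes>\<^bsub>K\<^esub> f (map (act (inv\<^bsub>G\<^esub> \<one>\<^bsub>G\<^esub>)) a))"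
    unfolding val_def
  proof (rule finsum_single)
    fix g assume g: "g \<in> carrier G" "g \<noteq> \<one>\<^bsub>G\<^esub>"
    then have "inv\<^bsub>G\<^esub> g \<in> carrier G - {\<one>\<^bsub>G\<^esub>}" by (simp add: G.inv_eq_1_iff)
    then show "act g (?l \<otimes>\<^bsub>K\<^esub> f (map (act (inv\<^bsub>G\<^esub> g)) a)) = \<zero>\<^bsub>K\<^esub>"
      using f(3) l(1) act0 g(1) by simp
  qed (use l(1) fc[OF pts[OF aX G.inv_closed]] act_closed in auto)
  then have va: "val f a ?l = \<one>\<^bsub>K\<^esub>" by (simp add: a1 l act_one)
  have "val f b ?l = (\<Oplus>\<^bsub>K\<^esub>g\<in>carrier G. \<zero>\<^bsub>K\<^esub>)"
    unfolding val_def using f(4) l(1) act0 by (intro K.finsum_cong') auto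
  then have vb: "val f b ?l = \<zero>\<^bsub>K\<^esub>" by simp
  show ?thesis using f(1) l(1) va vb unfolding W_def by force
qed

text \<open>
  Here \<open>y\<close> is, up to a nonzero factor, the value at \<open>b\<close> of the product of \<open>X - g(a)\<close> over the orbit of \<open>a\<close>.
\<close>

lemma orbit_gen_pairs:
  assumes M: "field M" "\<psi> \<in> ring_hom K M" and a: "a \<in> carrier K" and b: "b \<in> carrier M"
    and A: "(\<psi> a, b) \<in> A"
  shows "\<exists>y. (\<zero>\<^bsub>M\<^esub>, y) \<in> gen_pairs M (\<psi> ` D) A \<and> (y = \<zero>\<^bsub>M\<^esub> \<longrightarrow> (\<exists>g\<in>carrier G. b = \<psi> (act g a)))"
proof -
  interpret M: field M by fact
  interpret \<psi>: ring_hom_cring K M \<psi>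
    using M(2) K.is_cring M.is_cring by (simp add: ring_hom_cring_def ring_hom_cring_axioms_def)
  let ?S = "gen_pairs M (\<psi> ` D) A"
  \<comment> \<open>A sum of g(l) with weights u(g). The weights put into \<open>W\<close> are the
    values, at \<open>\<psi> a\<close> and at \<open>b\<close>, of the conjugate by \<open>g\<close>
    of one polynomial over \<open>K\<close>; summed with g(l), the conjugated coefficients become
    traces and so lie in \<open>D\<close>.\<close>
  define sm where "sm u l = (\<Oplus>\<^bsub>M\<^esub>g\<in>carrier G. \<psi> (act g l) \<otimes>\<^bsub>M\<^esub> u g)" for u l
  define W where "W = {(u, v). u \<in> carrier G \<rightarrow> carrier M \<and> v \<in> carrier G \<rightarrow> carrier M \<and>
    (\<forall>l\<in>carrier K. (sm u l, sm v l) \<in> ?S)}"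
  have sm_const: "sm (\<lambda>_. y) l = \<psi> (trace l) \<otimes>\<^bsub>M\<^esub> y" if "y \<in> carrier M" "l \<in> carrier K" for y l
  proof -
    have "\<psi> (trace l) = (\<Oplus>\<^bsub>M\<^esub>g\<in>carrier G. \<psi> (act g l))"
      unfolding trace_def using that by (subst \<psi>.hom_finsum) (auto simp: act_closed comp_def)
    then show ?thesis
      unfolding sm_def using that finite_G by (simp add: M.finsum_ldistr act_closed Pi_def)
  qed
  have sm_cong: "sm u l = sm u' l" if "u \<in> carrier G \<rightarrow> carrier M" "l \<in> carrier K"
      "\<And>g. g \<in> carrier G \<Longrightarrow> u g = u' g" for u u' l
    unfolding sm_def using that by (intro M.finsum_cong') (auto simp: act_closed Pi_iff)
  have one: "((\<lambda>_. \<one>\<^bsub>M\<^esub>), (\<lambda>_. \<one>\<^bsub>M\<^esub>)) \<in> W"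
    unfolding W_def using trace_closed trace_in_D by (auto simp: sm_const intro: gen_pairs.const)
  \<comment> \<open>The variable leaves the sum as a factor, and the root is moved into the
    multiplier by g(l) g(q) = g(l q).\<close>
  have step: "((\<lambda>g. (\<psi> a \<ominus>\<^bsub>M\<^esub> \<psi> (act g q)) \<otimes>\<^bsub>M\<^esub> u g), (\<lambda>g. (b \<ominus>\<^bsub>M\<^esub> \<psi> (act g q)) \<otimes>\<^bsub>M\<^esub> v g)) \<in> W"
    if uv: "(u, v) \<in> W" and q: "q \<in> carrier K" for u v q
  proof -
    have s: "sm (\<lambda>g. (c \<ominus>\<^bsub>M\<^esub> \<psi> (act g q)) \<otimes>\<^bsub>M\<^esub> u g) l = c \<otimes>\<^bsub>M\<^esub> sm u l \<oplus>\<^bsub>M\<^esub> sm u (\<ominus>\<^bsub>K\<^esub> (l \<otimes>\<^bsub>K\<^esub> q))"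
      if u: "u \<in> carrier G \<rightarrow> carrier M" and c: "c \<in> carrier M" and l: "l \<in> carrier K" for u c l
    proof -
      have uc: "u g \<in> carrier M" if "g \<in> carrier G" for g using u that by auto
      have pc: "\<psi> (act g x) \<in> carrier M" if "g \<in> carrier G" "x \<in> carrier K" for g x
        using act_closed[OF that] by simp
      have "sm (\<lambda>g. (c \<ominus>\<^bsub>M\<^esub> \<psi> (act g q)) \<otimes>\<^bsub>M\<^esub> u g) l = (\<Oplus>\<^bsub>M\<^esub>g\<in>carrier G.
          c \<otimes>\<^bsub>M\<^esub> (\<psi> (act g l) \<otimes>\<^bsub>M\<^esub> u g) \<oplus>\<^bsub>M\<^esub> \<psi> (act g (\<ominus>\<^bsub>K\<^esub> (l \<otimes>\<^bsub>K\<^esub> q))) \<otimes>\<^bsub>M\<^esub> u g)"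
        unfolding sm_def
      proof (intro M.finsum_cong' refl)
        fix g assume g: "g \<in> carrier G"
        have "\<psi> (act g (\<ominus>\<^bsub>K\<^esub> (l \<otimes>\<^bsub>K\<^esub> q))) = \<ominus>\<^bsub>M\<^esub> (\<psi> (act g l) \<otimes>\<^bsub>M\<^esub> \<psi> (act g q))"
          using g l q by (simp add: act_K_minus act_K_mult act_closed)
        then show "\<psi> (act g l) \<otimes>\<^bsub>M\<^esub> ((c \<ominus>\<^bsub>M\<^esub> \<psi> (act g q)) \<otimes>\<^bsub>M\<^esub> u g) =
            c \<otimes>\<^bsub>M\<^esub> (\<psi> (act g l) \<otimes>\<^bsub>M\<^esub> u g) \<oplus>\<^bsub>M\<^esub> \<psi> (act g (\<ominus>\<^bsub>K\<^esub> (l \<otimes>\<^bsub>K\<^esub> q))) \<otimes>\<^bsub>M\<^esub> u g"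
          using uc[OF g] pc[OF g l] pc[OF g q] c by simp algebra
      qed (use uc pc c l q in auto)
      then show ?thesis
        unfolding sm_def using uc pc c l q finite_G
        by (simp add: M.finsum_addf M.finsum_rdistr Pi_def)
    qed
    have uc: "u \<in> carrier G \<rightarrow> carrier M" "v \<in> carrier G \<rightarrow> carrier M" using uv by (auto simp: W_def)
    have "(\<psi> a \<otimes>\<^bsub>M\<^esub> sm u l \<oplus>\<^bsub>M\<^esub> sm u (\<ominus>\<^bsub>K\<^esub> (l \<otimes>\<^bsub>K\<^esub> q)), b \<otimes>\<^bsub>M\<^esub> sm v l \<oplus>\<^bsub>M\<^esub> sm v (\<ominus>\<^bsub>K\<^esub> (l \<otimes>\<^bsub>K\<^esub> q))) \<in> ?S"
      if "l \<in> carrier K" for l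
      using uv that q A by (intro gen_pairs.add[OF gen_pairs.mult[OF gen_pairs.base]]) (auto simp: W_def)
    then show ?thesis
      using s[OF uc(1), of "\<psi> a"] s[OF uc(2) b] uc a b q act_closed by (auto simp: W_def)
  qed
  let ?u = "\<lambda>Q c g. \<Otimes>\<^bsub>M\<^esub>q\<in>Q. (c \<ominus>\<^bsub>M\<^esub> \<psi> (act g q))"
  have cl: "c \<ominus>\<^bsub>M\<^esub> \<psi> (act g q) \<in> carrier M" if "c \<in> carrier M" "g \<in> carrier G" "q \<in> carrier K" for c g q
    using that act_closed by simp
  have prodW: "\<exists>(u, v)\<in>W. \<forall>g\<in>carrier G. u g = ?u Q (\<psi> a) g \<and> v g = ?u Q b g" if "finite Q" "Q \<subseteq> carrier K" for Q
    using that
  proof (induction Q)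
    case empty
    then show ?case by (intro bexI[OF _ one]) auto
  next
    case (insert q Q)
    then obtain u v where uv: "(u, v) \<in> W" "\<forall>g\<in>carrier G. u g = ?u Q (\<psi> a) g \<and> v g = ?u Q b g" by auto
    have q: "q \<in> carrier K" using insert.prems by simp
    have ins: "?u (insert q Q) c g = (c \<ominus>\<^bsub>M\<^esub> \<psi> (act g q)) \<otimes>\<^bsub>M\<^esub> ?u Q c g" if "c \<in> carrier M" "g \<in> carrier G" for c g
      using insert.hyps insert.prems cl that by (intro M.finprod_insert) auto
    show ?case
      by (rule bexI[OF _ step[OF uv(1) q]]) (use uv(2) a b in \<open>auto simp: ins\<close>)
  qed
  \<comment> \<open>The set of conjugates, each taken once; every group element permutes it.\<close>
  let ?Q = "(\<lambda>g. act g a) ` carrier G"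
  have Q: "finite ?Q" "?Q \<subseteq> carrier K" using finite_G act_closed a by auto
  obtain u v where uv: "(u, v) \<in> W" "\<forall>g\<in>carrier G. u g = ?u ?Q (\<psi> a) g \<and> v g = ?u ?Q b g"
    using prodW[OF Q] by auto
  have uc: "u \<in> carrier G \<rightarrow> carrier M" "v \<in> carrier G \<rightarrow> carrier M" using uv(1) by (auto simp: W_def)
  define y where "y = (\<Otimes>\<^bsub>M\<^esub>q\<in>?Q. b \<ominus>\<^bsub>M\<^esub> \<psi> q)"
  have yc: "y \<in> carrier M" unfolding y_def using Q(2) b by (intro M.finprod_closed) auto
  \<comment> \<open>The factor belonging to the conjugate g^-1(a) is \<open>\<psi> a\<close> minus
    itself.\<close>
  have u0: "u g = \<zero>\<^bsub>M\<^esub>" if g: "g \<in> carrier G" for g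
  proof -
    have "act (inv\<^bsub>G\<^esub> g) a \<in> ?Q" using g by auto
    moreover have "\<psi> a \<ominus>\<^bsub>M\<^esub> \<psi> (act g (act (inv\<^bsub>G\<^esub> g) a)) = \<zero>\<^bsub>M\<^esub>"
      using g a by (simp add: act_inv_cancel M.r_right_minus_eq)
    moreover have "?u ?Q (\<psi> a) g = (\<psi> a \<ominus>\<^bsub>M\<^esub> \<psi> (act g (act (inv\<^bsub>G\<^esub> g) a))) \<otimes>\<^bsub>M\<^esub>
        ?u (?Q - {act (inv\<^bsub>G\<^esub> g) a}) (\<psi> a) g"
      using Q g a cl[OF _ g] calculation(1)
      by (subst M.finprod_insert[symmetric]) (auto simp: insert_absorb act_closed)
    moreover have "?u (?Q - {act (inv\<^bsub>G\<^esub> g) a}) (\<psi> a) g \<in> carrier M"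
      using Q a cl[OF _ g] by (intro M.finprod_closed) (auto simp: act_closed)
    ultimately show ?thesis using uv(2) g by simp
  qed
  \<comment> \<open>Conjugating by \<open>g\<close> only permutes the factors, so at
    \<open>b\<close> the weight does not depend on \<open>g\<close>.\<close>
  have vy: "v g = y" if g: "g \<in> carrier G" for g
  proof -
    have inj: "inj_on (act g) ?Q"
    proof (rule inj_on_inverseI)
      fix q assume "q \<in> ?Q"
      then show "act (inv\<^bsub>G\<^esub> g) (act g q) = q"
        using act_inv_cancel[OF G.inv_closed[OF g], of q] Q(2) g by auto
    qed
    have "act g ` ?Q \<subseteq> ?Q"
    proof clarify
      fix h assume "h \<in> carrier G"
      then show "act g (act h a) \<in> ?Q" using g a by (intro image_eqI[of _ _ "g \<otimes>\<^bsub>G\<^esub> h"]) (auto simp: act_mult)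
    qed
    then have img: "act g ` ?Q = ?Q" using Q(1) inj by (intro card_subset_eq) (auto simp: card_image)
    have "?u ?Q b g = (\<Otimes>\<^bsub>M\<^esub>q\<in>act g ` ?Q. b \<ominus>\<^bsub>M\<^esub> \<psi> q)"
      using inj b Q(2) img by (intro M.finprod_reindex[symmetric]) auto
    then show ?thesis using uv(2) g by (simp add: img y_def)
  qed
  \<comment> \<open>For the constant weight \<open>y\<close> the sum is \<open>y\<close> times the
    image of the trace of \<open>l\<close>; a nonzero trace lets the vanishing of \<open>y\<close>
    be read off.\<close>
  obtain l where l: "l \<in> carrier K" "trace l \<noteq> \<zero>\<^bsub>K\<^esub>" using trace_nonzero by blast
  have "sm u l = \<psi> (trace l) \<otimes>\<^bsub>M\<^esub> \<zero>\<^bsub>M\<^esub>"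
    using sm_cong[OF uc(1) l(1), of "\<lambda>_. \<zero>\<^bsub>M\<^esub>"] u0 sm_const[of "\<zero>\<^bsub>M\<^esub>" l] l(1) by simp
  then have su: "sm u l = \<zero>\<^bsub>M\<^esub>" using l(1) trace_closed by simp
  have sv: "sm v l = \<psi> (trace l) \<otimes>\<^bsub>M\<^esub> y"
    using sm_cong[OF uc(2) l(1), of "\<lambda>_. y"] vy sm_const[OF yc l(1)] by simp
  have mem: "(\<zero>\<^bsub>M\<^esub>, \<psi> (trace l) \<otimes>\<^bsub>M\<^esub> y) \<in> ?S"
    using uv(1) l(1) su sv unfolding W_def by force
  have inj: "inj_on \<psi> (carrier K)"
    by (rule non_trivial_field_hom_is_inj[OF M(2) K.field_axioms M.field_axioms])
  have nz: "\<psi> (trace l) \<noteq> \<zero>\<^bsub>M\<^esub>"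
    using inj l trace_closed[OF l(1)] \<psi>.hom_zero by (metis K.zero_closed inj_onD)
  have "\<exists>g\<in>carrier G. b = \<psi> (act g a)" if "\<psi> (trace l) \<otimes>\<^bsub>M\<^esub> y = \<zero>\<^bsub>M\<^esub>"
  proof (rule ccontr)
    assume no: "\<not> ?thesis"
    have "(\<Otimes>\<^bsub>M\<^esub>q\<in>Q. b \<ominus>\<^bsub>M\<^esub> \<psi> q) \<noteq> \<zero>\<^bsub>M\<^esub>" if "finite Q" "Q \<subseteq> ?Q" for Q
      using that
    proof (induction Q)
      case (insert q Q)
      have c: "\<And>q. q \<in> ?Q \<Longrightarrow> b \<ominus>\<^bsub>M\<^esub> \<psi> q \<in> carrier M" using Q(2) b by auto
      have "b \<ominus>\<^bsub>M\<^esub> \<psi> q \<noteq> \<zero>\<^bsub>M\<^esub>" using no insert.prems Q(2) b by (auto simp: M.r_right_minus_eq act_closed a)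
      moreover have "(\<Otimes>\<^bsub>M\<^esub>q\<in>Q. b \<ominus>\<^bsub>M\<^esub> \<psi> q) \<in> carrier M"
        using c insert.prems by (intro M.finprod_closed) auto
      ultimately show ?case using insert c by (simp add: M.finprod_insert M.integral_iff Pi_def subset_iff)
    qed auto
    from this[OF Q(1) order_refl] have "y \<noteq> \<zero>\<^bsub>M\<^esub>" by (simp add: y_def)
    then show False using that nz yc trace_closed[OF l(1)] by (simp add: M.integral_iff)
  qed
  with mem show ?thesis by blast
qed

end

section \<open>The groups at the finite levels\<close>

text \<open>The levelwise bijections run from \<open>P\<close> to \<open>H\<close>, as the action
  sends group elements to automorphisms; the isomorphism of the limits applies their inverses in
  each coordinate.\<close>

lemma inverse_limit_iso:
  assumes bij: "\<And>N. N \<in> I \<Longrightarrow> bij_betw (\<phi> N) (carrier (P N)) (carrier (H N))"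
    and closed: "\<And>N x y. N \<in> I \<Longrightarrow> x \<in> carrier (P N) \<Longrightarrow> y \<in> carrier (P N) \<Longrightarrow> x \<otimes>\<^bsub>P N\<^esub> y \<in> carrier (P N)"
    and hom: "\<And>N x y. N \<in> I \<Longrightarrow> x \<in> carrier (P N) \<Longrightarrow> y \<in> carrier (P N) \<Longrightarrow>
      \<phi> N (x \<otimes>\<^bsub>P N\<^esub> y) = \<phi> N x \<otimes>\<^bsub>H N\<^esub> \<phi> N y"
    and f: "\<And>N M x. N \<in> I \<Longrightarrow> M \<in> I \<Longrightarrow> lt N M \<Longrightarrow> x \<in> carrier (P M) \<Longrightarrow> f M N x \<in> carrier (P N)"
    and compat: "\<And>N M x. N \<in> I \<Longrightarrow> M \<in> I \<Longrightarrow> lt N M \<Longrightarrow> x \<in> carrier (P M) \<Longrightarrow> h M N (\<phi> M x) = \<phi> N (f M N x)"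
  shows "inverse_limit I lt H h \<cong> inverse_limit I lt P f"
proof -
  let ?\<psi> = "\<lambda>N. inv_into (carrier (P N)) (\<phi> N)"
  let ?L = "\<lambda>x. \<lambda>N\<in>I. ?\<psi> N (x N)"
  have inv: "?\<psi> N y \<in> carrier (P N)" "\<phi> N (?\<psi> N y) = y" if "N \<in> I" "y \<in> carrier (H N)" for N y
    using bij[OF that(1)] that(2) by (auto simp: bij_betw_def inv_into_into f_inv_into_f)
  have inv': "\<phi> N x \<in> carrier (H N)" "?\<psi> N (\<phi> N x) = x" if "N \<in> I" "x \<in> carrier (P N)" for N x
    using bij[OF that(1)] that(2) by (auto simp: bij_betw_def)
  have "?L \<in> iso (inverse_limit I lt H h) (inverse_limit I lt P f)"
  proof (rule isoI)
    show "?L \<in> hom (inverse_limit I lt H h) (inverse_limit I lt P f)"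
    proof (rule homI)
      fix x assume x: "x \<in> carrier (inverse_limit I lt H h)"
      have "f M N (?\<psi> M (x M)) = ?\<psi> N (x N)" if "N \<in> I" "M \<in> I" "lt N M" for N M
      proof -
        have xM: "x M \<in> carrier (H M)" "h M N (x M) = x N"
          using x that by (auto simp: inverse_limit_def PiE_iff)
        have "\<phi> N (f M N (?\<psi> M (x M))) = x N"
          using compat[OF that inv(1)[OF that(2) xM(1)]] inv(2)[OF that(2) xM(1)] xM(2) by simp
        then show ?thesis using inv'(2)[OF that(1) f[OF that inv(1)[OF that(2) xM(1)]]] by simp
      qed
      then show "?L x \<in> carrier (inverse_limit I lt P f)"
        using x inv(1) by (auto simp: inverse_limit_def PiE_iff)
    next
      fix x y assume "x \<in> carrier (inverse_limit I lt H h)" "y \<in> carrier (inverse_limit I lt H h)"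
      then have xy: "x N \<in> carrier (H N)" "y N \<in> carrier (H N)" if "N \<in> I" for N
        using that by (auto simp: inverse_limit_def PiE_iff)
      have "?\<psi> N (x N \<otimes>\<^bsub>H N\<^esub> y N) = ?\<psi> N (x N) \<otimes>\<^bsub>P N\<^esub> ?\<psi> N (y N)" if N: "N \<in> I" for N
        using hom[OF N inv(1)[OF N xy(1)[OF N]] inv(1)[OF N xy(2)[OF N]]]
          inv'(2)[OF N closed[OF N inv(1)[OF N xy(1)[OF N]] inv(1)[OF N xy(2)[OF N]]]]
        by (simp add: inv(2) N xy)
      then show "?L (x \<otimes>\<^bsub>inverse_limit I lt H h\<^esub> y) = ?L x \<otimes>\<^bsub>inverse_limit I lt P f\<^esub> ?L y"
        by (auto simp: inverse_limit_def)
    qed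
    show "bij_betw ?L (carrier (inverse_limit I lt H h)) (carrier (inverse_limit I lt P f))"
    proof (rule bij_betw_byWitness[where f' = "\<lambda>x. \<lambda>N\<in>I. \<phi> N (x N)"])
      show "\<forall>x\<in>carrier (inverse_limit I lt H h). (\<lambda>N\<in>I. \<phi> N (?L x N)) = x"
        using inv(2) by (auto simp: inverse_limit_def PiE_iff extensional_def fun_eq_iff)
      show "\<forall>x\<in>carrier (inverse_limit I lt P f). ?L (\<lambda>N\<in>I. \<phi> N (x N)) = x"
        using inv'(2) by (auto simp: inverse_limit_def PiE_iff extensional_def fun_eq_iff)
      show "?L ` carrier (inverse_limit I lt H h) \<subseteq> carrier (inverse_limit I lt P f)"
        using \<open>?L \<in> hom _ _\<close> by (auto simp: hom_def)
      show "(\<lambda>x. \<lambda>N\<in>I. \<phi> N (x N)) ` carrier (inverse_limit I lt P f) \<subseteq> carrier (inverse_limit I lt H h)"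
        using inv'(1) compat by (auto simp: inverse_limit_def PiE_iff)
    qed
  qed
  then show ?thesis by (rule is_isoI)
qed

text \<open>The given maps are computable on carriers only; the value 0 elsewhere makes them total
  recursive.\<close>

definition guard :: "nat set \<Rightarrow> (nat \<Rightarrow> nat) \<Rightarrow> nat \<Rightarrow> nat" where
  "guard D f x = (if x \<in> D then f x else 0)"

lemma ring_hom_cong:
  assumes "f \<in> ring_hom R S" "ring R" "\<And>x. x \<in> carrier R \<Longrightarrow> f x = g x"
  shows "g \<in> ring_hom R S"
proof -
  interpret ring R by fact
  show ?thesis using assms(1,3) by (auto simp: ring_hom_def Pi_iff)
qed

lemma arec_guard_map:
  assumes "uniformly_computable_maps D f"
    and D: "\<And>n x. arec U n \<Longrightarrow> arec U x \<Longrightarrow> adec U (\<lambda>i z. x i z \<in> D (n i z))"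
    and "arec U n" "arec U x"
  shows "arec U (\<lambda>i z. guard (D (n i z)) (f (n i z)) (x i z))"
proof -
  obtain \<phi> where \<phi>: "partial_recursive \<phi>" "\<forall>i. \<forall>x\<in>D i. \<phi> (list_encode [i, x]) = Some (f i x)"
    using assms(1) unfolding uniformly_computable_maps_def by blast
  show ?thesis unfolding guard_def
    by (rule arec_if_partial[OF \<phi>(1), where g = "\<lambda>i z. list_encode [n i z, x i z]"])
      (use \<phi>(2) in \<open>auto intro!: arec_intros D assms(3,4)\<close>)
qed

section \<open>Uniform computability and Galois theory of the levels\<close>

locale cohesive_galois = fully_computable_galois F K \<Psi> Ks \<Theta> \<Psi>s \<Phi> G res act
  for F K :: "nat ring" and \<Psi> :: "nat \<Rightarrow> nat"
    and Ks :: "nat \<Rightarrow> nat ring" and \<Theta> \<Psi>s \<Phi> :: "nat \<Rightarrow> nat \<Rightarrow> nat"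
    and G :: "nat \<Rightarrow> nat monoid" and res :: "nat \<Rightarrow> nat \<Rightarrow> nat \<Rightarrow> nat"
    and act :: "nat \<Rightarrow> nat \<Rightarrow> nat \<Rightarrow> nat" +
  fixes C :: "nat set"
  assumes coh: "cohesive C"
begin

abbreviation "ev P \<equiv> eventually P (almost_all C)"

lemma field_Ks: "field (Ks k)" and field_K: "field K" and field_F: "field F"
  using computable_Ks computable_K computable_F unfolding uniformly_computable_fields_def by blast+

lemma ring_Ks: "ring (Ks k)" and ring_F: "ring F" and ring_K: "ring K"
  using field_Ks field_F field_K by (auto intro: field.is_ring)

lemmas Ks_dec = adec_carrier[OF computable_Ks]

lemma group_G: "group (G k)"
  using computable_G unfolding uniformly_computable_finite_groups_def by blast

definition G_list :: "nat \<Rightarrow> nat list" where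
  "G_list = (SOME l. total_rec (\<lambda>k. list_encode (l k)) \<and> (\<forall>k. set (l k) = carrier (G k)))"

lemma G_list: "total_rec (\<lambda>k. list_encode (G_list k))" "set (G_list k) = carrier (G k)"
proof -
  obtain \<phi> where \<phi>: "partial_recursive \<phi>" "\<forall>i. \<exists>xs. \<phi> i = Some (list_encode xs) \<and> set xs = carrier (G i)"
    using computable_G unfolding uniformly_computable_finite_groups_def by blast
  then obtain l where l: "\<And>i. \<phi> i = Some (list_encode (l i))" "\<And>i. set (l i) = carrier (G i)" by metis
  have "\<phi> = (\<lambda>i. Some (list_encode (l i)))" using l(1) by (rule ext)
  then have "total_rec (\<lambda>k. list_encode (l k))" using \<phi>(1) by (simp add: total_rec_def)
  then have "\<exists>l. total_rec (\<lambda>k. list_encode (l k)) \<and> (\<forall>k. set (l k) = carrier (G k))" using l(2) by blast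
  from someI_ex[OF this, folded G_list_def] show "total_rec (\<lambda>k. list_encode (G_list k))" "set (G_list k) = carrier (G k)"
    by auto
qed

lemma alist_G: "arec U n \<Longrightarrow> alist U (\<lambda>i z. G_list (n i z))"
  unfolding alist_def by (rule arec_total[OF G_list(1)])

lemma adec_G: "arec U n \<Longrightarrow> arec U x \<Longrightarrow> adec U (\<lambda>i z. x i z \<in> carrier (G (n i z)))"
  unfolding G_list(2)[symmetric] by (intro adec_member alist_G)

lemma total_rec_G: "total_rec (\<lambda>z. of_bool (nsnd z \<in> carrier (G (nfst z))))"
  by (rule total_rec_of_arec, fold adec_def) (intro adec_G arec_intros)

lemma finite_G: "finite (carrier (G k))"
  unfolding G_list(2)[symmetric] by simp

definition act0 :: "nat \<Rightarrow> nat \<Rightarrow> nat \<Rightarrow> nat" where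
  "act0 k g x = (if g \<in> carrier (G k) \<and> x \<in> carrier (Ks k) then act k g x else 0)"

lemma arec_act0:
  assumes "arec U n" "arec U g" "arec U x"
  shows "arec U (\<lambda>i z. act0 (n i z) (g i z) (x i z))"
proof -
  obtain \<phi> where \<phi>: "partial_recursive \<phi>"
      "\<forall>i. \<forall>g\<in>carrier (G i). \<forall>x\<in>carrier (Ks i). \<phi> (list_encode [i, g, x]) = Some (act i g x)"
    using computable_act by blast
  show ?thesis unfolding act0_def
    by (rule arec_if_partial[OF \<phi>(1), where g = "\<lambda>i z. list_encode [n i z, g i z, x i z]"])
      (use \<phi>(2) in \<open>auto intro!: arec_intros adec_G Ks_dec assms\<close>)
qed

definition gmult0 :: "nat \<Rightarrow> nat \<Rightarrow> nat \<Rightarrow> nat" where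
  "gmult0 k x y = (if x \<in> carrier (G k) \<and> y \<in> carrier (G k) then x \<otimes>\<^bsub>G k\<^esub> y else 0)"

lemma arec_gmult0:
  assumes "arec U n" "arec U x" "arec U y"
  shows "arec U (\<lambda>i z. gmult0 (n i z) (x i z) (y i z))"
proof -
  obtain \<phi> where \<phi>: "partial_recursive \<phi>"
      "\<forall>i. \<forall>x\<in>carrier (G i). \<forall>y\<in>carrier (G i). \<phi> (list_encode [i, x, y]) = Some (x \<otimes>\<^bsub>G i\<^esub> y)"
    using computable_G unfolding uniformly_computable_finite_groups_def uniformly_computable_binops_def by blast
  show ?thesis unfolding gmult0_def
    by (rule arec_if_partial[OF \<phi>(1), where g = "\<lambda>i z. list_encode [n i z, x i z, y i z]"])
      (use \<phi>(2) in \<open>auto intro!: arec_intros adec_G assms\<close>)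
qed

definition res0 :: "nat \<Rightarrow> nat \<Rightarrow> nat \<Rightarrow> nat" where
  "res0 m n g = (if n < m \<and> g \<in> carrier (G m) then res m n g else 0)"

lemma arec_res0:
  assumes "arec U m" "arec U n" "arec U g"
  shows "arec U (\<lambda>i z. res0 (m i z) (n i z) (g i z))"
proof -
  obtain \<phi> where \<phi>: "partial_recursive \<phi>"
      "\<forall>m n. \<forall>g\<in>carrier (G m). n < m \<longrightarrow> \<phi> (list_encode [m, n, g]) = Some (res m n g)"
    using computable_res by blast
  show ?thesis unfolding res0_def
    by (rule arec_if_partial[OF \<phi>(1), where g = "\<lambda>i z. list_encode [m i z, n i z, g i z]"])
      (use \<phi>(2) in \<open>auto intro!: arec_intros adec_G assms\<close>)
qed

lemma galois_action: "galois_action (Ks k) (G k) (act k) (\<Theta> k ` carrier F)"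
proof -
  interpret K: field "Ks k" by (rule field_Ks)
  interpret G: group "G k" by (rule group_G)
  define h where "h = (\<lambda>g. \<lambda>x\<in>carrier (Ks k). act k g x)"
  let ?Gal = "galois_group (Ks k) (\<Theta> k ` carrier F)"
  have h_act: "h g x = act k g x" if "x \<in> carrier (Ks k)" for g x using that by (simp add: h_def)
  have h: "h \<in> hom (G k) ?Gal" "bij_betw h (carrier (G k)) (carrier ?Gal)"
    using G_galois[of k] by (auto simp: iso_def h_def)
  have hB: "h g \<in> Bij (carrier (Ks k))" "h g \<in> ring_hom (Ks k) (Ks k)" if "g \<in> carrier (G k)" for g
    using hom_in_carrier[OF h(1) that] by (auto simp: galois_group_def)
  have hom: "act k g \<in> ring_hom (Ks k) (Ks k)" if "g \<in> carrier (G k)" for g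
    by (rule ring_hom_cong[OF hB(2)[OF that] ring_Ks h_act])
  have mult: "act k (g \<otimes>\<^bsub>G k\<^esub> g') x = act k g (act k g' x)"
    if g: "g \<in> carrier (G k)" "g' \<in> carrier (G k)" and x: "x \<in> carrier (Ks k)" for g g' x
  proof -
    have "h (g \<otimes>\<^bsub>G k\<^esub> g') = compose (carrier (Ks k)) (h g) (h g')"
      using hom_mult[OF h(1) g] hB[OF g(1)] hB[OF g(2)] by (simp add: galois_group_def BijGroup_def)
    then have "h (g \<otimes>\<^bsub>G k\<^esub> g') x = compose (carrier (Ks k)) (h g) (h g') x" by simp
    then show ?thesis using x ring_hom_closed[OF hom[OF g(2)] x] by (simp add: compose_def h_act)
  qed
  \<comment> \<open>The identity of the group acts as an idempotent injective map, hence
    trivially.\<close>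
  have one: "act k \<one>\<^bsub>G k\<^esub> x = x" if x: "x \<in> carrier (Ks k)" for x
  proof -
    have inj: "inj_on (h \<one>\<^bsub>G k\<^esub>) (carrier (Ks k))"
      using hB(1)[OF G.one_closed] by (simp add: Bij_def bij_betw_def)
    note c = ring_hom_closed[OF hom[OF G.one_closed] x]
    have "h \<one>\<^bsub>G k\<^esub> (act k \<one>\<^bsub>G k\<^esub> x) = h \<one>\<^bsub>G k\<^esub> x"
      using mult[OF G.one_closed G.one_closed x] by (simp add: h_act x c)
    then show ?thesis by (rule inj_onD[OF inj _ c x])
  qed
  have faithful: "g = \<one>\<^bsub>G k\<^esub>" if g: "g \<in> carrier (G k)" and fx: "\<forall>x\<in>carrier (Ks k). act k g x = x" for g
  proof -
    have "h g = h \<one>\<^bsub>G k\<^esub>" unfolding h_def by (rule restrict_ext) (simp add: fx one)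
    then show ?thesis by (rule inj_onD[OF bij_betw_imp_inj_on[OF h(2)] _ g G.one_closed])
  qed
  have fixed: "x \<in> \<Theta> k ` carrier F" if x: "x \<in> carrier (Ks k)" and fx: "\<forall>g\<in>carrier (G k). act k g x = x" for x
  proof -
    have "\<sigma> x = x" if \<sigma>: "\<sigma> \<in> carrier ?Gal" for \<sigma>
    proof -
      obtain g where "g \<in> carrier (G k)" "\<sigma> = h g"
        using \<sigma> unfolding bij_betw_imp_surj_on[OF h(2), symmetric] by blast
      then show ?thesis using fx x by (simp add: h_act)
    qed
    then have "x \<in> {x \<in> carrier (Ks k). \<forall>\<sigma>\<in>carrier ?Gal. \<sigma> x = x}" using x by simp
    also have "\<dots> = \<Theta> k ` carrier F" using galois_Ks[of k] unfolding galois_extension_def by (elim conjE)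
    finally show ?thesis .
  qed
  show ?thesis
    by (intro galois_action.intro galois_action_axioms.intro field_Ks group_G finite_G)
      (erule (2) mult | erule hom | erule one | (rule faithful, assumption, blast) | (rule fixed, assumption, blast))+
qed

lemma act_fixes: "g \<in> carrier (G k) \<Longrightarrow> c \<in> carrier F \<Longrightarrow> act k g (\<Theta> k c) = \<Theta> k c"
proof -
  assume g: "g \<in> carrier (G k)" and c: "c \<in> carrier F"
  have "(\<lambda>g. \<lambda>x\<in>carrier (Ks k). act k g x) \<in> hom (G k) (galois_group (Ks k) (\<Theta> k ` carrier F))"
    using G_galois[of k] by (simp add: iso_def)
  from hom_in_carrier[OF this g]
  have "(\<lambda>x\<in>carrier (Ks k). act k g x) \<in> carrier (galois_group (Ks k) (\<Theta> k ` carrier F))" .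
  then have "(\<lambda>x\<in>carrier (Ks k). act k g x) (\<Theta> k c) = \<Theta> k c"
    using c by (auto simp: galois_group_def)
  then show ?thesis using ring_hom_closed[OF \<Theta>_hom c] by simp
qed

text \<open>By faithfulness each nontrivial group element moves some element of the field; the tuple
  collects one for each group element.\<close>

lemma free_tuple_exists: "\<exists>u. set u \<subseteq> carrier (Ks k) \<and>
    (\<forall>g\<in>carrier (G k). map (act k g) u = u \<longrightarrow> g = \<one>\<^bsub>G k\<^esub>)"
proof -
  interpret galois_action "Ks k" "G k" "act k" "\<Theta> k ` carrier F" by (rule galois_action)
  have "\<exists>x\<in>carrier (Ks k). act k g x = x \<longrightarrow> g = \<one>\<^bsub>G k\<^esub>" if "g \<in> carrier (G k)" for g
  proof (cases "\<forall>x\<in>carrier (Ks k). act k g x = x")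
    case True
    then show ?thesis using faithful[OF that] by (intro bexI[OF _ K.zero_closed]) auto
  qed auto
  then obtain x where x: "\<And>g. g \<in> carrier (G k) \<Longrightarrow> x g \<in> carrier (Ks k)"
      "\<And>g. g \<in> carrier (G k) \<Longrightarrow> act k g (x g) = x g \<Longrightarrow> g = \<one>\<^bsub>G k\<^esub>" by metis
  show ?thesis
  proof (intro exI[of _ "map x (G_list k)"] conjI ballI impI)
    show "set (map x (G_list k)) \<subseteq> carrier (Ks k)" using x(1) by (auto simp: G_list(2))
    fix g assume g: "g \<in> carrier (G k)" and "map (act k g) (map x (G_list k)) = map x (G_list k)"
    then have "act k g (x g) = x g" by (auto simp: G_list(2) map_eq_conv)
    then show "g = \<one>\<^bsub>G k\<^esub>" using x(2)[OF g] by simp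
  qed
qed

lemma level_extension:
  assumes N: "N \<in> hyper_nat C"
  shows "hyper_extension C Ks (val N) (reindex N Ks) F (reindex N \<Theta>) (\<lambda>i. guard (carrier F) (\<Theta> (val N i)))"
proof
  note v = hyper_nat_val[OF N]
  show "cohesive C" by (rule coh)
  show "computable_field F" by (rule computable_F)
  show "hyper_field C Ks (val N) (reindex N Ks)"
    unfolding hyper_field_def reindex_def using computable_Ks v by blast
  show "arec (almost_all C) (\<lambda>i. guard (carrier F) (\<Theta> (val N i)))"
    using arec_guard_map[OF computable_\<Theta> adec_carrier[OF computable_F arec_const[of _ 0]] v(1) arec_arg] by simp
  show "ev (\<lambda>i. guard (carrier F) (\<Theta> (val N i)) \<in> ring_hom F (Ks (val N i)))"
    by (intro always_eventually allI ring_hom_cong[OF \<Theta>_hom ring_F]) (simp add: guard_def)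
  show "ev (\<lambda>i. \<exists>e'. reindex N \<Theta> i = Some e' \<and> (\<forall>x\<in>carrier F. e' x = guard (carrier F) (\<Theta> (val N i)) x))"
    using v(4) by eventually_elim (simp add: reindex_def guard_def)
qed

lemma top_extension: "hyper_extension C (\<lambda>_. K) (\<lambda>_. 0) (\<lambda>_. Some K) F (\<lambda>_. Some \<Psi>) (\<lambda>_. guard (carrier F) \<Psi>)"
proof
  show "cohesive C" by (rule coh)
  show "computable_field F" by (rule computable_F)
  show "hyper_field C (\<lambda>_. K) (\<lambda>_. 0) (\<lambda>_. Some K)"
    unfolding hyper_field_def
    by (intro conjI computable_K arec_const exI[of _ "\<lambda>_. Some 0"] partial_recursive.zero) auto
  show "arec (almost_all C) (\<lambda>_. guard (carrier F) \<Psi>)"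
    using arec_guard_map[OF computable_\<Psi> adec_carrier[OF computable_F arec_const[of _ 0]] arec_const[of _ 0] arec_arg] by simp
  show "ev (\<lambda>i. guard (carrier F) \<Psi> \<in> ring_hom F K)"
    by (intro always_eventually allI ring_hom_cong[OF \<Psi>_hom ring_F]) (simp add: guard_def)
qed (simp add: guard_def)

section \<open>The cohesive product of the groups and its action on hyper-tuples\<close>

definition level_group :: "hyper \<Rightarrow> hyper monoid" where
  "level_group N = coh_prod_group C (reindex N G)"

lemma level_group_carrier:
  assumes N: "N \<in> hyper_nat C"
  shows "g \<in> carrier (level_group N) \<longleftrightarrow> g \<in> hyper_nat C \<and> ev (\<lambda>i. val g i \<in> carrier (G (val N i)))"
proof -
  note v = hyper_nat_val[OF N]
  have "(\<lambda>i. map_option carrier (reindex N G i)) = (\<lambda>i. map_option (\<lambda>k. carrier (G k)) (rep N i))"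
    by (auto simp: reindex_def option.map_comp comp_def)
  then show ?thesis
    unfolding level_group_def coh_prod_group_def
    using coh_prod_iff[OF v(3,4), of "\<lambda>k. carrier (G k)"] total_rec_G by simp
qed

lemma level_group_mult:
  assumes N: "N \<in> hyper_nat C" and g: "g \<in> carrier (level_group N)" and h: "h \<in> carrier (level_group N)"
  shows "g \<otimes>\<^bsub>level_group N\<^esub> h \<in> carrier (level_group N)"
    "ev (\<lambda>i. val (g \<otimes>\<^bsub>level_group N\<^esub> h) i = val g i \<otimes>\<^bsub>G (val N i)\<^esub> val h i)"
proof -
  have g': "g \<in> hyper_nat C" "ev (\<lambda>i. val g i \<in> carrier (G (val N i)))"
    and h': "h \<in> hyper_nat C" "ev (\<lambda>i. val h i \<in> carrier (G (val N i)))"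
    using g h by (simp_all add: level_group_carrier[OF N])
  note v = hyper_nat_val[OF N] and vg = hyper_nat_val[OF g'(1)] and vh = hyper_nat_val[OF h'(1)]
  let ?m = "\<lambda>i. gmult0 (val N i) (val g i) (val h i)"
  have r: "seq_rec C ?m" by (intro arec_gmult0 v vg vh)
  have eq: "ev (\<lambda>i. ?m i = val g i \<otimes>\<^bsub>G (val N i)\<^esub> val h i)"
    using g'(2) h'(2) by eventually_elim (simp add: gmult0_def)
  have "g \<otimes>\<^bsub>level_group N\<^esub> h = hclass C ?m"
    unfolding level_group_def coh_prod_group_def monoid.simps
    by (rule coh_class_eq_hclass) (use v(4) vg(4) vh(4) eq in eventually_elim, simp add: reindex_def)
  moreover have "ev (\<lambda>i. val (hclass C ?m) i \<in> carrier (G (val N i)))"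
    using val_hclass[OF r] eq g'(2) h'(2)
    by eventually_elim (simp add: group.is_monoid[OF group_G] monoid.m_closed)
  moreover have "ev (\<lambda>i. val (hclass C ?m) i = val g i \<otimes>\<^bsub>G (val N i)\<^esub> val h i)"
    using val_hclass[OF r] eq by eventually_elim simp
  ultimately show "g \<otimes>\<^bsub>level_group N\<^esub> h \<in> carrier (level_group N)"
    "ev (\<lambda>i. val (g \<otimes>\<^bsub>level_group N\<^esub> h) i = val g i \<otimes>\<^bsub>G (val N i)\<^esub> val h i)"
    using hclass_hyper_nat[OF r] by (simp_all add: level_group_carrier[OF N])
qed

definition level_act :: "hyper \<Rightarrow> hyper \<Rightarrow> hyper \<Rightarrow> hyper" where
  "level_act N g = (\<lambda>a\<in>coh_tuples C (reindex N Ks). pointwise C (\<lambda>i. act0 (val N i) (val g i)) a)"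

definition level_hauts :: "hyper \<Rightarrow> (hyper \<Rightarrow> hyper) monoid" where
  "level_hauts N = haut_group C (reindex N Ks) F (reindex N \<Theta>)"

context
  fixes N assumes N: "N \<in> hyper_nat C"
begin

interpretation L: hyper_extension C Ks "val N" "reindex N Ks" F "reindex N \<Theta>"
    "\<lambda>i. guard (carrier F) (\<Theta> (val N i))"
  by (rule level_extension[OF N])

lemma level_hauts_eq: "carrier (level_hauts N) = L.relative_hauts"
  by (simp add: level_hauts_def L.relative_hauts_def)

lemma act_arec: "g \<in> hyper_nat C \<Longrightarrow> arec (almost_all C) (\<lambda>i. act0 (val N i) (val g i))"
  using arec_act0[OF L.n_rec hyper_nat_val(1) arec_arg] by simp

lemma act0_hom:
  assumes "g \<in> carrier (G k)" shows "act0 k g \<in> ring_hom (Ks k) (Ks k)"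
  by (rule ring_hom_cong[OF galois_action.act_hom[OF galois_action assms] ring_Ks]) (simp add: act0_def assms)

lemma level_act_lval:
  assumes "g \<in> carrier (level_group N)" "a \<in> coh_tuples C (reindex N Ks)"
  shows "ev (\<lambda>i. lval (level_act N g a) i = map (act (val N i) (val g i)) (lval a i))"
proof -
  have g: "g \<in> hyper_nat C" "ev (\<lambda>i. val g i \<in> carrier (G (val N i)))"
    using assms(1) by (simp_all add: level_group_carrier[OF N])
  have a: "ev (\<lambda>i. set (lval a i) \<subseteq> carrier (Ks (val N i)))" using assms(2) by (simp add: L.T_iff)
  show ?thesis
    using pointwise_hyper_nat(2)[OF act_arec[OF g(1)] L.T_nat[OF assms(2)]] g(2) a
    by eventually_elim (use assms(2) in \<open>auto simp: level_act_def act0_def subset_iff\<close>)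
qed

lemma level_act_embedding:
  assumes "g \<in> carrier (level_group N)"
  shows "hyper_embedding C (reindex N Ks) (reindex N Ks) (level_act N g)"
proof -
  have g: "g \<in> hyper_nat C" "ev (\<lambda>i. val g i \<in> carrier (G (val N i)))"
    using assms(1) by (simp_all add: level_group_carrier[OF N])
  have "ev (\<lambda>i. act0 (val N i) (val g i) \<in> ring_hom (Ks (val N i)) (Ks (val N i)))"
    using g(2) by eventually_elim (rule act0_hom)
  from pointwise_embedding[OF L.L L.L act_arec[OF g(1)] this] show ?thesis
    by (rule hyper_embedding_cong[OF L.L]) (simp add: level_act_def)
qed

lemma level_act_haut:
  assumes g: "g \<in> carrier (level_group N)" shows "level_act N g \<in> carrier (level_hauts N)"
  unfolding level_hauts_eq L.relative_hauts_iff
proof (intro conjI ballI)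
  have gn: "g \<in> hyper_nat C" and gc: "ev (\<lambda>i. val g i \<in> carrier (G (val N i)))"
    using g by (simp_all add: level_group_carrier[OF N])
  note emb = level_act_embedding[OF g]
  show "level_act N g \<in> extensional L.T" by (simp add: level_act_def)
  show "hyper_embedding C (reindex N Ks) (reindex N Ks) (level_act N g)" by (rule emb)
  have clos: "level_act N g a \<in> L.T" if "a \<in> L.T" for a using emb that unfolding hyper_embedding_def by blast
  show "level_act N g ` L.T = L.T"
  proof (intro equalityI subsetI)
    fix b assume b: "b \<in> L.T"
    have bn: "b \<in> hyper_nat C" and bc: "ev (\<lambda>i. set (lval b i) \<subseteq> carrier (Ks (val N i)))"
      using b by (simp_all add: L.T_iff)
    \<comment> \<open>The preimage is found by search, which makes it recursive; applying the
      inverse group element at each index shows that the search succeeds.\<close>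
    let ?P = "\<lambda>i k. (\<forall>x\<in>set (list_decode k). x \<in> carrier (Ks (val N i))) \<and>
      map (act0 (val N i) (val g i)) (list_decode k) = lval b i"
    have dec: "adec (almost_all C) ?P"
      by (intro arec_intros Ks_dec L.n_rec arec_act0 hyper_nat_val(1)[OF gn] lval_rec[OF bn])
    have "ev (\<lambda>i. \<exists>k. ?P i k)"
      using bc gc
    proof eventually_elim
      case (elim i)
      interpret galois_action "Ks (val N i)" "G (val N i)" "act (val N i)" "\<Theta> (val N i) ` carrier F"
        by (rule galois_action)
      let ?a = "map (act (val N i) (inv\<^bsub>G (val N i)\<^esub> (val g i))) (lval b i)"
      have ac: "set ?a \<subseteq> carrier (Ks (val N i))" using elim act_closed by auto
      have "map (act0 (val N i) (val g i)) ?a = lval b i"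
        using elim ac act_inv_cancel[OF elim(2)] by (auto simp: act0_def subset_iff intro!: map_idI)
      then show ?case using ac by (intro exI[of _ "list_encode ?a"]) auto
    qed
    then obtain f where f: "seq_rec C f" "ev (\<lambda>i. ?P i (f i))" by (rule seq_search[OF dec])
    define a where "a = hlist C (\<lambda>i. list_decode (f i))"
    have ar: "seq_list C (\<lambda>i. list_decode (f i))" by (rule alist_decode[OF f(1)])
    have aT: "a \<in> L.T" unfolding a_def
      by (rule hlist_tuple[OF L.L ar]) (use f(2) in \<open>eventually_elim, auto\<close>)
    have "b = level_act N g a"
    proof (rule hyper_list_eqI[OF bn L.T_nat[OF clos[OF aT]]])
      show "ev (\<lambda>i. lval b i = lval (level_act N g a) i)"
        using pointwise_hyper_nat(2)[OF act_arec[OF gn] L.T_nat[OF aT]] f(2) lval_hlist[OF ar]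
        by eventually_elim (use aT in \<open>simp add: level_act_def a_def\<close>)
    qed
    then show "b \<in> level_act N g ` L.T" using aT by blast
  qed (use clos in auto)
  fix c assume c: "c \<in> coh_tuples C (\<lambda>_. Some F)"
  let ?p = "pointwise C (\<lambda>i. guard (carrier F) (\<Theta> (val N i)))"
  have cc: "ev (\<lambda>i. set (lval c i) \<subseteq> carrier F)" using c by (simp add: coh_tuples_iff[OF L.base_field])
  have cn: "c \<in> hyper_nat C" using c by (rule coh_tuples_hyper_nat[OF L.base_field])
  have pT: "?p c \<in> L.T"
    using pointwise_embedding[OF L.base_field L.L L.e L.e_hom] c unfolding hyper_embedding_def by blast
  show "level_act N g (?p c) = ?p c"
  proof (rule hyper_list_eqI[OF L.T_nat[OF clos[OF pT]] L.T_nat[OF pT]])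
    show "ev (\<lambda>i. lval (level_act N g (?p c)) i = lval (?p c) i)"
      using level_act_lval[OF g pT] pointwise_hyper_nat(2)[OF L.e cn] cc gc
      by eventually_elim (auto simp: guard_def act_fixes subset_iff)
  qed
qed

lemma level_act_mult:
  assumes g: "g \<in> carrier (level_group N)" and h: "h \<in> carrier (level_group N)"
  shows "level_act N (g \<otimes>\<^bsub>level_group N\<^esub> h) = level_act N g \<otimes>\<^bsub>level_hauts N\<^esub> level_act N h"
proof -
  note gh = level_group_mult[OF N g h]
  have clos: "level_act N g a \<in> L.T" if "g \<in> carrier (level_group N)" "a \<in> L.T" for g a
    using level_act_embedding[OF that(1)] that(2) unfolding hyper_embedding_def by blast
  have "level_act N (g \<otimes>\<^bsub>level_group N\<^esub> h) a = level_act N g (level_act N h a)" if a: "a \<in> L.T" for a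
  proof (rule hyper_list_eqI[OF L.T_nat[OF clos[OF gh(1) a]] L.T_nat[OF clos[OF g clos[OF h a]]]])
    have "ev (\<lambda>i. val g i \<in> carrier (G (val N i)))" "ev (\<lambda>i. val h i \<in> carrier (G (val N i)))"
        "ev (\<lambda>i. set (lval a i) \<subseteq> carrier (Ks (val N i)))"
      using g h a by (simp_all add: level_group_carrier[OF N] L.T_iff)
    then show "ev (\<lambda>i. lval (level_act N (g \<otimes>\<^bsub>level_group N\<^esub> h) a) i = lval (level_act N g (level_act N h a)) i)"
      using level_act_lval[OF gh(1) a] gh(2) level_act_lval[OF g clos[OF h a]] level_act_lval[OF h a]
      by eventually_elim (auto simp: galois_action.act_mult[OF galois_action] subset_iff)
  qed
  moreover have "level_act N g \<in> Bij L.T" "level_act N h \<in> Bij L.T"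
    using level_act_haut[OF g] level_act_haut[OF h]
    by (simp_all add: level_hauts_def haut_group_def field_hauts_def tree_hauts_def)
  ultimately show ?thesis
    by (auto simp: level_hauts_def haut_group_def BijGroup_def compose_def fun_eq_iff level_act_def[of N "g \<otimes>\<^bsub>level_group N\<^esub> h"])
qed

lemma free_sequence:
  obtains u where "u \<in> L.T"
    "ev (\<lambda>i. \<forall>g\<in>carrier (G (val N i)). map (act (val N i) g) (lval u i) = lval u i \<longrightarrow> g = \<one>\<^bsub>G (val N i)\<^esub>)"
proof -
  \<comment> \<open>Freeness is expressed by comparing pairs of group elements, which mentions no
    unit and is decidable from the list of elements. Taking one of the pair to be the unit gives
    back the trivial stabiliser.\<close>
  let ?free = "\<lambda>k u. \<forall>g\<in>set (G_list k). \<forall>h\<in>set (G_list k). map (act0 k g) u = map (act0 k h) u \<longrightarrow> g = h"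
  let ?P = "\<lambda>i z. (\<forall>x\<in>set (list_decode z). x \<in> carrier (Ks (val N i))) \<and> ?free (val N i) (list_decode z)"
  have dec: "adec (almost_all C) ?P"
    by (intro arec_intros Ks_dec L.n_rec arec_act0 alist_G)
  have m0: "map (act0 k g) u = map (act k g) u" if "g \<in> carrier (G k)" "set u \<subseteq> carrier (Ks k)" for k g u
    using that by (auto simp: act0_def)
  have ex: "\<exists>z. ?P i z" for i
  proof -
    interpret galois_action "Ks (val N i)" "G (val N i)" "act (val N i)" "\<Theta> (val N i) ` carrier F"
      by (rule galois_action)
    obtain u where u: "set u \<subseteq> carrier (Ks (val N i))"
        "\<forall>g\<in>carrier (G (val N i)). map (act (val N i) g) u = u \<longrightarrow> g = \<one>\<^bsub>G (val N i)\<^esub>"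
      using free_tuple_exists by blast
    have "g = h" if "g \<in> carrier (G (val N i))" "h \<in> carrier (G (val N i))"
      "map (act (val N i) g) u = map (act (val N i) h) u" for g h
      using eq_of_free[OF _ that u(1)] u(2) by blast
    then show ?thesis using u(1) m0[OF _ u(1)]
      by (intro exI[of _ "list_encode u"]) (auto simp: G_list(2) subset_iff)
  qed
  obtain f where f: "seq_rec C f" "ev (\<lambda>i. ?P i (f i))"
    by (rule seq_search[OF dec]) (use ex in auto)
  have r: "seq_list C (\<lambda>i. list_decode (f i))" by (rule alist_decode[OF f(1)])
  let ?u = "hlist C (\<lambda>i. list_decode (f i))"
  have uT: "?u \<in> L.T"
    by (rule hlist_tuple[OF L.L r]) (use f(2) in \<open>eventually_elim, auto\<close>)
  have "ev (\<lambda>i. \<forall>g\<in>carrier (G (val N i)). map (act (val N i) g) (lval ?u i) = lval ?u i \<longrightarrow> g = \<one>\<^bsub>G (val N i)\<^esub>)"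
    using f(2) lval_hlist[OF r]
  proof eventually_elim
    case (elim i)
    interpret galois_action "Ks (val N i)" "G (val N i)" "act (val N i)" "\<Theta> (val N i) ` carrier F"
      by (rule galois_action)
    let ?d = "list_decode (f i)"
    have dc: "set ?d \<subseteq> carrier (Ks (val N i))" using elim(1) by auto
    have fr: "g = h" if "g \<in> carrier (G (val N i))" "h \<in> carrier (G (val N i))"
        "map (act (val N i) g) ?d = map (act (val N i) h) ?d" for g h
      using elim(1) that m0[OF _ dc] by (auto simp: G_list(2))
    have "map (act (val N i) \<one>\<^bsub>G (val N i)\<^esub>) ?d = ?d" using dc act_one by (auto intro!: map_idI)
    then show ?case using fr[OF _ G.one_closed] elim(2) by simp
  qed
  with uT show thesis by (rule that)
qed

text \<open>Outside the orbit the pair (1, 0) would be generated from the entries of the tuple and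
  its image, contradicting that generated pairs vanish simultaneously.\<close>

lemma haut_orbit:
  assumes \<sigma>: "\<sigma> \<in> carrier (level_hauts N)" and a: "a \<in> L.T"
    and free: "ev (\<lambda>i. \<forall>g\<in>carrier (G (val N i)). map (act (val N i) g) (lval a i) = lval a i \<longrightarrow> g = \<one>\<^bsub>G (val N i)\<^esub>)"
  shows "ev (\<lambda>i. \<exists>g\<in>carrier (G (val N i)). lval (\<sigma> a) i = map (act (val N i) g) (lval a i))"
proof -
  have \<sigma>': "\<sigma> \<in> L.relative_hauts" using \<sigma> by (simp add: level_hauts_eq)
  show ?thesis
    using free L.gen_pairs_transfer[OF \<sigma>' a] L.A_B_wf[OF \<sigma>' a]
  proof eventually_elim
    case (elim i)
    interpret galois_action "Ks (val N i)" "G (val N i)" "act (val N i)" "\<Theta> (val N i) ` carrier F"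
      by (rule galois_action)
    have im: "guard (carrier F) (\<Theta> (val N i)) ` carrier F = \<Theta> (val N i) ` carrier F" by (auto simp: guard_def)
    show ?case
    proof (rule ccontr)
      assume "\<not> ?thesis"
      then have "(\<one>\<^bsub>Ks (val N i)\<^esub>, \<zero>\<^bsub>Ks (val N i)\<^esub>) \<in> gen_pairs (Ks (val N i)) (\<Theta> (val N i) ` carrier F)
          (set (zip (lval a i) (lval (\<sigma> a) i)))"
        using elim by (intro one_zero_in_gen_pairs) auto
      then have "\<one>\<^bsub>Ks (val N i)\<^esub> = \<zero>\<^bsub>Ks (val N i)\<^esub>" using elim(2) unfolding im by blast
      then show False using K.one_not_zero by simp
    qed
  qed
qed

lemma level_act_bij: "bij_betw (level_act N) (carrier (level_group N)) (carrier (level_hauts N))"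
  unfolding bij_betw_def
proof
  obtain u where u: "u \<in> L.T"
    "ev (\<lambda>i. \<forall>g\<in>carrier (G (val N i)). map (act (val N i) g) (lval u i) = lval u i \<longrightarrow> g = \<one>\<^bsub>G (val N i)\<^esub>)"
    by (rule free_sequence)
  have uc: "ev (\<lambda>i. set (lval u i) \<subseteq> carrier (Ks (val N i)))" using u(1) by (simp add: L.T_iff)
  have free: "g = h" if "\<forall>g\<in>carrier (G k). map (act k g) u = u \<longrightarrow> g = \<one>\<^bsub>G k\<^esub>"
      "g \<in> carrier (G k)" "h \<in> carrier (G k)" "map (act k g) u = map (act k h) u" "set u \<subseteq> carrier (Ks k)" for k g h u
    using galois_action.eq_of_free[OF galois_action _ that(2-5)] that(1) by blast
  show "inj_on (level_act N) (carrier (level_group N))"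
  proof (rule inj_onI)
    fix g h assume gh: "g \<in> carrier (level_group N)" "h \<in> carrier (level_group N)" "level_act N g = level_act N h"
    then have c: "g \<in> hyper_nat C" "h \<in> hyper_nat C" "ev (\<lambda>i. val g i \<in> carrier (G (val N i)))"
      "ev (\<lambda>i. val h i \<in> carrier (G (val N i)))"
      by (simp_all add: level_group_carrier[OF N])
    have "ev (\<lambda>i. val g i = val h i)"
      using level_act_lval[OF gh(1) u(1)] level_act_lval[OF gh(2) u(1)] c(3,4) u(2) uc
    proof eventually_elim
      case (elim i)
      show ?case by (rule free[OF elim(5) elim(3,4) _ elim(6)]) (use elim(1,2) gh(3) in simp)
    qed
    then show "g = h" by (rule hyper_eqI[OF c(1,2)])
  qed
  show "level_act N ` carrier (level_group N) = carrier (level_hauts N)"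
  proof (intro equalityI subsetI)
    fix \<sigma> assume \<sigma>: "\<sigma> \<in> carrier (level_hauts N)"
    have \<sigma>': "\<sigma> \<in> L.relative_hauts" using \<sigma> by (simp add: level_hauts_eq)
    note \<sigma>T = L.\<sigma>_T[OF \<sigma>']
    let ?P = "\<lambda>i g. g \<in> carrier (G (val N i)) \<and> lval (\<sigma> u) i = map (act0 (val N i) g) (lval u i)"
    have "adec (almost_all C) ?P"
      by (intro arec_intros adec_G L.n_rec lval_rec L.T_nat \<sigma>T u(1) arec_act0)
    moreover have "ev (\<lambda>i. \<exists>g. ?P i g)"
      using haut_orbit[OF \<sigma> u] uc
    proof eventually_elim
      case (elim i)
      then obtain g where "g \<in> carrier (G (val N i))" "lval (\<sigma> u) i = map (act (val N i) g) (lval u i)" by blast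
      then show ?case using elim(2) by (intro exI[of _ g]) (auto simp: act0_def subset_iff)
    qed
    ultimately obtain f where f: "seq_rec C f" "ev (\<lambda>i. ?P i (f i))" by (rule seq_search)
    define g where "g = hclass C f"
    have gn: "g \<in> hyper_nat C" unfolding g_def by (rule hclass_hyper_nat[OF f(1)])
    have gP: "ev (\<lambda>i. ?P i (val g i))"
      using f(2) val_hclass[OF f(1)] by eventually_elim (simp add: g_def)
    have g: "g \<in> carrier (level_group N)"
      using gn gP by (auto simp: level_group_carrier[OF N] elim: eventually_mono)
    have "\<sigma> a = level_act N g a" if a: "a \<in> L.T" for a
    proof (rule hyper_list_eqI[OF L.T_nat[OF \<sigma>T[OF a]]])
      show "level_act N g a \<in> hyper_nat C"
        using level_act_embedding[OF g] a L.T_nat unfolding hyper_embedding_def by blast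
      \<comment> \<open>With the free tuple \<open>u\<close> in front, \<open>?b\<close> has trivial
        stabiliser as well, so at each index some \<open>h\<close> moves it to its image. On the
        part \<open>u\<close> this \<open>h\<close> agrees with \<open>g\<close>, hence
        \<open>h\<close> is the value of \<open>g\<close>, and the part \<open>a\<close> is moved by
        it too.\<close>
      let ?b = "hyper_append C u a"
      have bT: "?b \<in> L.T" by (rule hyper_append_tuple[OF L.L u(1) a])
      note lb = lval_append[OF L.T_nat[OF u(1)] L.T_nat[OF a]]
      have "ev (\<lambda>i. \<forall>g\<in>carrier (G (val N i)). map (act (val N i) g) (lval ?b i) = lval ?b i \<longrightarrow> g = \<one>\<^bsub>G (val N i)\<^esub>)"
        using u(2) lb by eventually_elim simp
      note orb = haut_orbit[OF \<sigma> bT this]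
      have \<sigma>b: "ev (\<lambda>i. lval (\<sigma> ?b) i = lval (\<sigma> u) i @ lval (\<sigma> a) i)"
        unfolding L.\<sigma>_append[OF \<sigma>' u(1) a]
        by (rule lval_append[OF L.T_nat[OF \<sigma>T[OF u(1)]] L.T_nat[OF \<sigma>T[OF a]]])
      show "ev (\<lambda>i. lval (\<sigma> a) i = lval (level_act N g a) i)"
        using orb \<sigma>b lb gP level_act_lval[OF g a] u(2) uc L.\<sigma>_length[OF \<sigma>' u(1)]
      proof eventually_elim
        case (elim i)
        obtain h where h: "h \<in> carrier (G (val N i))" "lval (\<sigma> ?b) i = map (act (val N i) h) (lval ?b i)"
          using elim(1) by blast
        have "lval (\<sigma> u) i @ lval (\<sigma> a) i = map (act (val N i) h) (lval u i) @ map (act (val N i) h) (lval a i)"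
          using h(2) elim(2,3) by simp
        then have 1: "lval (\<sigma> u) i = map (act (val N i) h) (lval u i)" "lval (\<sigma> a) i = map (act (val N i) h) (lval a i)"
          using elim(8) by auto
        have "map (act0 (val N i) (val g i)) (lval u i) = map (act (val N i) (val g i)) (lval u i)"
          using elim(4,7) by (auto simp: act0_def)
        then have "map (act (val N i) (val g i)) (lval u i) = map (act (val N i) h) (lval u i)"
          using 1(1) elim(4) by simp
        then have "val g i = h" using elim(4) by (intro free[OF elim(6) _ h(1) _ elim(7)]) auto
        then show ?case using 1(2) elim(5) by simp
      qed
    qed
    then have "\<sigma> = level_act N g"
      using \<sigma>' level_act_haut[OF g] unfolding level_hauts_eq L.relative_hauts_iff
      by (auto intro: extensionalityI)
    then show "\<sigma> \<in> level_act N ` carrier (level_group N)" using g by blast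
  qed (use level_act_haut in auto)
qed

end

end

section \<open>Transition maps and the embeddings into the top level\<close>

context cohesive_galois
begin

lemma tower_map_refl: "tower_map \<Phi> n n x = x"
  by (simp add: tower_map_def)

lemma tower_map_Suc: "n \<le> m \<Longrightarrow> tower_map \<Phi> n (Suc m) x = \<Phi> m (tower_map \<Phi> n m x)"
  by (simp add: tower_map_def)

lemma tower_map_hom: "n \<le> m \<Longrightarrow> tower_map \<Phi> n m \<in> ring_hom (Ks n) (Ks m)"
proof (induction m rule: dec_induct)
  case base
  show ?case by (rule ring_hom_memI) (auto simp: tower_map_refl)
next
  case (step m)
  have "\<Phi> m \<circ> tower_map \<Phi> n m \<in> ring_hom (Ks n) (Ks (Suc m))"
    by (rule ring_hom_trans[OF step.IH \<Phi>_hom])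
  then show ?case
    by (rule ring_hom_cong[OF _ ring_Ks]) (simp add: tower_map_Suc step.hyps(1))
qed

lemma \<Psi>s_tower_map: "n \<le> m \<Longrightarrow> x \<in> carrier (Ks n) \<Longrightarrow> \<Psi>s m (tower_map \<Phi> n m x) = \<Psi>s n x"
proof (induction m rule: dec_induct)
  case (step m)
  then show ?case
    using \<Psi>s_\<Phi>[OF ring_hom_closed[OF tower_map_hom[OF step.hyps(1)] step.prems]]
    by (simp add: tower_map_Suc)
qed (simp add: tower_map_refl)

text \<open>\<open>tower_map\<close> as a primitive recursion on the difference of levels, with
  guarded steps, so that it is recursive in both levels and in the element.\<close>

definition tower0 :: "nat \<Rightarrow> nat \<Rightarrow> nat \<Rightarrow> nat" where
  "tower0 n m x = rec_nat x (\<lambda>j r. guard (carrier (Ks (n + j))) (\<Phi> (n + j)) r) (m - n)"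

lemma tower0_eq:
  assumes "n \<le> m" "x \<in> carrier (Ks n)" shows "tower0 n m x = tower_map \<Phi> n m x"
proof -
  have "rec_nat x (\<lambda>j r. guard (carrier (Ks (n + j))) (\<Phi> (n + j)) r) k = tower_map \<Phi> n (n + k) x" for k
    using ring_hom_closed[OF tower_map_hom assms(2)]
    by (induction k) (simp_all add: tower_map_refl tower_map_Suc guard_def)
  from this[of "m - n"] show ?thesis using assms(1) by (simp add: tower0_def)
qed

lemma arec_tower0:
  assumes "arec U n" "arec U m" "arec U x"
  shows "arec U (\<lambda>i z. tower0 (n i z) (m i z) (x i z))"
  unfolding tower0_def
  by (intro arec_rec arec_intros arec_guard_map[OF computable_\<Phi> Ks_dec] assms arec_comp[OF assms(1)])

lemma hyper_less_iff:
  assumes "N \<in> hyper_nat C" "M \<in> hyper_nat C"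
  shows "hyper_less C N M \<longleftrightarrow> ev (\<lambda>i. val N i < val M i)"
proof -
  have "ev (\<lambda>i. \<exists>n m. rep N i = Some n \<and> rep M i = Some m \<and> n < m) \<longleftrightarrow> ev (\<lambda>i. val N i < val M i)"
    by (rule eventually_cong[OF eventually_conj[OF hyper_nat_val(4)[OF assms(1)] hyper_nat_val(4)[OF assms(2)]]])
      auto
  then show ?thesis by (simp add: hyper_less_def eventually_almost_all)
qed

abbreviation "TN N \<equiv> coh_tuples C (reindex N Ks)"

lemma level_field: "N \<in> hyper_nat C \<Longrightarrow> hyper_field C Ks (val N) (reindex N Ks)"
  using level_extension unfolding hyper_extension_def by blast

lemma top_field: "hyper_field C (\<lambda>_. K) (\<lambda>_. 0) (\<lambda>_. Some K)"
  using top_extension unfolding hyper_extension_def by blast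

lemma TN_iff: "N \<in> hyper_nat C \<Longrightarrow> a \<in> TN N \<longleftrightarrow> a \<in> hyper_nat C \<and> ev (\<lambda>i. set (lval a i) \<subseteq> carrier (Ks (val N i)))"
  by (rule coh_tuples_iff[OF level_field])

context
  fixes N M assumes N: "N \<in> hyper_nat C" and M: "M \<in> hyper_nat C" and less: "hyper_less C N M"
begin

lemma val_less: "ev (\<lambda>i. val N i < val M i)"
  using less by (simp add: hyper_less_iff N M)

lemma tower0_seq: "arec (almost_all C) (\<lambda>i. tower0 (val N i) (val M i))"
  using arec_tower0[OF hyper_nat_val(1)[OF N] hyper_nat_val(1)[OF M] arec_arg] by simp

lemma coh_incl_eq: "a \<in> TN N \<Longrightarrow> coh_incl C \<Phi> N M a = pointwise C (\<lambda>i. tower0 (val N i) (val M i)) a"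
  unfolding coh_incl_def
proof (rule hyper_map_eq_pointwise[OF level_field[OF N]])
  show "ev (\<lambda>i. \<exists>e'. Option.bind (rep N i) (\<lambda>n. Option.bind (rep M i) (\<lambda>m. Some (tower_map \<Phi> n m))) = Some e' \<and>
      (\<forall>x\<in>carrier (Ks (val N i)). e' x = tower0 (val N i) (val M i) x))"
    using hyper_nat_val(4)[OF N] hyper_nat_val(4)[OF M] val_less
    by eventually_elim (simp add: tower0_eq)
qed

lemma coh_incl_embedding: "hyper_embedding C (reindex N Ks) (reindex M Ks) (coh_incl C \<Phi> N M)"
proof (rule hyper_embedding_cong[OF level_field[OF N] pointwise_embedding[OF level_field[OF N] level_field[OF M] tower0_seq]])
  show "ev (\<lambda>i. tower0 (val N i) (val M i) \<in> ring_hom (Ks (val N i)) (Ks (val M i)))"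
    using val_less
  proof eventually_elim
    case (elim i)
    then show ?case
      by (intro ring_hom_cong[OF tower_map_hom ring_Ks]) (simp_all add: tower0_eq)
  qed
qed (rule coh_incl_eq)

lemma coh_incl_lval:
  assumes "a \<in> TN N"
  shows "ev (\<lambda>i. lval (coh_incl C \<Phi> N M a) i = map (tower_map \<Phi> (val N i) (val M i)) (lval a i))"
proof -
  have a: "a \<in> hyper_nat C" "ev (\<lambda>i. set (lval a i) \<subseteq> carrier (Ks (val N i)))"
    using assms by (simp_all add: TN_iff[OF N])
  show ?thesis
    unfolding coh_incl_eq[OF assms]
    using pointwise_hyper_nat(2)[OF tower0_seq a(1)] a(2) val_less
    by eventually_elim (auto simp: tower0_eq subset_iff)
qed

lemma coh_incl_closed: "a \<in> TN N \<Longrightarrow> coh_incl C \<Phi> N M a \<in> TN M"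
  using coh_incl_embedding unfolding hyper_embedding_def by blast

lemma coh_incl_inj: "inj_on (coh_incl C \<Phi> N M) (TN N)"
  by (rule hyper_embedding_inj[OF level_field[OF N] level_field[OF M] coh_incl_embedding])

lemma coh_res_closed:
  assumes g: "g \<in> carrier (level_group M)"
  shows "coh_res C res M N g \<in> carrier (level_group N)"
    "ev (\<lambda>i. val (coh_res C res M N g) i = res (val M i) (val N i) (val g i))"
proof -
  have g': "g \<in> hyper_nat C" "ev (\<lambda>i. val g i \<in> carrier (G (val M i)))"
    using g by (simp_all add: level_group_carrier[OF M])
  let ?r = "\<lambda>i. res0 (val M i) (val N i) (val g i)"
  have r: "seq_rec C ?r" by (intro arec_res0 hyper_nat_val(1) N M g'(1))
  have eq: "ev (\<lambda>i. ?r i = res (val M i) (val N i) (val g i))"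
    using val_less g'(2) by eventually_elim (simp add: res0_def)
  have *: "coh_res C res M N g = hclass C ?r"
    unfolding coh_res_def
    by (rule coh_class_eq_hclass)
      (use hyper_nat_val(4)[OF N] hyper_nat_val(4)[OF M] hyper_nat_val(4)[OF g'(1)] eq in \<open>eventually_elim, simp\<close>)
  show 1: "ev (\<lambda>i. val (coh_res C res M N g) i = res (val M i) (val N i) (val g i))"
    unfolding * using val_hclass[OF r] eq by eventually_elim simp
  have "ev (\<lambda>i. val (coh_res C res M N g) i \<in> carrier (G (val N i)))"
    using 1 val_less g'(2) by eventually_elim (auto intro: hom_in_carrier[OF res_hom])
  then show "coh_res C res M N g \<in> carrier (level_group N)"
    using hclass_hyper_nat[OF r] by (simp add: level_group_carrier[OF N] *)
qed

text \<open>At each index this is \<open>res_restrict\<close>, the defining property of the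
  restriction maps of the groups.\<close>

lemma level_act_incl:
  assumes g: "g \<in> carrier (level_group M)" and a: "a \<in> TN N"
  shows "level_act M g (coh_incl C \<Phi> N M a) = coh_incl C \<Phi> N M (level_act N (coh_res C res M N g) a)"
proof -
  note r = coh_res_closed[OF g]
  have clos: "level_act N (coh_res C res M N g) a \<in> TN N"
    using level_act_embedding[OF N r(1)] a unfolding hyper_embedding_def by blast
  have clos': "level_act M g (coh_incl C \<Phi> N M a) \<in> TN M"
    using level_act_embedding[OF M g] coh_incl_closed[OF a] unfolding hyper_embedding_def by blast
  show ?thesis
  proof (rule hyper_list_eqI)
    show "level_act M g (coh_incl C \<Phi> N M a) \<in> hyper_nat C"
      "coh_incl C \<Phi> N M (level_act N (coh_res C res M N g) a) \<in> hyper_nat C"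
      using clos' coh_incl_closed[OF clos] by (simp_all add: TN_iff[OF M])
    have "ev (\<lambda>i. val g i \<in> carrier (G (val M i)))" "ev (\<lambda>i. set (lval a i) \<subseteq> carrier (Ks (val N i)))"
      using g a by (simp_all add: level_group_carrier[OF M] TN_iff[OF N])
    then show "ev (\<lambda>i. lval (level_act M g (coh_incl C \<Phi> N M a)) i =
        lval (coh_incl C \<Phi> N M (level_act N (coh_res C res M N g) a)) i)"
      using level_act_lval[OF M g coh_incl_closed[OF a]] coh_incl_lval[OF a] coh_incl_lval[OF clos]
        level_act_lval[OF N r(1) a] r(2) val_less
      by eventually_elim (auto simp: res_restrict subset_iff)
  qed
qed

lemma haut_restrict_level_act:
  assumes g: "g \<in> carrier (level_group M)"
  shows "haut_restrict C Ks \<Phi> M N (level_act M g) = level_act N (coh_res C res M N g)"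
proof
  fix a
  show "haut_restrict C Ks \<Phi> M N (level_act M g) a = level_act N (coh_res C res M N g) a"
  proof (cases "a \<in> TN N")
    case True
    have "level_act N (coh_res C res M N g) a \<in> TN N"
      using level_act_embedding[OF N coh_res_closed(1)[OF g]] True unfolding hyper_embedding_def by blast
    then show ?thesis
      using True by (simp add: haut_restrict_def level_act_incl[OF g True] the_inv_into_f_f[OF coh_incl_inj])
  next
    case False
    then show ?thesis by (simp add: haut_restrict_def level_act_def)
  qed
qed

text \<open>In particular \<open>\<tau>\<close> preserves the image of the inclusion, so \<^const>\<open>the_inv_into\<close> is not applied outside its range.\<close>

lemma level_haut_incl:
  assumes \<tau>: "\<tau> \<in> carrier (level_hauts M)" and a: "a \<in> TN N"
  shows "\<tau> (coh_incl C \<Phi> N M a) = coh_incl C \<Phi> N M (haut_restrict C Ks \<Phi> M N \<tau> a)"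
proof -
  obtain g where "g \<in> carrier (level_group M)" "\<tau> = level_act M g"
    using \<tau> level_act_bij[OF M] unfolding bij_betw_def by blast
  then show ?thesis using level_act_incl a haut_restrict_level_act by simp
qed

end

theorem level_limits_iso:
  "inverse_limit (hyper_nat C) (hyper_less C) level_hauts (haut_restrict C Ks \<Phi>) \<cong>
   inverse_limit (hyper_nat C) (hyper_less C) level_group (coh_res C res)"
  by (rule inverse_limit_iso[where \<phi> = level_act])
    (use level_act_bij level_group_mult level_act_mult coh_res_closed haut_restrict_level_act in auto)

section \<open>The embeddings of the levels into the top\<close>

definition top_embed :: "hyper \<Rightarrow> hyper \<Rightarrow> hyper" where
  "top_embed N = pointwise C (\<lambda>i. guard (carrier (Ks (val N i))) (\<Psi>s (val N i)))"

abbreviation "TK \<equiv> coh_tuples C (\<lambda>_. Some K)"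

lemma TK_iff: "a \<in> TK \<longleftrightarrow> a \<in> hyper_nat C \<and> ev (\<lambda>i. set (lval a i) \<subseteq> carrier K)"
  using coh_tuples_iff[OF top_field] .

lemma arec_\<Psi>s: "arec U n \<Longrightarrow> arec U x \<Longrightarrow> arec U (\<lambda>i z. guard (carrier (Ks (n i z))) (\<Psi>s (n i z)) (x i z))"
  by (rule arec_guard_map[OF computable_\<Psi>s Ks_dec])

context
  fixes N assumes N: "N \<in> hyper_nat C"
begin

lemma \<Psi>s_seq: "arec (almost_all C) (\<lambda>i. guard (carrier (Ks (val N i))) (\<Psi>s (val N i)))"
  using arec_\<Psi>s[OF hyper_nat_val(1)[OF N] arec_arg] by simp

lemma top_embed_embedding: "hyper_embedding C (reindex N Ks) (\<lambda>_. Some K) (top_embed N)"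
  unfolding top_embed_def
  by (rule pointwise_embedding[OF level_field[OF N] top_field \<Psi>s_seq])
    (intro always_eventually allI ring_hom_cong[OF \<Psi>s_hom ring_Ks], simp add: guard_def)

lemma top_embed_closed: "a \<in> TN N \<Longrightarrow> top_embed N a \<in> TK"
  using top_embed_embedding unfolding hyper_embedding_def by blast

lemma top_embed_inj: "inj_on (top_embed N) (TN N)"
  by (rule hyper_embedding_inj[OF level_field[OF N] top_field top_embed_embedding])

lemma top_embed_lval:
  assumes "a \<in> TN N" shows "ev (\<lambda>i. lval (top_embed N a) i = map (\<Psi>s (val N i)) (lval a i))"
proof -
  have a: "a \<in> hyper_nat C" "ev (\<lambda>i. set (lval a i) \<subseteq> carrier (Ks (val N i)))"
    using assms by (simp_all add: TN_iff[OF N])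
  show ?thesis
    unfolding top_embed_def using pointwise_hyper_nat(2)[OF \<Psi>s_seq a(1)] a(2)
    by eventually_elim (auto simp: guard_def subset_iff)
qed

text \<open>Preimages existing at each index separately can be found by search, so together they
  form a hyper-tuple of the level.\<close>

lemma top_embed_onto:
  assumes b: "b \<in> TK" and ex: "ev (\<lambda>i. \<forall>y\<in>set (lval b i). \<exists>x\<in>carrier (Ks (val N i)). \<Psi>s (val N i) x = y)"
  shows "b \<in> top_embed N ` TN N"
proof -
  have bn: "b \<in> hyper_nat C" using b by (simp add: TK_iff)
  let ?P = "\<lambda>i k. (\<forall>x\<in>set (list_decode k). x \<in> carrier (Ks (val N i))) \<and>
    map (guard (carrier (Ks (val N i))) (\<Psi>s (val N i))) (list_decode k) = lval b i"
  have dec: "adec (almost_all C) ?P"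
    by (intro arec_intros Ks_dec arec_\<Psi>s hyper_nat_val(1)[OF N] lval_rec[OF bn])
  have "ev (\<lambda>i. \<exists>k. ?P i k)"
    using ex
  proof eventually_elim
    case (elim i)
    then obtain f where f: "\<forall>y\<in>set (lval b i). f y \<in> carrier (Ks (val N i)) \<and> \<Psi>s (val N i) (f y) = y" by metis
    show ?case
      by (intro exI[of _ "list_encode (map f (lval b i))"]) (use f in \<open>auto simp: guard_def intro!: map_idI\<close>)
  qed
  then obtain f where f: "seq_rec C f" "ev (\<lambda>i. ?P i (f i))" by (rule seq_search[OF dec])
  have r: "seq_list C (\<lambda>i. list_decode (f i))" by (rule alist_decode[OF f(1)])
  let ?a = "hlist C (\<lambda>i. list_decode (f i))"
  have aT: "?a \<in> TN N"
    by (rule hlist_tuple[OF level_field[OF N] r]) (use f(2) in \<open>eventually_elim, auto\<close>)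
  have an: "?a \<in> hyper_nat C" by (rule hlist_hyper_nat[OF r])
  have "b = top_embed N ?a"
  proof (rule hyper_list_eqI[OF bn])
    show "top_embed N ?a \<in> hyper_nat C" using top_embed_closed[OF aT] by (simp add: TK_iff)
    show "ev (\<lambda>i. lval b i = lval (top_embed N ?a) i)"
      unfolding top_embed_def using pointwise_hyper_nat(2)[OF \<Psi>s_seq an] lval_hlist[OF r] f(2)
      by eventually_elim simp
  qed
  then show ?thesis using aT by blast
qed

end

lemma top_embed_incl:
  assumes "N \<in> hyper_nat C" "M \<in> hyper_nat C" "hyper_less C N M" "a \<in> TN N"
  shows "top_embed M (coh_incl C \<Phi> N M a) = top_embed N a"
proof (rule hyper_list_eqI)
  have c: "coh_incl C \<Phi> N M a \<in> TN M" by (rule coh_incl_closed[OF assms])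
  show "top_embed M (coh_incl C \<Phi> N M a) \<in> hyper_nat C" "top_embed N a \<in> hyper_nat C"
    using top_embed_closed[OF assms(2) c] top_embed_closed[OF assms(1,4)] by (simp_all add: TK_iff)
  have "ev (\<lambda>i. set (lval a i) \<subseteq> carrier (Ks (val N i)))" using assms(4) by (simp add: TN_iff[OF assms(1)])
  then show "ev (\<lambda>i. lval (top_embed M (coh_incl C \<Phi> N M a)) i = lval (top_embed N a) i)"
    using top_embed_lval[OF assms(2) c] top_embed_lval[OF assms(1,4)] coh_incl_lval[OF assms] val_less[OF assms(1-3)]
    by eventually_elim (auto simp: \<Psi>s_tower_map subset_iff)
qed

lemma hyper_nat_upper_bound:
  assumes "N \<in> hyper_nat C" "N' \<in> hyper_nat C"
  obtains M where "M \<in> hyper_nat C" "hyper_less C N M" "hyper_less C N' M"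
proof
  \<comment> \<open>The successor makes the bound strict, as the system is indexed along the strict
    order.\<close>
  let ?m = "\<lambda>i. Suc (val N i + val N' i)"
  have r: "seq_rec C ?m" by (intro arec_intros hyper_nat_val(1) assms)
  show M: "hclass C ?m \<in> hyper_nat C" by (rule hclass_hyper_nat[OF r])
  show "hyper_less C N (hclass C ?m)" "hyper_less C N' (hclass C ?m)"
    unfolding hyper_less_iff[OF assms(1) M] hyper_less_iff[OF assms(2) M]
    using val_hclass[OF r] by (eventually_elim, simp)+
qed

text \<open>At each index the finitely many entries lie in one level, since the levels increase to
  the whole field. A search for such a level together with the preimages gives a recursive sequence
  of levels, which is the hypernatural \<open>N\<close>.\<close>

lemma top_embed_cover:
  assumes b: "b \<in> TK" obtains N where "N \<in> hyper_nat C" "b \<in> top_embed N ` TN N"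
proof -
  have bn: "b \<in> hyper_nat C" "ev (\<lambda>i. set (lval b i) \<subseteq> carrier K)" using b by (simp_all add: TK_iff)
  let ?P = "\<lambda>i z. (\<forall>x\<in>set (list_decode (nsnd z)). x \<in> carrier (Ks (nfst z))) \<and>
    map (guard (carrier (Ks (nfst z))) (\<Psi>s (nfst z))) (list_decode (nsnd z)) = lval b i"
  have dec: "adec (almost_all C) ?P"
    by (intro arec_intros Ks_dec arec_\<Psi>s lval_rec[OF bn(1)])
  have ex: "\<exists>n. \<forall>y\<in>set ys. \<exists>x\<in>carrier (Ks n). \<Psi>s n x = y" if "set ys \<subseteq> carrier K" for ys
    using that
  proof (induction ys)
    case (Cons y ys)
    then obtain n where n: "\<forall>y\<in>set ys. \<exists>x\<in>carrier (Ks n). \<Psi>s n x = y" by auto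
    obtain k x where k: "x \<in> carrier (Ks k)" "\<Psi>s k x = y" using Cons.prems K_union by auto
    let ?m = "max n k"
    have up: "\<exists>x'\<in>carrier (Ks ?m). \<Psi>s ?m x' = \<Psi>s j x" if "j \<le> ?m" "x \<in> carrier (Ks j)" for j x
      using \<Psi>s_tower_map[OF that] ring_hom_closed[OF tower_map_hom[OF that(1)] that(2)] by blast
    have "\<exists>x\<in>carrier (Ks ?m). \<Psi>s ?m x = z" if z: "z \<in> set (y # ys)" for z
    proof (cases "z = y")
      case True
      then show ?thesis using up[of k x] k by simp
    next
      case False
      then obtain w where "w \<in> carrier (Ks n)" "\<Psi>s n w = z" using n z by auto
      then show ?thesis using up[of n w] by simp
    qed
    then show ?case by blast
  qed simp
  have "ev (\<lambda>i. \<exists>z. ?P i z)"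
    using bn(2)
  proof eventually_elim
    case (elim i)
    obtain n where "\<forall>y\<in>set (lval b i). \<exists>x\<in>carrier (Ks n). \<Psi>s n x = y" using ex[OF elim] by blast
    then obtain f where f: "\<forall>y\<in>set (lval b i). f y \<in> carrier (Ks n) \<and> \<Psi>s n (f y) = y" by metis
    show ?case
      by (intro exI[of _ "prod_encode (n, list_encode (map f (lval b i)))"])
        (use f in \<open>auto simp: guard_def intro!: map_idI\<close>)
  qed
  then obtain f where f: "seq_rec C f" "ev (\<lambda>i. ?P i (f i))" by (rule seq_search[OF dec])
  have r: "seq_rec C (\<lambda>i. nfst (f i))" by (intro arec_intros f(1))
  let ?N = "hclass C (\<lambda>i. nfst (f i))"
  have N: "?N \<in> hyper_nat C" by (rule hclass_hyper_nat[OF r])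
  have "ev (\<lambda>i. \<forall>y\<in>set (lval b i). \<exists>x\<in>carrier (Ks (val ?N i)). \<Psi>s (val ?N i) x = y)"
    using val_hclass[OF r] f(2)
  proof eventually_elim
    case (elim i)
    have "set (lval b i) = guard (carrier (Ks (nfst (f i)))) (\<Psi>s (nfst (f i))) ` set (list_decode (nsnd (f i)))"
      using elim(2) by (metis list.set_map)
    then show ?case using elim by (auto simp: guard_def)
  qed
  from that[OF N top_embed_onto[OF N b this]] show thesis .
qed

lemma top_embed_const:
  assumes N: "N \<in> hyper_nat C" and c: "c \<in> coh_tuples C (\<lambda>_. Some F)"
  shows "pointwise C (\<lambda>i. guard (carrier F) (\<Theta> (val N i))) c \<in> TN N"
    "top_embed N (pointwise C (\<lambda>i. guard (carrier F) (\<Theta> (val N i))) c) = pointwise C (\<lambda>_. guard (carrier F) \<Psi>) c"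
proof -
  interpret L: hyper_extension C Ks "val N" "reindex N Ks" F "reindex N \<Theta>" "\<lambda>i. guard (carrier F) (\<Theta> (val N i))"
    by (rule level_extension[OF N])
  interpret T: hyper_extension C "\<lambda>_. K" "\<lambda>_. 0" "\<lambda>_. Some K" F "\<lambda>_. Some \<Psi>" "\<lambda>_. guard (carrier F) \<Psi>"
    by (rule top_extension)
  have cn: "c \<in> hyper_nat C" "ev (\<lambda>i. set (lval c i) \<subseteq> carrier F)" using c by (simp_all add: coh_tuples_iff[OF L.base_field])
  show p: "pointwise C (\<lambda>i. guard (carrier F) (\<Theta> (val N i))) c \<in> TN N"
    using pointwise_embedding[OF L.base_field L.L L.e L.e_hom] c unfolding hyper_embedding_def by blast
  show "top_embed N (pointwise C (\<lambda>i. guard (carrier F) (\<Theta> (val N i))) c) = pointwise C (\<lambda>_. guard (carrier F) \<Psi>) c"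
  proof (rule hyper_list_eqI)
    show "top_embed N (pointwise C (\<lambda>i. guard (carrier F) (\<Theta> (val N i))) c) \<in> hyper_nat C"
      using top_embed_closed[OF N p] by (simp add: TK_iff)
    show "pointwise C (\<lambda>_. guard (carrier F) \<Psi>) c \<in> hyper_nat C" by (rule pointwise_hyper_nat[OF T.e cn(1)])
    show "ev (\<lambda>i. lval (top_embed N (pointwise C (\<lambda>i. guard (carrier F) (\<Theta> (val N i))) c)) i =
        lval (pointwise C (\<lambda>_. guard (carrier F) \<Psi>) c) i)"
      using top_embed_lval[OF N p] pointwise_hyper_nat(2)[OF L.e cn(1)] pointwise_hyper_nat(2)[OF T.e cn(1)] cn(2)
      by eventually_elim (auto simp: guard_def \<Psi>s_\<Theta> subset_iff)
  qed
qed

end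

section \<open>Restriction and gluing of hyper-automorphisms\<close>

context hyper_extension
begin

lemma relative_hauts_Bij: "\<sigma> \<in> relative_hauts \<Longrightarrow> \<sigma> \<in> Bij T"
  unfolding relative_hauts_def haut_group_def field_hauts_def tree_hauts_def by simp

lemma haut_group_mult:
  "\<sigma> \<in> relative_hauts \<Longrightarrow> \<tau> \<in> relative_hauts \<Longrightarrow> \<sigma> \<otimes>\<^bsub>haut_group C L F E\<^esub> \<tau> = compose T \<sigma> \<tau>"
  using relative_hauts_Bij by (simp add: haut_group_def BijGroup_def)

lemma relative_hauts_compose:
  assumes \<sigma>: "\<sigma> \<in> relative_hauts" and \<tau>: "\<tau> \<in> relative_hauts" shows "compose T \<sigma> \<tau> \<in> relative_hauts"
  unfolding relative_hauts_iff
proof (intro conjI ballI)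
  show "hyper_embedding C L L (compose T \<sigma> \<tau>)"
    by (rule hyper_embedding_cong[OF L hyper_embedding_comp[OF L \<sigma>_emb[OF \<tau>] \<sigma>_emb[OF \<sigma>]]])
      (simp add: compose_def)
  show "compose T \<sigma> \<tau> ` T = T"
    using \<sigma>_surj[OF \<sigma>] \<sigma>_surj[OF \<tau>] by (simp add: compose_def image_image[symmetric] cong: image_cong_simp)
  fix c assume c: "c \<in> coh_tuples C (\<lambda>_. Some F)"
  have "pointwise C e c \<in> T"
    using pointwise_embedding[OF base_field L e e_hom] c unfolding hyper_embedding_def by blast
  then show "compose T \<sigma> \<tau> (pointwise C e c) = pointwise C e c"
    using \<sigma>_fix[OF \<sigma> c] \<sigma>_fix[OF \<tau> c] by (simp add: compose_def)
qed (rule compose_extensional)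

text \<open>The laws follow by cancelling \<sigma> in the identity map. The inverse is what makes
  restrictions to a level surjective in \<open>level_restrict_haut\<close>.\<close>

lemma relative_hauts_inverse:
  assumes \<sigma>: "\<sigma> \<in> relative_hauts"
  shows "(\<lambda>a\<in>T. inv_into T \<sigma> a) \<in> relative_hauts"
  unfolding relative_hauts_iff
proof (intro conjI ballI)
  have inv: "inv_into T \<sigma> a \<in> T" "\<sigma> (inv_into T \<sigma> a) = a" if "a \<in> T" for a
    using that \<sigma>_surj[OF \<sigma>] by (auto simp: inv_into_into f_inv_into_f)
  have inv': "inv_into T \<sigma> (\<sigma> a) = a" if "a \<in> T" for a
    using inv_into_f_f[OF \<sigma>_inj[OF \<sigma>] that] .
  have "hyper_embedding C L L (\<lambda>a. a)" by (simp add: hyper_embedding_def)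
  then have "hyper_embedding C L L (\<lambda>a. \<sigma> ((\<lambda>a\<in>T. inv_into T \<sigma> a) a))"
    by (rule hyper_embedding_cong[OF L]) (simp add: inv)
  then show "hyper_embedding C L L (\<lambda>a\<in>T. inv_into T \<sigma> a)"
    by (rule hyper_embedding_factor[OF L L L \<sigma>_emb[OF \<sigma>]]) (simp add: inv)
  show "(\<lambda>a\<in>T. inv_into T \<sigma> a) ` T = T"
  proof (intro equalityI subsetI)
    fix a assume a: "a \<in> T"
    then show "a \<in> (\<lambda>a\<in>T. inv_into T \<sigma> a) ` T"
      using \<sigma>_T[OF \<sigma> a] inv'[OF a] by (intro image_eqI[of _ _ "\<sigma> a"]) auto
  qed (use inv in auto)
  fix c assume c: "c \<in> coh_tuples C (\<lambda>_. Some F)"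
  have p: "pointwise C e c \<in> T"
    using pointwise_embedding[OF base_field L e e_hom] c unfolding hyper_embedding_def by blast
  then show "(\<lambda>a\<in>T. inv_into T \<sigma> a) (pointwise C e c) = pointwise C e c"
    using inv'[OF p] \<sigma>_fix[OF \<sigma> c] by simp
qed (rule restrict_extensional)

end

section \<open>Passage between the top and the levels\<close>

context cohesive_galois
begin

definition top_hauts :: "(hyper \<Rightarrow> hyper) monoid" where
  "top_hauts = haut_group C (\<lambda>_. Some K) F (\<lambda>_. Some \<Psi>)"

interpretation T: hyper_extension C "\<lambda>_. K" "\<lambda>_. 0" "\<lambda>_. Some K" F "\<lambda>_. Some \<Psi>" "\<lambda>_. guard (carrier F) \<Psi>"
  by (rule top_extension)

lemma top_hauts_eq: "carrier top_hauts = T.relative_hauts"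
  by (simp add: top_hauts_def T.relative_hauts_def)

lemma top_haut_stable:
  assumes \<sigma>: "\<sigma> \<in> T.relative_hauts" and N: "N \<in> hyper_nat C" and a: "a \<in> TN N"
  shows "\<sigma> (top_embed N a) \<in> top_embed N ` TN N"
proof (rule top_embed_onto[OF N])
  have b: "top_embed N a \<in> TK" by (rule top_embed_closed[OF N a])
  show "\<sigma> (top_embed N a) \<in> TK" by (rule T.\<sigma>_T[OF \<sigma> b])
  have "ev (\<lambda>i. set (lval a i) \<subseteq> carrier (Ks (val N i)))" using a by (simp add: TN_iff[OF N])
  then show "ev (\<lambda>i. \<forall>y\<in>set (lval (\<sigma> (top_embed N a)) i). \<exists>x\<in>carrier (Ks (val N i)). \<Psi>s (val N i) x = y)"
    using T.gen_pairs_transfer[OF \<sigma> b] T.A_B_wf[OF \<sigma> b] top_embed_lval[OF N a]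
  proof eventually_elim
    case (elim i)
    let ?k = "val N i" and ?A = "lval (top_embed N a) i" and ?B = "lval (\<sigma> (top_embed N a)) i"
    interpret galois_action "Ks ?k" "G ?k" "act ?k" "\<Theta> ?k ` carrier F" by (rule galois_action)
    \<comment> \<open>Describes the constants of \<open>K\<close> as coming through level
      \<open>?k\<close>, the form in which \<open>orbit_gen_pairs\<close> takes them.\<close>
    have im: "guard (carrier F) \<Psi> ` carrier F = \<Psi>s ?k ` \<Theta> ?k ` carrier F"
      by (auto simp: guard_def \<Psi>s_\<Theta> image_image)
    show ?case
    proof
      fix y assume "y \<in> set ?B"
      then obtain j where j: "j < length ?B" "y = ?B ! j" by (auto simp: in_set_conv_nth)
      have jl: "j < length (lval a i)" using j(1) elim(3,4) by simp
      have x: "lval a i ! j \<in> carrier (Ks ?k)" using elim(1) jl by auto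
      have "(\<Psi>s ?k (lval a i ! j), y) \<in> set (zip ?A ?B)"
        using j jl elim(4) by (auto simp: set_zip intro!: exI[of _ j])
      moreover have "y \<in> carrier K" using elim(3) j by (metis nth_mem subsetD)
      ultimately have "\<exists>z. (\<zero>\<^bsub>K\<^esub>, z) \<in> gen_pairs K (\<Psi>s ?k ` \<Theta> ?k ` carrier F) (set (zip ?A ?B)) \<and>
          (z = \<zero>\<^bsub>K\<^esub> \<longrightarrow> (\<exists>g\<in>carrier (G ?k). y = \<Psi>s ?k (act ?k g (lval a i ! j))))"
        by (intro orbit_gen_pairs field_K \<Psi>s_hom x)
      then
      obtain z where z: "(\<zero>\<^bsub>K\<^esub>, z) \<in> gen_pairs K (\<Psi>s ?k ` \<Theta> ?k ` carrier F) (set (zip ?A ?B))"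
        "z = \<zero>\<^bsub>K\<^esub> \<longrightarrow> (\<exists>g\<in>carrier (G ?k). y = \<Psi>s ?k (act ?k g (lval a i ! j)))"
        by (elim exE conjE) (rule that)
      \<comment> \<open>The first component of the pair is zero, so transfer forces \<open>z\<close>
        to vanish, and this says that \<open>y\<close> is a conjugate of an element of the
        level.\<close>
      have "z = \<zero>\<^bsub>K\<^esub>" using elim(2) z(1) unfolding im by blast
      then show "\<exists>x\<in>carrier (Ks ?k). \<Psi>s ?k x = y" using z(2) act_closed[OF _ x] by blast
    qed
  qed
qed

definition level_restrict :: "(hyper \<Rightarrow> hyper) \<Rightarrow> hyper \<Rightarrow> hyper \<Rightarrow> hyper" where
  "level_restrict \<sigma> N = (\<lambda>a\<in>TN N. the_inv_into (TN N) (top_embed N) (\<sigma> (top_embed N a)))"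

lemma level_restrict:
  assumes \<sigma>: "\<sigma> \<in> T.relative_hauts" and N: "N \<in> hyper_nat C" and a: "a \<in> TN N"
  shows "level_restrict \<sigma> N a \<in> TN N" "top_embed N (level_restrict \<sigma> N a) = \<sigma> (top_embed N a)"
  using the_inv_into_into[OF top_embed_inj[OF N] top_haut_stable[OF assms] order_refl]
    f_the_inv_into_f[OF top_embed_inj[OF N] top_haut_stable[OF assms]] a
  by (simp_all add: level_restrict_def)

lemma level_restrict_extensional: "level_restrict \<sigma> N \<in> extensional (TN N)"
  by (simp add: level_restrict_def)

text \<open>Followed by \<open>top_embed N\<close>, the restriction is \<sigma> after
  \<open>top_embed N\<close>, a composition of embeddings; cancelling \<open>top_embed N\<close>
  leaves the laws for the restriction.\<close>

lemma level_restrict_haut: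
  assumes \<sigma>: "\<sigma> \<in> T.relative_hauts" and N: "N \<in> hyper_nat C"
  shows "level_restrict \<sigma> N \<in> carrier (level_hauts N)"
proof -
  interpret L: hyper_extension C Ks "val N" "reindex N Ks" F "reindex N \<Theta>" "\<lambda>i. guard (carrier F) (\<Theta> (val N i))"
    by (rule level_extension[OF N])
  note r = level_restrict[OF \<sigma> N]
  show ?thesis
    unfolding level_hauts_eq[OF N] L.relative_hauts_iff
  proof (intro conjI ballI)
    show "level_restrict \<sigma> N \<in> extensional (TN N)" by (rule level_restrict_extensional)
    have "hyper_embedding C (reindex N Ks) (\<lambda>_. Some K) (\<lambda>a. top_embed N (level_restrict \<sigma> N a))"
      by (rule hyper_embedding_cong[OF L.L hyper_embedding_comp[OF L.L top_embed_embedding[OF N] T.\<sigma>_emb[OF \<sigma>]]])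
        (rule r(2))
    then show "hyper_embedding C (reindex N Ks) (reindex N Ks) (level_restrict \<sigma> N)"
      by (rule hyper_embedding_factor[OF L.L T.L L.L top_embed_embedding[OF N]]) (rule r(1))
    show "level_restrict \<sigma> N ` TN N = TN N"
    proof (intro equalityI subsetI)
      fix b assume b: "b \<in> TN N"
      \<comment> \<open>The restriction of the inverse automorphism supplies the preimage of
        \<open>b\<close>.\<close>
      let ?\<sigma>' = "\<lambda>a\<in>TK. inv_into TK \<sigma> a"
      have b': "top_embed N b \<in> TK" by (rule top_embed_closed[OF N b])
      note r' = level_restrict[OF T.relative_hauts_inverse[OF \<sigma>] N b]
      have "top_embed N (level_restrict \<sigma> N (level_restrict ?\<sigma>' N b)) = \<sigma> (?\<sigma>' (top_embed N b))"
        by (simp only: r(2)[OF r'(1)] r'(2))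
      also have "\<dots> = top_embed N b"
        using b' T.\<sigma>_surj[OF \<sigma>] by (simp add: f_inv_into_f)
      finally have "level_restrict \<sigma> N (level_restrict ?\<sigma>' N b) = b"
        by (rule inj_onD[OF top_embed_inj[OF N] _ r(1)[OF r'(1)] b])
      then show "b \<in> level_restrict \<sigma> N ` TN N" using r'(1) by (metis image_eqI)
    qed (use r(1) in auto)
    fix c assume c: "c \<in> coh_tuples C (\<lambda>_. Some F)"
    note tc = top_embed_const[OF N c]
    have "top_embed N (level_restrict \<sigma> N (pointwise C (\<lambda>i. guard (carrier F) (\<Theta> (val N i))) c)) =
        top_embed N (pointwise C (\<lambda>i. guard (carrier F) (\<Theta> (val N i))) c)"
      unfolding r(2)[OF tc(1)] tc(2) by (rule T.\<sigma>_fix[OF \<sigma> c])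
    then show "level_restrict \<sigma> N (pointwise C (\<lambda>i. guard (carrier F) (\<Theta> (val N i))) c) =
        pointwise C (\<lambda>i. guard (carrier F) (\<Theta> (val N i))) c"
      by (rule inj_onD[OF top_embed_inj[OF N] _ r(1)[OF tc(1)] tc(1)])
  qed
qed

lemma haut_restrict_level_restrict:
  assumes \<sigma>: "\<sigma> \<in> T.relative_hauts" and NM: "N \<in> hyper_nat C" "M \<in> hyper_nat C" "hyper_less C N M"
  shows "haut_restrict C Ks \<Phi> M N (level_restrict \<sigma> M) = level_restrict \<sigma> N"
proof
  fix a
  show "haut_restrict C Ks \<Phi> M N (level_restrict \<sigma> M) a = level_restrict \<sigma> N a"
  proof (cases "a \<in> TN N")
    case True
    note c = coh_incl_closed[OF NM True] and r = level_restrict[OF \<sigma> NM(1) True]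
    note rc = level_restrict[OF \<sigma> NM(2) c] and cr = coh_incl_closed[OF NM r(1)]
    \<comment> \<open>Both sides are compared in the top level, where the inclusion between the
      levels disappears.\<close>
    have "top_embed M (level_restrict \<sigma> M (coh_incl C \<Phi> N M a)) = top_embed M (coh_incl C \<Phi> N M (level_restrict \<sigma> N a))"
      by (simp only: rc(2) top_embed_incl[OF NM True] top_embed_incl[OF NM r(1)] r(2))
    then have "level_restrict \<sigma> M (coh_incl C \<Phi> N M a) = coh_incl C \<Phi> N M (level_restrict \<sigma> N a)"
      by (rule inj_onD[OF top_embed_inj[OF NM(2)] _ rc(1) cr])
    then show ?thesis
      using True by (simp add: haut_restrict_def the_inv_into_f_f[OF coh_incl_inj[OF NM] r(1)])
  next
    case False
    then show ?thesis by (simp add: haut_restrict_def level_restrict_def)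
  qed
qed

lemma glue:
  assumes x: "\<And>N. N \<in> hyper_nat C \<Longrightarrow> x N \<in> carrier (level_hauts N)"
    and compat: "\<And>N M. N \<in> hyper_nat C \<Longrightarrow> M \<in> hyper_nat C \<Longrightarrow> hyper_less C N M \<Longrightarrow>
      haut_restrict C Ks \<Phi> M N (x M) = x N"
  obtains \<sigma> where "\<sigma> \<in> T.relative_hauts"
    "\<And>N a. N \<in> hyper_nat C \<Longrightarrow> a \<in> TN N \<Longrightarrow> \<sigma> (top_embed N a) = top_embed N (x N a)"
proof -
  have emb: "hyper_embedding C (reindex N Ks) (reindex N Ks) (x N)" and surj: "x N ` TN N = TN N"
    and fix_F: "\<And>c. c \<in> coh_tuples C (\<lambda>_. Some F) \<Longrightarrow> x N (pointwise C (\<lambda>i. guard (carrier F) (\<Theta> (val N i))) c) =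
      pointwise C (\<lambda>i. guard (carrier F) (\<Theta> (val N i))) c"
    if N: "N \<in> hyper_nat C" for N
  proof -
    interpret L: hyper_extension C Ks "val N" "reindex N Ks" F "reindex N \<Theta>" "\<lambda>i. guard (carrier F) (\<Theta> (val N i))"
      by (rule level_extension[OF N])
    have "x N \<in> L.relative_hauts" using x[OF N] by (simp add: level_hauts_eq[OF N])
    then show "hyper_embedding C (reindex N Ks) (reindex N Ks) (x N)" "x N ` TN N = TN N"
      "\<And>c. c \<in> coh_tuples C (\<lambda>_. Some F) \<Longrightarrow> x N (pointwise C (\<lambda>i. guard (carrier F) (\<Theta> (val N i))) c) =
        pointwise C (\<lambda>i. guard (carrier F) (\<Theta> (val N i))) c"
      unfolding L.relative_hauts_iff by blast+
  qed
  have clos: "x N a \<in> TN N" if "N \<in> hyper_nat C" "a \<in> TN N" for N a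
    using emb[OF that(1)] that(2) unfolding hyper_embedding_def by blast
  have up: "top_embed N (x N a) = top_embed M (x M (coh_incl C \<Phi> N M a))"
    if NM: "N \<in> hyper_nat C" "M \<in> hyper_nat C" "hyper_less C N M" and a: "a \<in> TN N" for N M a
    using level_haut_incl[OF NM x[OF NM(2)] a] top_embed_incl[OF NM clos[OF NM(1) a]] compat[OF NM] by simp
  \<comment> \<open>Compatibility is given along the strict order only, so two levels are compared
    through one strictly above both.\<close>
  have wd: "top_embed N (x N a) = top_embed N' (x N' a')"
    if N: "N \<in> hyper_nat C" "a \<in> TN N" and N': "N' \<in> hyper_nat C" "a' \<in> TN N'"
      and eq: "top_embed N a = top_embed N' a'" for N N' a a'
  proof -
    obtain M where M: "M \<in> hyper_nat C" "hyper_less C N M" "hyper_less C N' M"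
      using hyper_nat_upper_bound[OF N(1) N'(1)] by blast
    have "top_embed M (coh_incl C \<Phi> N M a) = top_embed M (coh_incl C \<Phi> N' M a')"
      using top_embed_incl[OF N(1) M(1,2) N(2)] top_embed_incl[OF N'(1) M(1,3) N'(2)] eq by simp
    then have "coh_incl C \<Phi> N M a = coh_incl C \<Phi> N' M a'"
      by (rule inj_onD[OF top_embed_inj[OF M(1)]])
        (rule coh_incl_closed[OF N(1) M(1,2) N(2)], rule coh_incl_closed[OF N'(1) M(1,3) N'(2)])
    then show ?thesis using up[OF N(1) M(1,2) N(2)] up[OF N'(1) M(1,3) N'(2)] by simp
  qed
  \<comment> \<open>A tuple of the top has many descriptions as the image of a tuple of some level;
    by \<open>wd\<close> all of them name the same value, so the choice is immaterial.\<close>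
  define \<sigma> where "\<sigma> = (\<lambda>a\<in>TK. SOME b. \<exists>N\<in>hyper_nat C. \<exists>a'\<in>TN N. a = top_embed N a' \<and> b = top_embed N (x N a'))"
  have \<sigma>: "\<sigma> (top_embed N a) = top_embed N (x N a)" if N: "N \<in> hyper_nat C" "a \<in> TN N" for N a
  proof -
    let ?Q = "\<lambda>b. \<exists>M\<in>hyper_nat C. \<exists>a'\<in>TN M. top_embed N a = top_embed M a' \<and> b = top_embed M (x M a')"
    have "?Q (SOME b. ?Q b)"
      by (rule someI[of ?Q "top_embed N (x N a)"]) (use N in blast)
    then have "(SOME b. ?Q b) = top_embed N (x N a)" using wd[OF N] by metis
    then show ?thesis using top_embed_closed[OF N] by (simp add: \<sigma>_def)
  qed
  \<comment> \<open>Each law of a hyper-automorphism involves at most two tuples, so it can be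
    checked inside a single level.\<close>
  have common: "\<exists>N a' b'. N \<in> hyper_nat C \<and> a' \<in> TN N \<and> b' \<in> TN N \<and> a = top_embed N a' \<and> b = top_embed N b'"
    if ab: "a \<in> TK" "b \<in> TK" for a b
  proof -
    obtain N1 N2 where N: "N1 \<in> hyper_nat C" "a \<in> top_embed N1 ` TN N1" "N2 \<in> hyper_nat C" "b \<in> top_embed N2 ` TN N2"
      using top_embed_cover[OF ab(1)] top_embed_cover[OF ab(2)] by metis
    then obtain a' b' where a': "a' \<in> TN N1" "a = top_embed N1 a'" and b': "b' \<in> TN N2" "b = top_embed N2 b'" by blast
    obtain M where M: "M \<in> hyper_nat C" "hyper_less C N1 M" "hyper_less C N2 M"
      using hyper_nat_upper_bound[OF N(1,3)] by blast
    show ?thesis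
      using top_embed_incl[OF N(1) M(1,2) a'(1)] top_embed_incl[OF N(3) M(1,3) b'(1)] a' b'
        coh_incl_closed[OF N(1) M(1,2) a'(1)] coh_incl_closed[OF N(3) M(1,3) b'(1)] M(1) by metis
  qed
  have "\<sigma> \<in> T.relative_hauts"
    unfolding T.relative_hauts_iff
  proof (intro conjI ballI)
    show "\<sigma> \<in> extensional TK" by (simp add: \<sigma>_def)
    show "\<sigma> ` TK = TK"
    proof (intro equalityI subsetI)
      fix b assume "b \<in> \<sigma> ` TK"
      then obtain a where "a \<in> TK" "b = \<sigma> a" by blast
      then obtain N a' where "N \<in> hyper_nat C" "a' \<in> TN N" "b = \<sigma> (top_embed N a')" using common by metis
      then show "b \<in> TK" using \<sigma> clos top_embed_closed by simp
    next
      fix b assume "b \<in> TK"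
      then obtain N b' where N: "N \<in> hyper_nat C" and b': "b' \<in> TN N" "b = top_embed N b'" using common by metis
      obtain a' where a': "a' \<in> TN N" "b' = x N a'" using surj[OF N] b'(1) by blast
      then show "b \<in> \<sigma> ` TK" using \<sigma>[OF N a'(1)] b'(2) top_embed_closed[OF N a'(1)] by (metis image_eqI)
    qed
    show "hyper_embedding C (\<lambda>_. Some K) (\<lambda>_. Some K) \<sigma>"
      unfolding hyper_embedding_def
    proof (intro conjI ballI allI impI)
      fix a b assume "a \<in> TK" "b \<in> TK"
      then obtain N a' b' where N: "N \<in> hyper_nat C" and ab': "a' \<in> TN N" "b' \<in> TN N"
        and ab: "a = top_embed N a'" "b = top_embed N b'" using common by metis
      note J = top_embed_embedding[OF N, unfolded hyper_embedding_def]
      note X = emb[OF N, unfolded hyper_embedding_def]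
      note c = clos[OF N ab'(1)] clos[OF N ab'(2)]
      show "hyper_prefix C (\<sigma> a) (\<sigma> b) \<longleftrightarrow> hyper_prefix C a b"
        unfolding ab \<sigma>[OF N ab'(1)] \<sigma>[OF N ab'(2)] using J X ab' c by simp
      have t: "hyper_append C a' b' \<in> TN N" by (rule hyper_append_tuple[OF level_field[OF N] ab'])
      have "\<sigma> (hyper_append C a b) = \<sigma> (top_embed N (hyper_append C a' b'))" using J ab' ab by simp
      also have "\<dots> = hyper_append C (\<sigma> a) (\<sigma> b)"
        unfolding ab \<sigma>[OF N ab'(1)] \<sigma>[OF N ab'(2)] \<sigma>[OF N t] using J X ab' c by simp
      finally show "\<sigma> (hyper_append C a b) = hyper_append C (\<sigma> a) (\<sigma> b)" .
    next
      fix a assume "a \<in> TK"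
      then obtain N a' where N: "N \<in> hyper_nat C" and a': "a' \<in> TN N" and a: "a = top_embed N a'" using common by metis
      note J = top_embed_embedding[OF N, unfolded hyper_embedding_def]
      note X = emb[OF N, unfolded hyper_embedding_def]
      note c = clos[OF N a']
      show "\<sigma> a \<in> TK" unfolding a \<sigma>[OF N a'] by (rule top_embed_closed[OF N c])
      show "arity C (\<sigma> a) = arity C a" unfolding a \<sigma>[OF N a'] using J X a' c by simp
      fix p assume p: "hyper_poly C p \<and> arity C a = hyper_var C p"
      have ar: "arity C a' = hyper_var C p" "arity C (x N a') = hyper_var C p" using p J X a' a by simp_all
      have t: "hyper_singleton C (hyper_eval C (reindex N Ks) p a') \<in> TN N"
        by (rule hyper_evalE[OF level_field[OF N] a' conjunct1[OF p] ar(1)])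
      have "hyper_singleton C (hyper_eval C (\<lambda>_. Some K) p (\<sigma> a)) =
          top_embed N (hyper_singleton C (hyper_eval C (reindex N Ks) p (x N a')))"
        unfolding a \<sigma>[OF N a'] using J c p ar(2) by simp
      also have "\<dots> = \<sigma> (top_embed N (hyper_singleton C (hyper_eval C (reindex N Ks) p a')))"
        unfolding \<sigma>[OF N t] using X a' p ar(1) by simp
      also have "\<dots> = \<sigma> (hyper_singleton C (hyper_eval C (\<lambda>_. Some K) p a))"
        unfolding a using J a' p ar(1) by simp
      finally show "hyper_singleton C (hyper_eval C (\<lambda>_. Some K) p (\<sigma> a)) =
          \<sigma> (hyper_singleton C (hyper_eval C (\<lambda>_. Some K) p a))" .
    qed
    fix c assume c: "c \<in> coh_tuples C (\<lambda>_. Some F)"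
    \<comment> \<open>Every level contains the constants; the level with constant index 0 is
      taken.\<close>
    have N: "hclass C (\<lambda>_. 0) \<in> hyper_nat C" by (rule hclass_hyper_nat[OF arec_const])
    note tc = top_embed_const[OF N c]
    show "\<sigma> (pointwise C (\<lambda>_. guard (carrier F) \<Psi>) c) = pointwise C (\<lambda>_. guard (carrier F) \<Psi>) c"
      using \<sigma>[OF N tc(1)] fix_F[OF N c] tc(2) by simp
  qed
  from this \<sigma> show thesis by (rule that)
qed

theorem top_limit_iso:
  "top_hauts \<cong> inverse_limit (hyper_nat C) (hyper_less C) level_hauts (haut_restrict C Ks \<Phi>)"
proof (rule is_isoI, rule isoI)
  let ?L = "inverse_limit (hyper_nat C) (hyper_less C) level_hauts (haut_restrict C Ks \<Phi>)"
  let ?R = "\<lambda>\<sigma>. \<lambda>N\<in>hyper_nat C. level_restrict \<sigma> N"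
  have R_in: "?R \<sigma> \<in> carrier ?L" if "\<sigma> \<in> T.relative_hauts" for \<sigma>
    using level_restrict_haut[OF that] haut_restrict_level_restrict[OF that]
    by (auto simp: inverse_limit_def PiE_iff)
  show "?R \<in> hom top_hauts ?L"
  proof (rule homI, unfold top_hauts_eq)
    fix \<sigma> \<tau> assume st: "\<sigma> \<in> T.relative_hauts" "\<tau> \<in> T.relative_hauts"
    have m: "\<sigma> \<otimes>\<^bsub>top_hauts\<^esub> \<tau> = compose TK \<sigma> \<tau>" unfolding top_hauts_def by (rule T.haut_group_mult[OF st])
    have "level_restrict (compose TK \<sigma> \<tau>) N = level_restrict \<sigma> N \<otimes>\<^bsub>level_hauts N\<^esub> level_restrict \<tau> N"
      if N: "N \<in> hyper_nat C" for N
    proof -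
      interpret L: hyper_extension C Ks "val N" "reindex N Ks" F "reindex N \<Theta>" "\<lambda>i. guard (carrier F) (\<Theta> (val N i))"
        by (rule level_extension[OF N])
      have lr: "level_restrict \<sigma> N \<in> L.relative_hauts" "level_restrict \<tau> N \<in> L.relative_hauts"
        using level_restrict_haut[OF st(1) N] level_restrict_haut[OF st(2) N] by (simp_all add: level_hauts_eq[OF N])
      have "level_restrict (compose TK \<sigma> \<tau>) N a = level_restrict \<sigma> N (level_restrict \<tau> N a)" if a: "a \<in> TN N" for a
      \<comment> \<open>After embedding into the top level both sides become \<sigma> applied after
        \<tau>.\<close>
      proof (rule inj_onD[OF top_embed_inj[OF N]])
        note rt = level_restrict[OF st(2) N a] and rs = level_restrict[OF st(1) N level_restrict(1)[OF st(2) N a]]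
        note rc = level_restrict[OF T.relative_hauts_compose[OF st] N a]
        show "level_restrict (compose TK \<sigma> \<tau>) N a \<in> TN N" "level_restrict \<sigma> N (level_restrict \<tau> N a) \<in> TN N"
          by (rule rc(1), rule rs(1))
        show "top_embed N (level_restrict (compose TK \<sigma> \<tau>) N a) = top_embed N (level_restrict \<sigma> N (level_restrict \<tau> N a))"
          unfolding rc(2) rs(2) rt(2) using top_embed_closed[OF N a] by (simp add: compose_def)
      qed
      then have "level_restrict (compose TK \<sigma> \<tau>) N = compose (TN N) (level_restrict \<sigma> N) (level_restrict \<tau> N)"
        by (intro extensionalityI[of _ "TN N"] level_restrict_extensional compose_extensional)
          (simp add: compose_eq)
      then show ?thesis unfolding level_hauts_def by (simp add: L.haut_group_mult[OF lr])
    qed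
    then show "?R (\<sigma> \<otimes>\<^bsub>top_hauts\<^esub> \<tau>) = ?R \<sigma> \<otimes>\<^bsub>?L\<^esub> ?R \<tau>"
      unfolding m by (auto simp: inverse_limit_def)
  qed (rule R_in)
  show "bij_betw ?R (carrier top_hauts) (carrier ?L)"
    unfolding top_hauts_eq bij_betw_def
  proof
    show "inj_on ?R T.relative_hauts"
    proof (rule inj_onI)
      fix \<sigma> \<tau> assume st: "\<sigma> \<in> T.relative_hauts" "\<tau> \<in> T.relative_hauts" and eq: "?R \<sigma> = ?R \<tau>"
      have lr: "level_restrict \<sigma> N = level_restrict \<tau> N" if "N \<in> hyper_nat C" for N
        using fun_cong[OF eq, of N] that by simp
      have "\<sigma> b = \<tau> b" if b: "b \<in> TK" for b
      proof -
        obtain N where N: "N \<in> hyper_nat C" "b \<in> top_embed N ` TN N" by (rule top_embed_cover[OF b])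
        then obtain a where a: "a \<in> TN N" "b = top_embed N a" by blast
        then show ?thesis
          using level_restrict(2)[OF st(1) N(1) a(1)] level_restrict(2)[OF st(2) N(1) a(1)] lr[OF N(1)] by simp
      qed
      then show "\<sigma> = \<tau>" using st by (auto simp: T.relative_hauts_iff intro: extensionalityI)
    qed
    show "?R ` T.relative_hauts = carrier ?L"
    proof (intro equalityI subsetI)
      fix x assume x: "x \<in> carrier ?L"
      then have x': "\<And>N. N \<in> hyper_nat C \<Longrightarrow> x N \<in> carrier (level_hauts N)"
        "\<And>N M. N \<in> hyper_nat C \<Longrightarrow> M \<in> hyper_nat C \<Longrightarrow> hyper_less C N M \<Longrightarrow> haut_restrict C Ks \<Phi> M N (x M) = x N"
        "x \<in> extensional (hyper_nat C)"
        by (auto simp: inverse_limit_def PiE_iff)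
      obtain \<sigma> where \<sigma>: "\<sigma> \<in> T.relative_hauts"
        "\<And>N a. N \<in> hyper_nat C \<Longrightarrow> a \<in> TN N \<Longrightarrow> \<sigma> (top_embed N a) = top_embed N (x N a)"
        using glue[OF x'(1,2)] by blast
      have "level_restrict \<sigma> N = x N" if N: "N \<in> hyper_nat C" for N
      proof -
        interpret L: hyper_extension C Ks "val N" "reindex N Ks" F "reindex N \<Theta>" "\<lambda>i. guard (carrier F) (\<Theta> (val N i))"
          by (rule level_extension[OF N])
        have xN: "x N \<in> L.relative_hauts" using x'(1)[OF N] by (simp add: level_hauts_eq[OF N])
        have "level_restrict \<sigma> N a = x N a" if a: "a \<in> TN N" for a
          using a by (simp add: level_restrict_def \<sigma>(2)[OF N a] the_inv_into_f_f[OF top_embed_inj[OF N] L.\<sigma>_T[OF xN a]])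
        then show ?thesis
          using xN by (intro extensionalityI[of _ "TN N"]) (auto simp: level_restrict_def L.relative_hauts_iff)
      qed
      then have "x = ?R \<sigma>" by (intro extensionalityI[OF x'(3) restrict_extensional]) simp
      then show "x \<in> ?R ` T.relative_hauts" using \<sigma>(1) by blast
    qed (use R_in in auto)
  qed
qed

end

theorem theorem5p18:
  fixes F K :: "nat ring" and \<Psi> :: "nat \<Rightarrow> nat"
    and Ks :: "nat \<Rightarrow> nat ring" and \<Theta> \<Psi>s \<Phi> :: "nat \<Rightarrow> nat \<Rightarrow> nat"
    and G :: "nat \<Rightarrow> nat monoid" and res :: "nat \<Rightarrow> nat \<Rightarrow> nat \<Rightarrow> nat"
    and act :: "nat \<Rightarrow> nat \<Rightarrow> nat \<Rightarrow> nat" and C :: "nat set"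
  assumes "fully_computable_galois F K \<Psi> Ks \<Theta> \<Psi>s \<Phi> G res act"
    and "ring.infinite_dimension K (\<Psi> ` carrier F) (carrier K)"
    and "cohesive C"
  shows "haut_group C (\<lambda>_. Some K) F (\<lambda>_. Some \<Psi>) \<cong>
      inverse_limit (hyper_nat C) (hyper_less C)
        (\<lambda>N. haut_group C (reindex N Ks) F (reindex N \<Theta>)) (haut_restrict C Ks \<Phi>)
    \<and> inverse_limit (hyper_nat C) (hyper_less C)
        (\<lambda>N. haut_group C (reindex N Ks) F (reindex N \<Theta>)) (haut_restrict C Ks \<Phi>) \<cong>
      inverse_limit (hyper_nat C) (hyper_less C)
        (\<lambda>N. coh_prod_group C (reindex N G)) (coh_res C res)"
proof -
  interpret cohesive_galois F K \<Psi> Ks \<Theta> \<Psi>s \<Phi> G res act C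
    using assms(1,3) by (simp add: cohesive_galois_def cohesive_galois_axioms_def)
  show ?thesis
    using top_limit_iso level_limits_iso
    by (simp add: top_hauts_def level_hauts_def[abs_def] level_group_def[abs_def])
qed

end
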